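(* Let $\Omega\subset\mathbb{R}^d$ be a bounded $C^2$ domain equipped with heterogeneous localization functions $\eta_\delta$, $0<\delta<\delta_0$, and let $\rho$ be an admissible kernel (as defined in the context). Then there exists a constant $C=C(d,\rho,\Omega)$ such that for every $\delta\in(0,\delta_0)$ $$\|u\|^2_{\mathfrak{W}^{\delta,2}(\Omega)}\le C\,B_{\rho,\delta}(u,u)\qquad\text{for all }u\in\mathfrak{W}^{\delta,2}_0(\Omega).$$ Moreover, for any $f\in[\mathfrak{W}^{\delta,2}_0(\Omega)]^*$ there exists a unique $u\in\mathfrak{W}^{\delta,2}_0(\Omega)$ satisfying $$B_{\rho,\delta}(u,v)=\langle f,v\rangle\qquad\text{for all }v\in\mathfrak{W}^{\delta,2}_0(\Omega),$$ and it satisfies the energy estimate $\|u\|_{\mathfrak{W}^{\delta,2}(\Omega)}\le C(d,\rho,\Omega)\,\|f\|_{[\mathfrak{W}^{\delta,2}_0(\Omega)]^*}$.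
   Context: Domain and localization functions. $\Omega\subset\mathbb{R}^d$ is a bounded $C^2$ domain. There are constants $\kappa_0\in(0,1)$ and $\kappa_1,\kappa_2,\bar\kappa_0>0$ depending at most on $d$ and $\Omega$ and, with $\delta_0:=\min\{1,\frac{1}{9\kappa_1^2},\frac{1}{2\bar\kappa_0^2}\}$, for every $0<\delta<\delta_0$ a function $\eta_\delta:\overline\Omega\to[0,\infty)$, positive in $\Omega$, such that: (i) $\eta_\delta(x)=\operatorname{dist}(x,\partial\Omega)^2$ for $x\in\Omega$ with $\operatorname{dist}(x,\partial\Omega)^2<\kappa_0\delta$; (ii) $\eta_\delta(x)=\delta$ for $x\in\Omega$ with $\kappa_0\operatorname{dist}(x,\partial\Omega)^2>\delta$; (iii) $\eta_\delta\in C^2(\overline\Omega)$ with $|\nabla\eta_\delta|\le\kappa_1\sqrt\delta$ and $|\nabla^2\eta_\delta|\le\kappa_2$ in $\Omega$; (iv) $\eta_\delta(x)\le\bar\kappa_0\min\{\delta,\operatorname{dist}(x,\partial\Omega)^2\}$ in $\Omega$. These data are fixed with $\Omega$; a constant "depending on $\Omega$" may depend on $\kappa_0,\kappa_1,\kappa_2,\bar\kappa_0$ but not on $\delta$. Kernel. $\rho:[0,\infty)\to[0,\infty)$ is admissible if there are constants $0<\rho_0<\infty$ and $0<r_0<R_0<1$ such that $\rho\in C^1([0,\infty))$, $\rho\ge0$, $\lim_{r\to0^+}\rho'(r)/r$ exists, $\operatorname{supp}\rho\subset[0,R_0)$, and $\rho(r)\ge\rho_0$ for all $r\in[0,r_0]$.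 For $\alpha\in\mathbb{R}$ set $\rho_{\delta,\alpha}(x,y):=\frac12\Big[\frac{1}{\eta_\delta(x)^{d+\alpha}}\rho\big(\tfrac{|y-x|}{\eta_\delta(x)}\big)+\frac{1}{\eta_\delta(y)^{d+\alpha}}\rho\big(\tfrac{|y-x|}{\eta_\delta(y)}\big)\Big]$ and $B_{\rho,\delta}(u,v):=\int_\Omega\int_\Omega\rho_{\delta,2}(x,y)(u(x)-u(y))(v(x)-v(y))\,dy\,dx$. Function spaces. Fix a constant $R\in(0,1)$ (constants may depend on this fixed choice). $[u]_{\mathfrak{W}^{\delta,2}(\Omega)}^2:=\int_\Omega\int_{\Omega\cap\{|y-x|\le R\eta_\delta(x)\}}\frac{|u(x)-u(y)|^2}{\eta_\delta(x)^{d+2}}\,dy\,dx$, $\|u\|_{\mathfrak{W}^{\delta,2}(\Omega)}^2:=\|u\|_{L^2(\Omega)}^2+[u]_{\mathfrak{W}^{\delta,2}(\Omega)}^2$; $\mathfrak{W}^{\delta,2}_0(\Omega)$ is the closure of $C^\infty_c(\Omega)$ in this norm. *)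

theory Defs
  imports "HOL-Analysis.Analysis"
begin

section \<open>Differentiability classes\<close>

definition partial_deriv :: "'a::euclidean_space \<Rightarrow> ('a \<Rightarrow> real) \<Rightarrow> 'a \<Rightarrow> real" where
  "partial_deriv b f x = frechet_derivative f (at x) b"

text \<open>Intended for open sets only; derivatives are taken at full neighbourhoods.\<close>

primrec Ck_on :: "nat \<Rightarrow> ('a::euclidean_space \<Rightarrow> real) \<Rightarrow> 'a set \<Rightarrow> bool" where
  "Ck_on 0 f S \<longleftrightarrow> continuous_on S f"
| "Ck_on (Suc k) f S \<longleftrightarrow>
     (\<forall>x\<in>S. f differentiable (at x)) \<and> (\<forall>b\<in>Basis. Ck_on k (partial_deriv b f) S)"

definition gradient :: "('a::euclidean_space \<Rightarrow> real) \<Rightarrow> 'a \<Rightarrow> 'a" where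
  "gradient f x = (\<Sum>b\<in>Basis. partial_deriv b f x *\<^sub>R b)"

text \<open>Euclidean (Frobenius) norm of the Hessian matrix.\<close>

definition hessian_norm :: "('a::euclidean_space \<Rightarrow> real) \<Rightarrow> 'a \<Rightarrow> real" where
  "hessian_norm f x = sqrt (\<Sum>b\<in>Basis. \<Sum>c\<in>Basis. (partial_deriv c (partial_deriv b f) x)\<^sup>2)"

definition extends_continuously :: "'a::euclidean_space set \<Rightarrow> ('a \<Rightarrow> real) \<Rightarrow> bool" where
  "extends_continuously \<Omega> f \<longleftrightarrow> (\<exists>g. continuous_on (closure \<Omega>) g \<and> (\<forall>x\<in>\<Omega>. g x = f x))"

text \<open>\<open>C\<^sup>2\<close> up to the boundary: \<open>f\<close> is \<open>C\<^sup>2\<close> in the open set \<open>\<Omega>\<close>, and \<open>f\<close> and all its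
  derivatives of order at most two extend continuously to the closure (\<open>f\<close> by its own values).\<close>

definition C2_closure :: "'a::euclidean_space set \<Rightarrow> ('a \<Rightarrow> real) \<Rightarrow> bool" where
  "C2_closure \<Omega> f \<longleftrightarrow>
     Ck_on 2 f \<Omega> \<and> continuous_on (closure \<Omega>) f \<and>
     (\<forall>b\<in>Basis. extends_continuously \<Omega> (partial_deriv b f)) \<and>
     (\<forall>b\<in>Basis. \<forall>c\<in>Basis. extends_continuously \<Omega> (partial_deriv c (partial_deriv b f)))"

definition test_function :: "'a::euclidean_space set \<Rightarrow> ('a \<Rightarrow> real) \<Rightarrow> bool" where
  "test_function \<Omega> \<phi> \<longleftrightarrow>
     (\<forall>k. Ck_on k \<phi> UNIV) \<and> compact (closure {x. \<phi> x \<noteq> 0}) \<and> closure {x. \<phi> x \<noteq> 0} \<subseteq> \<Omega>"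

section \<open>Domain, localization functions and kernel\<close>

text \<open>Near each boundary point, \<open>\<Omega>\<close> is the region above the graph of a \<open>C\<^sup>2\<close> function over
  the hyperplane orthogonal to some unit vector \<open>e\<close>.  The point \<open>x - (x \<bullet> e) *\<^sub>R e\<close> is the
  orthogonal projection of \<open>x\<close> to that hyperplane, so only the restriction of \<open>\<gamma>\<close> to the
  hyperplane matters.\<close>

definition C2_boundary :: "'a::euclidean_space set \<Rightarrow> bool" where
  "C2_boundary \<Omega> \<longleftrightarrow>
     (\<forall>p\<in>frontier \<Omega>. \<exists>r>0. \<exists>e. norm e = 1 \<and> (\<exists>\<gamma>. Ck_on 2 \<gamma> UNIV \<and>
        \<Omega> \<inter> ball p r = {x \<in> ball p r. x \<bullet> e > \<gamma> (x - (x \<bullet> e) *\<^sub>R e)}))"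

definition bounded_C2_domain :: "'a::euclidean_space set \<Rightarrow> bool" where
  "bounded_C2_domain \<Omega> \<longleftrightarrow>
     open \<Omega> \<and> connected \<Omega> \<and> \<Omega> \<noteq> {} \<and> bounded \<Omega> \<and> C2_boundary \<Omega>"

definition bdist :: "'a::euclidean_space set \<Rightarrow> 'a \<Rightarrow> real" where
  "bdist \<Omega> x = infdist x (frontier \<Omega>)"

definition delta0 :: "real \<Rightarrow> real \<Rightarrow> real" where
  "delta0 \<kappa>1 \<kappa>bar = Min {1, 1 / (9 * \<kappa>1\<^sup>2), 1 / (2 * \<kappa>bar\<^sup>2)}"

definition localization_functions ::
  "'a::euclidean_space set \<Rightarrow> real \<Rightarrow> real \<Rightarrow> real \<Rightarrow> real \<Rightarrow> (real \<Rightarrow> 'a \<Rightarrow> real) \<Rightarrow> bool" where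
  "localization_functions \<Omega> \<kappa>0 \<kappa>1 \<kappa>2 \<kappa>bar \<eta> \<longleftrightarrow>
     (\<forall>\<delta>. 0 < \<delta> \<and> \<delta> < delta0 \<kappa>1 \<kappa>bar \<longrightarrow>
        (\<forall>x\<in>closure \<Omega>. 0 \<le> \<eta> \<delta> x) \<and> (\<forall>x\<in>\<Omega>. 0 < \<eta> \<delta> x) \<and>
        (\<forall>x\<in>\<Omega>. (bdist \<Omega> x)\<^sup>2 < \<kappa>0 * \<delta> \<longrightarrow> \<eta> \<delta> x = (bdist \<Omega> x)\<^sup>2) \<and>
        (\<forall>x\<in>\<Omega>. \<kappa>0 * (bdist \<Omega> x)\<^sup>2 > \<delta> \<longrightarrow> \<eta> \<delta> x = \<delta>) \<and>
        C2_closure \<Omega> (\<eta> \<delta>) \<and>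
        (\<forall>x\<in>\<Omega>. norm (gradient (\<eta> \<delta>) x) \<le> \<kappa>1 * sqrt \<delta>) \<and>
        (\<forall>x\<in>\<Omega>. hessian_norm (\<eta> \<delta>) x \<le> \<kappa>2) \<and>
        (\<forall>x\<in>\<Omega>. \<eta> \<delta> x \<le> \<kappa>bar * min \<delta> ((bdist \<Omega> x)\<^sup>2)))"

text \<open>Only the values of \<open>\<rho>\<close> on \<open>[0,\<infinity>)\<close> matter; \<open>\<rho>'\<close> is one-sided at \<open>0\<close>.\<close>

definition admissible_kernel :: "(real \<Rightarrow> real) \<Rightarrow> bool" where
  "admissible_kernel \<rho> \<longleftrightarrow>
     (\<exists>\<rho>0 r0 R0. 0 < \<rho>0 \<and> 0 < r0 \<and> r0 < R0 \<and> R0 < 1 \<and>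
        (\<exists>\<rho>'. (\<forall>r\<ge>0. (\<rho> has_real_derivative \<rho>' r) (at r within {0..})) \<and>
               continuous_on {0..} \<rho>' \<and>
               (\<exists>L. ((\<lambda>r. \<rho>' r / r) \<longlongrightarrow> L) (at_right 0))) \<and>
        (\<forall>r\<ge>0. 0 \<le> \<rho> r) \<and>
        closure {r. 0 \<le> r \<and> \<rho> r \<noteq> 0} \<subseteq> {0..<R0} \<and>
        (\<forall>r\<in>{0..r0}. \<rho>0 \<le> \<rho> r))"

text \<open>From here on, \<open>\<eta> :: 'a \<Rightarrow> real\<close> is a single localization function \<open>\<eta>\<^sub>\<delta>\<close>.\<close>

definition loc_kernel :: "(real \<Rightarrow> real) \<Rightarrow> ('a::euclidean_space \<Rightarrow> real) \<Rightarrow> real \<Rightarrow> 'a \<Rightarrow> 'a \<Rightarrow> real" where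
  "loc_kernel \<rho> \<eta> \<alpha> x y =
     (1/2) * (1 / (\<eta> x powr (real DIM('a) + \<alpha>)) * \<rho> (norm (y - x) / \<eta> x)
            + 1 / (\<eta> y powr (real DIM('a) + \<alpha>)) * \<rho> (norm (y - x) / \<eta> y))"

definition B_form ::
  "'a::euclidean_space set \<Rightarrow> (real \<Rightarrow> real) \<Rightarrow> ('a \<Rightarrow> real) \<Rightarrow> ('a \<Rightarrow> real) \<Rightarrow> ('a \<Rightarrow> real) \<Rightarrow> real" where
  "B_form \<Omega> \<rho> \<eta> u v =
     (LINT x|lebesgue_on \<Omega>. (LINT y|lebesgue_on \<Omega>.
        loc_kernel \<rho> \<eta> 2 x y * (u x - u y) * (v x - v y)))"

section \<open>Function spaces\<close>

text \<open>Elements of the spaces are represented by functions \<open>u :: 'a \<Rightarrow> real\<close> that are Lebesgue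
  measurable on \<open>\<Omega>\<close>; values outside \<open>\<Omega>\<close> are irrelevant, and functions that agree almost
  everywhere in \<open>\<Omega>\<close> represent the same element.\<close>

definition W_seminorm2 :: "'a::euclidean_space set \<Rightarrow> real \<Rightarrow> ('a \<Rightarrow> real) \<Rightarrow> ('a \<Rightarrow> real) \<Rightarrow> ennreal" where
  "W_seminorm2 \<Omega> R \<eta> u =
     (\<integral>\<^sup>+x. (\<integral>\<^sup>+y. ennreal (\<bar>u x - u y\<bar>\<^sup>2 / \<eta> x ^ (DIM('a) + 2))
        \<partial>lebesgue_on (\<Omega> \<inter> {y. norm (y - x) \<le> R * \<eta> x})) \<partial>lebesgue_on \<Omega>)"

definition W_norm2 :: "'a::euclidean_space set \<Rightarrow> real \<Rightarrow> ('a \<Rightarrow> real) \<Rightarrow> ('a \<Rightarrow> real) \<Rightarrow> ennreal" where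
  "W_norm2 \<Omega> R \<eta> u = (\<integral>\<^sup>+x. ennreal ((u x)\<^sup>2) \<partial>lebesgue_on \<Omega>) + W_seminorm2 \<Omega> R \<eta> u"

definition W_space :: "'a::euclidean_space set \<Rightarrow> real \<Rightarrow> ('a \<Rightarrow> real) \<Rightarrow> ('a \<Rightarrow> real) set" where
  "W_space \<Omega> R \<eta> = {u \<in> borel_measurable (lebesgue_on \<Omega>). W_norm2 \<Omega> R \<eta> u < \<infinity>}"

definition W_norm :: "'a::euclidean_space set \<Rightarrow> real \<Rightarrow> ('a \<Rightarrow> real) \<Rightarrow> ('a \<Rightarrow> real) \<Rightarrow> real" where
  "W_norm \<Omega> R \<eta> u = sqrt (enn2real (W_norm2 \<Omega> R \<eta> u))"

text \<open>Closure of the test functions.  The comparison is made in \<open>ennreal\<close>, so that an infinite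
  norm of \<open>u - \<phi>\<close> does not count as small.\<close>

definition W0_space :: "'a::euclidean_space set \<Rightarrow> real \<Rightarrow> ('a \<Rightarrow> real) \<Rightarrow> ('a \<Rightarrow> real) set" where
  "W0_space \<Omega> R \<eta> =
     {u \<in> W_space \<Omega> R \<eta>. \<forall>\<epsilon>>0. \<exists>\<phi>. test_function \<Omega> \<phi> \<and>
        W_norm2 \<Omega> R \<eta> (\<lambda>x. u x - \<phi> x) < ennreal (\<epsilon>\<^sup>2)}"

text \<open>Bounded linear functionals.  Linearity and boundedness force \<open>f u = f v\<close> whenever
  \<open>u = v\<close> almost everywhere in \<open>\<Omega>\<close>, so \<open>f\<close> acts on equivalence classes.\<close>

definition W0_dual :: "'a::euclidean_space set \<Rightarrow> real \<Rightarrow> ('a \<Rightarrow> real) \<Rightarrow> (('a \<Rightarrow> real) \<Rightarrow> real) set" where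
  "W0_dual \<Omega> R \<eta> =
     {f. (\<forall>u\<in>W0_space \<Omega> R \<eta>. \<forall>v\<in>W0_space \<Omega> R \<eta>. f (\<lambda>x. u x + v x) = f u + f v) \<and>
         (\<forall>c. \<forall>u\<in>W0_space \<Omega> R \<eta>. f (\<lambda>x. c * u x) = c * f u) \<and>
         (\<exists>K. \<forall>u\<in>W0_space \<Omega> R \<eta>. \<bar>f u\<bar> \<le> K * W_norm \<Omega> R \<eta> u)}"

definition W0_dual_norm ::
  "'a::euclidean_space set \<Rightarrow> real \<Rightarrow> ('a \<Rightarrow> real) \<Rightarrow> (('a \<Rightarrow> real) \<Rightarrow> real) \<Rightarrow> real" where
  "W0_dual_norm \<Omega> R \<eta> f = (SUP u\<in>{u \<in> W0_space \<Omega> R \<eta>. W_norm \<Omega> R \<eta> u \<le> 1}. \<bar>f u\<bar>)"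

definition weak_solution ::
  "'a::euclidean_space set \<Rightarrow> real \<Rightarrow> (real \<Rightarrow> real) \<Rightarrow> ('a \<Rightarrow> real) \<Rightarrow> (('a \<Rightarrow> real) \<Rightarrow> real) \<Rightarrow> ('a \<Rightarrow> real) \<Rightarrow> bool" where
  "weak_solution \<Omega> R \<rho> \<eta> f u \<longleftrightarrow>
     u \<in> W0_space \<Omega> R \<eta> \<and> (\<forall>v\<in>W0_space \<Omega> R \<eta>. B_form \<Omega> \<rho> \<eta> u v = f v)"

end

theory Submission
  imports Defs
begin

text \<open>
  Write \<open>A x y = \<eta> x ^ (-d-2) \<psi> (norm (y - x) / \<eta> x)\<close>. Since \<open>\<eta>\<close> is 1/3-Lipschitz on the balls
  \<open>ball x (\<eta> x) \<subseteq> \<Omega>\<close>, energies with different horizons \<open>R, R' < 1\<close> are comparable: split each increment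
  into many small ones.

  For the Poincare inequality, uniform in \<open>\<delta>\<close>, test against the supersolution
  \<open>w x = M - exp (l (b \<bullet> x))\<close> with \<open>M\<close> large:
  the Picone inequality \<open>(u x - u y)\<^sup>2 \<ge> (w x - w y) ((u x)\<^sup>2 / w x - (u y)\<^sup>2 / w y)\<close> bounds the energy below
  by the integral over \<open>x\<close> of \<open>(u x)\<^sup>2 / w x\<close> times the integral over \<open>y\<close> of
  \<open>(A x y + A y x) (exp (l (b \<bullet> y)) - exp (l (b \<bullet> x)))\<close>. The even kernel \<open>A x\<close> contributes at
  least a multiple of \<open>l\<^sup>2\<close>, while \<open>exp s - 1 \<ge> s\<close> leaves of the adjoint kernel only its first moment times \<open>l\<close>.
  That first moment is bounded by the Hessian bound for \<open>\<eta>\<close>: it would vanish for affine \<open>\<eta>\<close>, because along each ray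
  the integrand is an exact derivative. Then \<open>l\<close> is chosen large. No regularity of the boundary is used.

  Density gives the inequality on the closure of the test functions. The form is thus equivalent to the squared norm
  there, and Riesz representation applies.\<close>

section \<open>Integration over translates, dilates and rays\<close>

text \<open>The kernel \<open>A x y\<close> carries its scale at one point only and is not
  symmetric, so a nonlocal integration by parts brings in its adjoint \<open>A y x\<close>, whose
  mean displacement acts as a drift. A Lipschitz bound controls this drift only by |grad \<eta>| /
  \<eta>. Near the boundary \<eta> is the squared distance and its gradient is of the order of the
  distance, so this is of order \<eta>^(-1/2) and blows up; where \<eta> is of order \<delta>, the
  bound degenerates as \<delta> tends to 0. This is the obstacle that the cancellation along rays
  removes: it leaves second derivatives of \<eta> only, and their bound \<open>\<kappa>2\<close> is
  independent of \<delta>. The second moment of the kernel, in contrast, has the same size at every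
  scale because of the exponent d + 2, so that a steep enough exponential outweighs a bounded drift.
  Change of horizon allows this to be done for one fixed profile, \<open>hat\<close>, instead of
  \<rho>. Test functions stay away from the boundary, which makes the signed double integrals
  absolutely convergent; how far they stay away does not enter the constant.\<close>

lemma nn_integral_lborel_translate:
  fixes f :: "'a::euclidean_space \<Rightarrow> ennreal"
  assumes "f \<in> borel_measurable borel"
  shows "(\<integral>\<^sup>+x. f (a + x) \<partial>lborel) = (\<integral>\<^sup>+x. f x \<partial>lborel)"
proof -
  have "(\<integral>\<^sup>+x. f x \<partial>lborel) = (\<integral>\<^sup>+x. f x \<partial>distr lborel borel ((+) a))"
    by (simp add: lborel_distr_plus)
  also have "\<dots> = (\<integral>\<^sup>+x. f (a + x) \<partial>lborel)"
    using assms by (subst nn_integral_distr) auto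
  finally show ?thesis by simp
qed

lemma nn_integral_lborel_scale:
  fixes f :: "'a::euclidean_space \<Rightarrow> ennreal"
  assumes [measurable]: "f \<in> borel_measurable borel" and "c \<noteq> 0"
  shows "(\<integral>\<^sup>+x. f x \<partial>lborel) = ennreal (\<bar>c\<bar> ^ DIM('a)) * (\<integral>\<^sup>+x. f (c *\<^sub>R x) \<partial>lborel)"
proof -
  have "(\<integral>\<^sup>+x. f x \<partial>lborel) = (\<integral>\<^sup>+x. f x \<partial>density (distr lborel borel (\<lambda>x::'a. 0 + c *\<^sub>R x)) (\<lambda>_. ennreal (\<bar>c\<bar> ^ DIM('a))))"
    using lborel_affine[OF \<open>c \<noteq> 0\<close>, of "0::'a"] by simp
  also have "\<dots> = ennreal (\<bar>c\<bar> ^ DIM('a)) * (\<integral>\<^sup>+x. f (c *\<^sub>R x) \<partial>lborel)"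
    by (subst nn_integral_density) (simp_all add: nn_integral_distr nn_integral_cmult)
  finally show ?thesis .
qed

lemma nn_integral_lborel_reflect:
  fixes f :: "'a::euclidean_space \<Rightarrow> ennreal"
  assumes "f \<in> borel_measurable borel"
  shows "(\<integral>\<^sup>+x. f (- x) \<partial>lborel) = (\<integral>\<^sup>+x. f x \<partial>lborel)"
  using nn_integral_lborel_scale[OF assms, of "-1"] by simp

lemma nn_integral_inverse_dyadic:
  assumes "a > 0"
  shows "(\<integral>\<^sup>+t. ennreal (1 / t) * indicator {a / 2..a} t \<partial>lborel) = ennreal (ln 2)"
proof -
  have "(\<integral>\<^sup>+t. ennreal (1 / t) * indicator {a / 2..a} t \<partial>lborel) = ennreal (ln a - ln (a / 2))"
    using assms by (intro nn_integral_FTC_Icc) (auto intro!: derivative_eq_intros simp: field_simps)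
  also have "ln a - ln (a / 2) = ln 2"
    using assms by (simp add: ln_div)
  finally show ?thesis .
qed

text \<open>Integration along rays without a surface measure: average over dyadic annuli, using
  \<open>\<integral> dt / t = ln 2\<close> over the scales \<open>t\<close> with \<open>t \<le> norm h \<le> 2 t\<close>.\<close>

lemma nn_integral_rays:
  fixes f :: "'a::euclidean_space \<Rightarrow> ennreal"
  assumes [measurable]: "f \<in> borel_measurable borel"
  shows "ennreal (ln 2) * (\<integral>\<^sup>+h. f h \<partial>lborel) =
    (\<integral>\<^sup>+k. indicator {k. 1 \<le> norm k \<and> norm k \<le> 2} k *
       (\<integral>\<^sup>+t. indicator {0<..} t * (ennreal (t ^ (DIM('a) - 1)) * f (t *\<^sub>R k)) \<partial>lborel) \<partial>lborel)"
    (is "_ = (\<integral>\<^sup>+k. ?W k * (\<integral>\<^sup>+t. ?P t * (?p t * f (t *\<^sub>R k)) \<partial>lborel) \<partial>lborel)")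
proof -
  have [measurable]: "{k::'a. 1 \<le> norm k \<and> norm k \<le> 2} \<in> sets borel" by measurable
  define Q where "Q = (\<lambda>t (h::'a). indicator {0<..} t * (ennreal (1/t) * indicator {h. t \<le> norm h \<and> norm h \<le> 2 * t} h) :: ennreal)"
  have Qeq: "Q t h = (if 0 < t \<and> t \<le> norm h \<and> norm h \<le> 2 * t then ennreal (1/t) else 0)" for t h
    by (auto simp: Q_def)
  have [measurable]: "(\<lambda>(t, h). Q t h) \<in> borel_measurable (lborel \<Otimes>\<^sub>M lborel)"
    unfolding Qeq by measurable
  have ray: "(\<integral>\<^sup>+t. Q t h \<partial>lborel) = ennreal (ln 2)" if "h \<noteq> 0" for h
  proof -
    have "Q t h = ennreal (1 / t) * indicator {norm h / 2..norm h} t" for t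
      using that by (auto simp: Qeq indicator_def)
    then show ?thesis using that by (simp add: nn_integral_inverse_dyadic)
  qed
  have ae: "AE h in lborel. h \<noteq> (0::'a)"
    by (rule AE_lborel_singleton)
  have "ennreal (ln 2) * (\<integral>\<^sup>+h. f h \<partial>lborel) = (\<integral>\<^sup>+h. ennreal (ln 2) * f h \<partial>lborel)"
    by (simp add: nn_integral_cmult)
  also have "\<dots> = (\<integral>\<^sup>+h. (\<integral>\<^sup>+t. Q t h * f h \<partial>lborel) \<partial>lborel)"
    using ae by (intro nn_integral_cong_AE) (auto simp: nn_integral_multc ray)
  also have "\<dots> = (\<integral>\<^sup>+t. (\<integral>\<^sup>+h. Q t h * f h \<partial>lborel) \<partial>lborel)"
    by (rule lborel_pair.Fubini') measurable
  also have "\<dots> = (\<integral>\<^sup>+t. (\<integral>\<^sup>+k. ?W k * (?P t * (?p t * f (t *\<^sub>R k))) \<partial>lborel) \<partial>lborel)"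
  proof (rule nn_integral_cong)
    fix t :: real
    show "(\<integral>\<^sup>+h. Q t h * f h \<partial>lborel) = (\<integral>\<^sup>+k. ?W k * (?P t * (?p t * f (t *\<^sub>R k))) \<partial>lborel)"
    proof (cases "t > 0")
      case False
      then show ?thesis by (simp add: Qeq)
    next
      case True
      \<comment> \<open>Dilation by \<open>t\<close> contributes \<open>t ^ DIM('a)\<close>, which
        the weight \<open>1 / t\<close> in \<open>Q\<close> lowers to the radial Jacobian.\<close>
      have p: "ennreal (t ^ DIM('a)) * ennreal (1 / t) = ?p t"
        using True power_minus_mult[of "DIM('a)" t] by (subst ennreal_mult[symmetric]) (auto simp: field_simps)
      have "(\<integral>\<^sup>+h. Q t h * f h \<partial>lborel) = ennreal (t ^ DIM('a)) * (\<integral>\<^sup>+k. Q t (t *\<^sub>R k) * f (t *\<^sub>R k) \<partial>lborel)"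
        using True by (subst nn_integral_lborel_scale[of _ t]) (auto simp: Qeq)
      also have "\<dots> = (\<integral>\<^sup>+k. ennreal (t ^ DIM('a)) * (Q t (t *\<^sub>R k) * f (t *\<^sub>R k)) \<partial>lborel)"
        by (subst nn_integral_cmult) (auto simp: Qeq)
      also have "\<dots> = (\<integral>\<^sup>+k. ?W k * (?P t * (?p t * f (t *\<^sub>R k))) \<partial>lborel)"
        using True p by (intro nn_integral_cong) (auto simp: Qeq indicator_def simp flip: mult.assoc)
      finally show ?thesis .
    qed
  qed
  also have "\<dots> = (\<integral>\<^sup>+k. (\<integral>\<^sup>+t. ?W k * (?P t * (?p t * f (t *\<^sub>R k))) \<partial>lborel) \<partial>lborel)"
    by (rule lborel_pair.Fubini') measurable
  also have "\<dots> = (\<integral>\<^sup>+k. ?W k * (\<integral>\<^sup>+t. ?P t * (?p t * f (t *\<^sub>R k)) \<partial>lborel) \<partial>lborel)"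
    by (intro nn_integral_cong nn_integral_cmult) measurable
  finally show ?thesis .
qed

lemma telescope_square:
  fixes a :: "nat \<Rightarrow> real"
  shows "(a 0 - a N)\<^sup>2 \<le> real N * (\<Sum>j<N. (a j - a (Suc j))\<^sup>2)"
proof -
  have "a 0 - a N = (\<Sum>j<N. a j - a (Suc j))"
    by (induction N) auto
  also have "(\<Sum>j<N. a j - a (Suc j))\<^sup>2 \<le> (\<Sum>j<N. (a j - a (Suc j))\<^sup>2) * (\<Sum>j<N. 1\<^sup>2)"
    using Cauchy_Schwarz_ineq_sum[of "\<lambda>j. a j - a (Suc j)" "\<lambda>_. 1" "{..<N}"] by simp
  finally show ?thesis by (simp add: mult.commute)
qed

section \<open>Localized kernels and change of the horizon\<close>

text \<open>The two indicators confine everything to \<Omega>, so that translations and Fubini act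
  on \<open>lborel\<close> over the whole space. The scale sits at the first argument; exchanging
  the arguments gives the adjoint kernel.\<close>

definition akernel :: "'a::euclidean_space set \<Rightarrow> ('a \<Rightarrow> real) \<Rightarrow> (real \<Rightarrow> real) \<Rightarrow> 'a \<Rightarrow> 'a \<Rightarrow> real" where
  "akernel \<Omega> \<eta> \<psi> x y = indicator \<Omega> x * indicator \<Omega> y * (\<psi> (norm (y - x) / \<eta> x) / \<eta> x ^ (DIM('a) + 2))"

definition energy :: "'a::euclidean_space set \<Rightarrow> ('a \<Rightarrow> real) \<Rightarrow> (real \<Rightarrow> real) \<Rightarrow> ('a \<Rightarrow> real) \<Rightarrow> ennreal" where
  "energy \<Omega> \<eta> \<psi> u = (\<integral>\<^sup>+x. \<integral>\<^sup>+y. ennreal (akernel \<Omega> \<eta> \<psi> x y * (u x - u y)\<^sup>2) \<partial>lborel \<partial>lborel)"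

text \<open>What the estimates use of a localization function, with constants free of \<delta>. In
  \<open>eta_second\<close> the gradient is taken at the far end \<open>x + h\<close>, because along
  a ray from \<open>x\<close> the quantity that appears is \<eta> minus its radial derivative times
  the parameter, both at the moving point.\<close>

locale localization =
  fixes \<Omega> :: "'a::euclidean_space set" and \<eta> :: "'a \<Rightarrow> real" and G :: "'a \<Rightarrow> 'a" and \<kappa> :: real
  assumes open_dom: "open \<Omega>" and bounded_dom: "bounded \<Omega>" and kappa: "0 \<le> \<kappa>"
    and eta_pos: "x \<in> \<Omega> \<Longrightarrow> 0 < \<eta> x"
    and ball_dom: "x \<in> \<Omega> \<Longrightarrow> norm h < \<eta> x \<Longrightarrow> x + h \<in> \<Omega>"
    and eta_lip: "x \<in> \<Omega> \<Longrightarrow> norm h < \<eta> x \<Longrightarrow> \<bar>\<eta> (x + h) - \<eta> x\<bar> \<le> norm h / 3"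
    and eta_deriv: "x \<in> \<Omega> \<Longrightarrow> (\<eta> has_derivative (\<lambda>h. G x \<bullet> h)) (at x)"
    and eta_second: "x \<in> \<Omega> \<Longrightarrow> norm h < \<eta> x \<Longrightarrow> \<bar>\<eta> (x + h) - G (x + h) \<bullet> h - \<eta> x\<bar> \<le> \<kappa> * (norm h)\<^sup>2"
begin

lemma dom_borel [measurable]: "\<Omega> \<in> sets borel"
  using open_dom by simp

lemma eta_cont: "continuous_on \<Omega> \<eta>"
  using eta_deriv has_derivative_continuous by (blast intro: continuous_at_imp_continuous_on)

lemma eta_measurable [measurable]: "(\<lambda>x. indicator \<Omega> x * \<eta> x) \<in> borel_measurable borel"
  using borel_measurable_continuous_on_indicator[OF _ eta_cont] by simp

lemma akernel_measurable [measurable]: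
  assumes [measurable]: "\<psi> \<in> borel_measurable borel" "f \<in> M \<rightarrow>\<^sub>M borel" "g \<in> M \<rightarrow>\<^sub>M borel"
  shows "(\<lambda>p. akernel \<Omega> \<eta> \<psi> (f p) (g p)) \<in> borel_measurable M"
proof -
  \<comment> \<open>Measurability of \<open>\<eta>\<close> is available on \<Omega> only; the factor
    \<open>indicator \<Omega> x\<close> allows replacing it by its truncation.\<close>
  have eq: "akernel \<Omega> \<eta> \<psi> x y = indicator \<Omega> x * indicator \<Omega> y *
     (\<psi> (norm (y - x) / (indicator \<Omega> x * \<eta> x)) / (indicator \<Omega> x * \<eta> x) ^ (DIM('a) + 2))" for x y
    by (simp add: akernel_def indicator_def)
  have [measurable]: "(\<lambda>p. indicator \<Omega> (f p) * \<eta> (f p)) \<in> borel_measurable M"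
    by (rule measurable_compose[OF _ eta_measurable]) simp
  show ?thesis unfolding eq by measurable
qed

lemma akernel_nonneg: "(\<And>t. 0 \<le> t \<Longrightarrow> 0 \<le> \<psi> t) \<Longrightarrow> 0 \<le> akernel \<Omega> \<eta> \<psi> x y"
  using eta_pos[of x] by (cases "x \<in> \<Omega>") (auto simp: akernel_def intro!: mult_nonneg_nonneg)

text \<open>With the displacement \<open>h\<close> outermost, each inner integral over
  \<open>x\<close> can be translated separately, as the chaining in \<open>energy_radius\<close>
  requires.\<close>

lemma energy_shift:
  assumes [measurable]: "\<psi> \<in> borel_measurable borel" "u \<in> borel_measurable borel"
  shows "energy \<Omega> \<eta> \<psi> u =
    (\<integral>\<^sup>+h. \<integral>\<^sup>+x. ennreal (akernel \<Omega> \<eta> \<psi> x (x + h) * (u x - u (x + h))\<^sup>2) \<partial>lborel \<partial>lborel)"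
proof -
  have "energy \<Omega> \<eta> \<psi> u =
    (\<integral>\<^sup>+x. \<integral>\<^sup>+h. ennreal (akernel \<Omega> \<eta> \<psi> x (x + h) * (u x - u (x + h))\<^sup>2) \<partial>lborel \<partial>lborel)"
    unfolding energy_def
    by (intro nn_integral_cong nn_integral_lborel_translate[symmetric]) measurable
  also have "\<dots> = (\<integral>\<^sup>+h. \<integral>\<^sup>+x. ennreal (akernel \<Omega> \<eta> \<psi> x (x + h) * (u x - u (x + h))\<^sup>2) \<partial>lborel \<partial>lborel)"
    by (rule lborel_pair.Fubini') measurable
  finally show ?thesis .
qed

text \<open>A displacement within horizon \<open>R'\<close> is cut into \<open>N\<close> steps along
  the segment, which stays in \<Omega> because \<open>R' < 1\<close>. At every chain point \<eta>
  lies between 2/3 and 4/3 of its value at \<open>x\<close>: the lower bound and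
  \<open>3 * R' \<le> 2 * real N * R\<close> put each step within horizon \<open>R\<close> of its
  own starting point, the upper bound gives the power of 4/3. Of the factor
  \<open>real N ^ (DIM('a) + 2)\<close>, one \<open>N\<close> comes from
  \<open>telescope_square\<close>, one counts the steps, whose integrals agree after translation,
  and \<open>N ^ DIM('a)\<close> is the Jacobian of rescaling \<open>h\<close>.\<close>

lemma energy_radius:
  assumes [measurable]: "u \<in> borel_measurable borel"
    and "0 < R" "0 < R'" "R' < 1" "N > 0" "3 * R' \<le> 2 * real N * R"
  shows "energy \<Omega> \<eta> (indicator {..R'}) u \<le>
    ennreal (real N ^ (DIM('a) + 2) * (4/3) ^ (DIM('a) + 2)) * energy \<Omega> \<eta> (indicator {..R}) u"
proof -
  define K' where "K' = akernel \<Omega> \<eta> (indicator {..R'})"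
  define K where "K = akernel \<Omega> \<eta> (indicator {..R})"
  have [measurable]: "(\<lambda>p. K (f p) (g p)) \<in> borel_measurable M" "(\<lambda>p. K' (f p) (g p)) \<in> borel_measurable M"
    if [measurable]: "f \<in> M \<rightarrow>\<^sub>M borel" "g \<in> M \<rightarrow>\<^sub>M borel" for f g and M :: "'b measure"
    unfolding K_def K'_def by measurable
  define q where "q = ((4/3) ^ (DIM('a) + 2) :: real)"
  have q: "q \<ge> 0" by (simp add: q_def)
  define X where "X = (\<lambda>(x::'a) h j. x + (real j / real N) *\<^sub>R h)"
  have X0: "X x h 0 = x" and XN: "X x h N = x + h" for x h
    using \<open>N > 0\<close> by (simp_all add: X_def)
  have XS: "X x h (Suc j) = X x h j + (1 / real N) *\<^sub>R h" for x h j
    by (simp add: X_def add_divide_distrib scaleR_left_distrib)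
  have Kle: "K' x (x + h) \<le> q * K (X x h j) (X x h (Suc j))" if j: "j < N" for x h j
  proof (cases "x \<in> \<Omega> \<and> norm h \<le> R' * \<eta> x")
    case False
    have "K' x (x + h) = 0"
      using False eta_pos[of x] by (auto simp: K'_def akernel_def indicator_def pos_divide_le_eq)
    moreover have "K (X x h j) (X x h (Suc j)) \<ge> 0"
      unfolding K_def by (rule akernel_nonneg) auto
    ultimately show ?thesis using q by simp
  next
    case True
    then have x: "x \<in> \<Omega>" and h: "norm h \<le> R' * \<eta> x" by auto
    note e = eta_pos[OF x]
    have R'e: "R' * \<eta> x < \<eta> x" using e \<open>R' < 1\<close> by simp
    have nm: "norm ((real i / real N) *\<^sub>R h) \<le> norm h" if "i \<le> N" for i
      using that \<open>N > 0\<close> mult_right_mono[of "real i" "real N" "norm h"] by (simp add: field_simps)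
    have in1: "X x h i \<in> \<Omega>" if "i \<le> N" for i
      unfolding X_def using nm[OF that] h R'e by (intro ball_dom x) linarith
    define y where "y = X x h j"
    have y: "y \<in> \<Omega>" unfolding y_def using in1 j by simp
    have "\<bar>\<eta> y - \<eta> x\<bar> \<le> norm ((real j / real N) *\<^sub>R h) / 3"
      unfolding y_def X_def using nm[of j] h R'e j by (intro eta_lip x) linarith
    then have ey: "\<bar>\<eta> y - \<eta> x\<bar> \<le> \<eta> x / 3"
      using nm[of j] h R'e j by linarith
    have ey1: "\<eta> y \<le> 4/3 * \<eta> x" and ey2: "2/3 * \<eta> x \<le> \<eta> y" using ey by linarith+
    note eyp = eta_pos[OF y]
    have "norm ((1 / real N) *\<^sub>R h) / \<eta> y \<le> R"
    proof -
      have "norm h \<le> R' * (3/2 * \<eta> y)"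
        using h mult_left_mono[of "\<eta> x" "3/2 * \<eta> y" R'] ey2 \<open>0 < R'\<close> by linarith
      also have "\<dots> = (3 * R') * \<eta> y / 2" by simp
      also have "\<dots> \<le> (2 * real N * R) * \<eta> y / 2"
        using assms(6) eyp by (intro divide_right_mono mult_right_mono) auto
      finally show ?thesis using eyp \<open>N > 0\<close> by (simp add: field_simps)
    qed
    then have Ky: "K y (X x h (Suc j)) = 1 / \<eta> y ^ (DIM('a) + 2)"
      using y in1[of "Suc j"] j by (simp add: K_def akernel_def XS y_def[symmetric])
    have "K' x (x + h) \<le> 1 / \<eta> x ^ (DIM('a) + 2)"
      using e by (auto simp: K'_def akernel_def indicator_def)
    also have "\<dots> \<le> q * (1 / \<eta> y ^ (DIM('a) + 2))"
    proof -
      have "\<eta> y ^ (DIM('a) + 2) \<le> (4/3 * \<eta> x) ^ (DIM('a) + 2)"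
        using ey1 eyp by (intro power_mono) auto
      then show ?thesis using e eyp by (simp add: q_def field_simps power_mult_distrib)
    qed
    finally show ?thesis using Ky y_def by simp
  qed
  define F where "F = (\<lambda>x h. ennreal (K x (x + h) * (u x - u (x + h))\<^sup>2))"
  have [measurable]: "(\<lambda>p. F (f p) (g p)) \<in> borel_measurable M"
    if [measurable]: "f \<in> M \<rightarrow>\<^sub>M borel" "g \<in> M \<rightarrow>\<^sub>M borel" for f g and M :: "'b measure"
    unfolding F_def by measurable
  have le: "ennreal (K' x (x + h) * (u x - u (x + h))\<^sup>2) \<le>
     ennreal (real N * q) * (\<Sum>j<N. F (X x h j) ((1 / real N) *\<^sub>R h))" for x h
  proof -
    have K0: "0 \<le> K a b" for a b unfolding K_def by (rule akernel_nonneg) auto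
    have K'0: "0 \<le> K' a b" for a b unfolding K'_def by (rule akernel_nonneg) auto
    have "K' x (x + h) * (u x - u (x + h))\<^sup>2 \<le> K' x (x + h) * (real N * (\<Sum>j<N. (u (X x h j) - u (X x h (Suc j)))\<^sup>2))"
      using telescope_square[of "\<lambda>j. u (X x h j)" N] by (intro mult_left_mono K'0) (simp add: X0 XN)
    also have "\<dots> = real N * (\<Sum>j<N. K' x (x + h) * (u (X x h j) - u (X x h (Suc j)))\<^sup>2)"
      by (simp add: sum_distrib_left mult_ac)
    also have "\<dots> \<le> real N * (\<Sum>j<N. q * K (X x h j) (X x h (Suc j)) * (u (X x h j) - u (X x h (Suc j)))\<^sup>2)"
      by (intro mult_left_mono sum_mono mult_right_mono Kle) auto
    also have "\<dots> = real N * q * (\<Sum>j<N. K (X x h j) (X x h (Suc j)) * (u (X x h j) - u (X x h (Suc j)))\<^sup>2)"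
      by (simp add: sum_distrib_left mult_ac)
    finally have "ennreal (K' x (x + h) * (u x - u (x + h))\<^sup>2) \<le>
      ennreal (real N * q * (\<Sum>j<N. K (X x h j) (X x h (Suc j)) * (u (X x h j) - u (X x h (Suc j)))\<^sup>2))"
      by (rule ennreal_leI)
    also have "\<dots> = ennreal (real N * q) * (\<Sum>j<N. F (X x h j) ((1 / real N) *\<^sub>R h))"
      using K0 q by (subst ennreal_mult) (auto simp: F_def sum_ennreal XS intro!: sum_nonneg)
    finally show ?thesis .
  qed
  have tr: "(\<integral>\<^sup>+x. F (X x h j) ((1 / real N) *\<^sub>R h) \<partial>lborel) = (\<integral>\<^sup>+x. F x ((1 / real N) *\<^sub>R h) \<partial>lborel)" for h j
    using nn_integral_lborel_translate[of "\<lambda>x. F x ((1 / real N) *\<^sub>R h)" "(real j / real N) *\<^sub>R h"]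
    by (simp add: X_def add.commute)
  have E: "energy \<Omega> \<eta> (indicator {..R}) u = (\<integral>\<^sup>+h. \<integral>\<^sup>+x. F x h \<partial>lborel \<partial>lborel)"
    unfolding F_def K_def by (rule energy_shift) measurable
  have mX[measurable]: "(\<lambda>p. X (f p) (g p) j) \<in> M \<rightarrow>\<^sub>M borel"
    if [measurable]: "f \<in> M \<rightarrow>\<^sub>M borel" "g \<in> M \<rightarrow>\<^sub>M borel" for f g j and M :: "'b measure"
    unfolding X_def by measurable
  have "energy \<Omega> \<eta> (indicator {..R'}) u =
    (\<integral>\<^sup>+h. \<integral>\<^sup>+x. ennreal (K' x (x + h) * (u x - u (x + h))\<^sup>2) \<partial>lborel \<partial>lborel)"
    unfolding K'_def by (rule energy_shift) measurable
  also have "\<dots> \<le> (\<integral>\<^sup>+h. \<integral>\<^sup>+x. ennreal (real N * q) * (\<Sum>j<N. F (X x h j) ((1 / real N) *\<^sub>R h)) \<partial>lborel \<partial>lborel)"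
    by (intro nn_integral_mono le)
  also have "\<dots> = (\<integral>\<^sup>+h. ennreal (real N * q) * (\<Sum>j<N. \<integral>\<^sup>+x. F (X x h j) ((1 / real N) *\<^sub>R h) \<partial>lborel) \<partial>lborel)"
    by (simp add: nn_integral_cmult nn_integral_sum)
  also have "\<dots> = (\<integral>\<^sup>+h. ennreal (real N * q) * (real N * (\<integral>\<^sup>+x. F x ((1 / real N) *\<^sub>R h) \<partial>lborel)) \<partial>lborel)"
    by (simp add: tr ennreal_of_nat_eq_real_of_nat)
  also have "\<dots> = ennreal (real N * q) * (real N * (\<integral>\<^sup>+h. (\<integral>\<^sup>+x. F x ((1 / real N) *\<^sub>R h) \<partial>lborel) \<partial>lborel))"
    by (simp add: nn_integral_cmult)
  also have "(\<integral>\<^sup>+h. (\<integral>\<^sup>+x. F x ((1 / real N) *\<^sub>R h) \<partial>lborel) \<partial>lborel) = ennreal (real N ^ DIM('a)) * (\<integral>\<^sup>+h. \<integral>\<^sup>+x. F x h \<partial>lborel \<partial>lborel)"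
    using \<open>N > 0\<close> by (subst nn_integral_lborel_scale[of _ "real N"]) auto
  also have "ennreal (real N * q) * (real N * (ennreal (real N ^ DIM('a)) * (\<integral>\<^sup>+h. \<integral>\<^sup>+x. F x h \<partial>lborel \<partial>lborel)))
      = ennreal (real N * q * (real N * real N ^ DIM('a))) * (\<integral>\<^sup>+h. \<integral>\<^sup>+x. F x h \<partial>lborel \<partial>lborel)"
    using q by (simp add: ennreal_mult mult.assoc)
  also have "real N * q * (real N * real N ^ DIM('a)) = real N ^ (DIM('a) + 2) * (4/3) ^ (DIM('a) + 2)"
    unfolding q_def power_add power2_eq_square by (simp only: mult_ac)
  finally show ?thesis unfolding E .
qed

end

section \<open>First moment of the adjoint kernel\<close>

text \<open>Continuity gives the primitive in \<open>hat_primitive\<close> a derivative at every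
  point. The horizon 1/4 leaves room for passing from the scale at one endpoint to the scale at the
  other, as in \<open>akernel_hat_support\<close>.\<close>

definition hat :: "real \<Rightarrow> real" where
  "hat t = max 0 (1/4 - t)"

lemma hat_measurable [measurable]: "hat \<in> borel_measurable borel"
  unfolding hat_def by measurable

lemma hat_nonneg: "0 \<le> hat t" and hat_le: "0 \<le> t \<Longrightarrow> hat t \<le> 1" and hat_zero: "1/4 \<le> t \<Longrightarrow> hat t = 0"
  by (auto simp: hat_def)

lemma hat_cont: "continuous_on S hat"
  unfolding hat_def by (intro continuous_intros)

text \<open>Constancy beyond 1/4 makes the increment of \<open>\<Psi>\<close> along a ray
  independent of where the ray is stopped.\<close>

lemma hat_primitive:
  obtains \<Psi> :: "real \<Rightarrow> real" where
    "\<And>s. 0 \<le> s \<Longrightarrow> s \<le> 1 \<Longrightarrow> (\<Psi> has_real_derivative s ^ n * hat s) (at s)"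
    "\<And>s. 1/4 \<le> s \<Longrightarrow> s \<le> 1 \<Longrightarrow> \<Psi> s = \<Psi> (1/4)"
proof -
  \<comment> \<open>Starting at -1, inside an interval that reaches to 2, makes 0 and 1 interior
    points, so the derivative is two-sided there.\<close>
  define \<Psi> where "\<Psi> = (\<lambda>s. integral {-1..s} (\<lambda>s. s ^ n * hat s))"
  have c: "continuous_on {-1..2} (\<lambda>s. s ^ n * hat s)"
    by (intro continuous_intros hat_cont)
  have d: "(\<Psi> has_real_derivative s ^ n * hat s) (at s)" if "0 \<le> s" "s \<le> 1" for s
    using integral_has_real_derivative[OF c, of s] that at_within_interior[of s "{-1..2}"]
    by (auto simp: \<Psi>_def)
  have "\<Psi> s = \<Psi> (1/4)" if s: "1/4 \<le> s" "s \<le> 1" for s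
  proof (cases "s = 1/4")
    case False
    show ?thesis
    proof (rule DERIV_isconst_end[where f = \<Psi>])
      show "1/4 < s" using s False by simp
      show "continuous_on {1/4..s} \<Psi>"
        using s by (intro continuous_at_imp_continuous_on ballI DERIV_isCont[OF d]) auto
      show "DERIV \<Psi> y :> 0" if "1/4 < y" "y < s" for y
        using d[of y] that s by (simp add: hat_zero)
    qed
  next
    case True
    then show ?thesis by (simp only:)
  qed
  then show ?thesis using d that by blast
qed

section \<open>The adjoint kernel along rays\<close>

context localization
begin

lemma eta_comparable:
  assumes "x \<in> \<Omega>" "norm h \<le> \<eta> x / 2"
  shows "x + h \<in> \<Omega>" "5/6 * \<eta> x \<le> \<eta> (x + h)" "\<eta> (x + h) \<le> 7/6 * \<eta> x"
proof -
  have "norm h < \<eta> x" using eta_pos[OF assms(1)] assms(2) by linarith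
  then show "x + h \<in> \<Omega>" by (rule ball_dom[OF assms(1)])
  show "5/6 * \<eta> x \<le> \<eta> (x + h)" "\<eta> (x + h) \<le> 7/6 * \<eta> x"
    using eta_lip[OF assms(1) \<open>norm h < \<eta> x\<close>] assms(2) by linarith+
qed

text \<open>By the Lipschitz bound \<eta> at \<open>y\<close> exceeds 11/12 of \<eta> at
  \<open>x\<close>, so a horizon of 1/4 at \<open>x\<close> is still below 1/2 as seen from
  \<open>y\<close>. Integrals of the adjoint kernel fix the second argument and need the bound from
  that side.\<close>

lemma akernel_hat_support:
  assumes "akernel \<Omega> \<eta> hat x y \<noteq> 0"
  shows "x \<in> \<Omega>" "y \<in> \<Omega>" "norm (y - x) < \<eta> x / 2" "norm (y - x) < \<eta> y / 2"
proof -
  show x: "x \<in> \<Omega>" and y: "y \<in> \<Omega>" using assms by (auto simp: akernel_def indicator_def split: if_splits)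
  note e = eta_pos[OF x]
  have "norm (y - x) / \<eta> x < 1/4"
    using assms hat_zero[of "norm (y - x) / \<eta> x"] by (force simp: akernel_def)
  then have n: "norm (y - x) < \<eta> x / 4" using e by (simp add: field_simps)
  then show "norm (y - x) < \<eta> x / 2" using e by linarith
  have "norm (y - x) < \<eta> x" using n e by linarith
  then have "\<bar>\<eta> y - \<eta> x\<bar> \<le> norm (y - x) / 3" using eta_lip[OF x, of "y - x"] by simp
  then show "norm (y - x) < \<eta> y / 2" using n e by linarith
qed

lemma akernel_hat_nonneg: "0 \<le> akernel \<Omega> \<eta> hat x y"
  by (rule akernel_nonneg) (rule hat_nonneg)

lemma akernel_hat_le:
  assumes "z = x \<or> z = y" "z \<in> \<Omega>"
  shows "akernel \<Omega> \<eta> hat x y \<le> (2 / \<eta> z) ^ (DIM('a) + 2)"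
proof (cases "akernel \<Omega> \<eta> hat x y = 0")
  case True
  then show ?thesis using eta_pos[OF assms(2)] by simp
next
  case False
  note s = akernel_hat_support[OF False]
  note e = eta_pos[OF s(1)]
  have "5/6 * \<eta> y \<le> \<eta> x"
    using eta_comparable(2)[OF s(2), of "x - y"] s(4) by (simp add: norm_minus_commute)
  then have z: "\<eta> z \<le> 2 * \<eta> x" using assms e by auto
  have "akernel \<Omega> \<eta> hat x y \<le> 1 / \<eta> x ^ (DIM('a) + 2)"
    unfolding akernel_def using s(1,2) e hat_le[of "norm (y - x) / \<eta> x"]
    by (simp add: divide_right_mono)
  also have "\<dots> = (1 / \<eta> x) ^ (DIM('a) + 2)" by (simp add: power_one_over)
  also have "\<dots> \<le> (2 / \<eta> z) ^ (DIM('a) + 2)"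
    using z e eta_pos[OF assms(2)] by (intro power_mono) (auto simp: field_simps)
  finally show ?thesis .
qed

text \<open>The radial part of the first moment of the adjoint kernel at \<open>x\<close>: of the
  power \<open>t ^ DIM('a)\<close>, all but one factor is the Jacobian of
  \<open>nn_integral_rays\<close>, and the last \<open>t\<close> comes from the linear weight
  \<open>b \<bullet> (t *\<^sub>R k)\<close>.\<close>

definition ray :: "'a \<Rightarrow> 'a \<Rightarrow> ennreal" where
  "ray x k = (\<integral>\<^sup>+t. indicator {0<..} t * ennreal (t ^ DIM('a) * akernel \<Omega> \<eta> hat (x + t *\<^sub>R k) x) \<partial>lborel)"

lemma ray_measurable [measurable]: "ray x \<in> borel_measurable borel"
  unfolding ray_def by measurable

lemma eta_ray_second:
  assumes x: "x \<in> \<Omega>" and "norm (t *\<^sub>R k) \<le> \<eta> x / 2"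
  shows "\<bar>\<eta> (x + t *\<^sub>R k) - t * (G (x + t *\<^sub>R k) \<bullet> k) - \<eta> x\<bar> \<le> \<kappa> * (norm (t *\<^sub>R k))\<^sup>2"
  using eta_second[OF x, of "t *\<^sub>R k"] assms eta_pos[OF x] by simp

text \<open>Along a ray, \<open>g t = t * norm k / \<eta> (x + t k)\<close> has derivative
  \<open>norm k * (\<eta> - t \<eta>') / \<eta>\<^sup>2\<close>, and \<open>\<eta> - t \<eta>'\<close> equals \<open>\<eta> x\<close> up to a second order error. So the
  integrand of \<open>ray\<close> is, up to that error, the derivative of \<open>\<Psi> \<circ> g\<close>, whose increment does
  not depend on the direction of the ray.\<close>

lemma ray_estimate:
  "\<exists>c. \<forall>x\<in>\<Omega>. \<forall>k. 1 \<le> norm k \<longrightarrow> (\<exists>p\<ge>0. ray x k = ennreal p \<and>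
     \<bar>p - c / (norm k ^ (DIM('a) + 1) * \<eta> x)\<bar> \<le> \<kappa>)"
proof -
  let ?n = "DIM('a)"
  obtain \<Psi> where D\<Psi>: "\<And>s. 0 \<le> s \<Longrightarrow> s \<le> 1 \<Longrightarrow> (\<Psi> has_real_derivative s ^ ?n * hat s) (at s)"
    and C\<Psi>: "\<And>s. 1/4 \<le> s \<Longrightarrow> s \<le> 1 \<Longrightarrow> \<Psi> s = \<Psi> (1/4)"
    using hat_primitive[of ?n] by metis
  define c where "c = \<Psi> (1/4) - \<Psi> 0"
  have "\<exists>p\<ge>0. ray x k = ennreal p \<and> \<bar>p - c / (norm k ^ (?n + 1) * \<eta> x)\<bar> \<le> \<kappa>"
    if x: "x \<in> \<Omega>" and k: "1 \<le> norm k" for x k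
  proof -
    define e where "e = \<eta> x"
    have e: "0 < e" unfolding e_def by (rule eta_pos[OF x])
    \<comment> \<open>The ray has then length \<open>e / 2\<close>: up to there
      \<open>eta_comparable\<close> applies, and beyond it the kernel vanishes by
      \<open>akernel_hat_support\<close>. At \<open>T\<close> the quotient \<open>g\<close> is at
      least 3/7, hence in the range where \<open>\<Psi>\<close> is constant.\<close>
    define T where "T = e / (2 * norm k)"
    have k0: "0 < norm k" using k by linarith
    have T: "0 < T" and Tk: "T * norm k = e / 2" using e k0 unfolding T_def by (auto simp del: zero_less_norm_iff)
    define E where "E = (\<lambda>t. \<eta> (x + t *\<^sub>R k))"
    define E' where "E' = (\<lambda>t. G (x + t *\<^sub>R k) \<bullet> k)"
    define H where "H = (\<lambda>t. t ^ ?n * (hat (t * norm k / E t) / E t ^ (?n + 2)))"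
    have tk: "norm (t *\<^sub>R k) = t * norm k" "t * norm k \<le> e / 2" if "t \<in> {0..T}" for t
      using that Tk mult_right_mono[of t T "norm k"] by auto
    have E: "x + t *\<^sub>R k \<in> \<Omega>" "5/6 * e \<le> E t" "E t \<le> 7/6 * e" "0 < E t" if "t \<in> {0..T}" for t
      using eta_comparable[OF x, of "t *\<^sub>R k"] tk[OF that] e unfolding E_def e_def by auto
    have dE: "(E has_real_derivative E' t) (at t)" if "t \<in> {0..T}" for t
    proof -
      have "((\<lambda>t. x + t *\<^sub>R k) has_derivative (\<lambda>s. s *\<^sub>R k)) (at t)"
        by (auto intro!: derivative_eq_intros)
      then have "(E has_derivative (\<lambda>s. G (x + t *\<^sub>R k) \<bullet> (s *\<^sub>R k))) (at t)"
        unfolding E_def using eta_deriv[OF E(1)[OF that]] by (rule has_derivative_compose)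
      then show ?thesis
        by (rule has_derivative_imp_has_field_derivative) (simp add: E'_def)
    qed
    have contE: "continuous_on {0..T} E"
      using dE by (intro continuous_at_imp_continuous_on ballI DERIV_isCont) auto
    have contH: "continuous_on {0..T} H"
      unfolding H_def using E(4) by (intro continuous_intros contE continuous_on_compose2[OF hat_cont[of UNIV]]) (fastforce+)
    have Hn: "0 \<le> H t" if "t \<in> {0..T}" for t
      unfolding H_def using that E(4)[OF that] by (intro mult_nonneg_nonneg divide_nonneg_nonneg hat_nonneg) auto
    define p where "p = integral {0..T} H"
    have Hp: "(H has_integral p) {0..T}"
      unfolding p_def by (intro integrable_integral integrable_continuous_real contH)
    have p0: "0 \<le> p" using Hp Hn by (rule has_integral_nonneg)
    have far: "akernel \<Omega> \<eta> hat (x + t *\<^sub>R k) x = 0" if "T < t" for t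
    proof (rule ccontr)
      assume "akernel \<Omega> \<eta> hat (x + t *\<^sub>R k) x \<noteq> 0"
      from akernel_hat_support(4)[OF this] have "\<bar>t\<bar> * norm k < e / 2" by (simp add: e_def)
      moreover have "T * norm k < t * norm k" using that k by (intro mult_strict_right_mono) auto
      ultimately show False using Tk T that by simp
    qed
    have "ray x k = (\<integral>\<^sup>+t. ennreal (H t) * indicator {0..T} t \<partial>lborel)"
      unfolding ray_def
    proof (rule nn_integral_cong)
      fix t :: real
      consider "t \<le> 0" | "t \<in> {0<..T}" | "T < t" by fastforce
      then show "indicator {0<..} t * ennreal (t ^ ?n * akernel \<Omega> \<eta> hat (x + t *\<^sub>R k) x) = ennreal (H t) * indicator {0..T} t"
      proof cases
        case 1 then show ?thesis by (cases "t = 0") (auto simp: H_def zero_power)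
      next
        case 2 then show ?thesis using E[of t] x by (auto simp: H_def akernel_def E_def)
      next
        case 3 then show ?thesis using T by (auto simp: far)
      qed
    qed
    also have "\<dots> = ennreal p"
      using Hn Hp by (rule nn_integral_has_integral_lebesgue')
    finally have rp: "ray x k = ennreal p" .
    define g where "g = (\<lambda>t. t * norm k / E t)"
    have g: "0 \<le> g t" "g t \<le> 1" if "t \<in> {0..T}" for t
      using E[OF that] tk[OF that] that e by (auto simp: g_def divide_le_eq_1)
    have gT: "g T \<ge> 1/4" using E[of T] T Tk e by (auto simp: g_def field_simps)
    have dg: "(g has_real_derivative norm k * (E t - t * E' t) / (E t)\<^sup>2) (at t)" if "t \<in> {0..T}" for t
      unfolding g_def using dE[OF that] E(4)[OF that]
      by (auto intro!: derivative_eq_intros simp: field_simps power2_eq_square)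
    \<comment> \<open>The power of \<open>norm k\<close> collects \<open>?n\<close> factors from
      \<open>g t ^ ?n\<close> and one from the derivative of \<open>g\<close>.\<close>
    have "((\<lambda>t. norm k ^ (?n + 1) * (H t * (E t - t * E' t))) has_integral (\<Psi> (g T) - \<Psi> (g 0))) {0..T}"
    proof (rule fundamental_theorem_of_calculus)
      show "0 \<le> T" using T by simp
      fix t assume t: "t \<in> {0..T}"
      have "((\<lambda>t. \<Psi> (g t)) has_real_derivative (g t ^ ?n * hat (g t)) * (norm k * (E t - t * E' t) / (E t)\<^sup>2)) (at t)"
        using DERIV_chain2[OF D\<Psi>[OF g[OF t]] dg[OF t]] .
      also have "(g t ^ ?n * hat (g t)) * (norm k * (E t - t * E' t) / (E t)\<^sup>2) = norm k ^ (?n + 1) * (H t * (E t - t * E' t))"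
        by (simp add: g_def H_def power_mult_distrib power_divide power_add power2_eq_square mult_ac)
      finally show "((\<lambda>t. \<Psi> (g t)) has_vector_derivative norm k ^ (?n + 1) * (H t * (E t - t * E' t))) (at t within {0..T})"
        using has_real_derivative_iff_has_vector_derivative has_vector_derivative_at_within by blast
    qed
    also have "\<Psi> (g T) - \<Psi> (g 0) = c"
      using C\<Psi>[OF gT] g(2)[of T] T by (simp add: c_def g_def)
    finally have "((\<lambda>t. norm k ^ (?n + 1) * (H t * (E t - t * E' t)) - norm k ^ (?n + 1) * (H t * e)) has_integral
        (c - norm k ^ (?n + 1) * (p * e))) {0..T}"
      by (intro has_integral_diff has_integral_mult_right has_integral_mult_left Hp)
    \<comment> \<open>The quadratic remainder supplies exactly the two powers that turn the division
      by \<open>E t ^ (?n + 2)\<close> into a power of \<open>g t\<close>, which is at most 1. The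
      error is therefore bounded however small \<eta> is.\<close>
    moreover have "norm (norm k ^ (?n + 1) * (H t * (E t - t * E' t)) - norm k ^ (?n + 1) * (H t * e)) \<le> norm k * \<kappa>"
      if t: "t \<in> {0..T}" for t
    proof -
      have "norm (norm k ^ (?n + 1) * (H t * (E t - t * E' t)) - norm k ^ (?n + 1) * (H t * e)) =
          norm k ^ (?n + 1) * (H t * \<bar>E t - t * E' t - e\<bar>)"
        using Hn[OF t] by (simp add: abs_mult flip: right_diff_distrib)
      also have "\<dots> \<le> norm k ^ (?n + 1) * (H t * (\<kappa> * (t * norm k)\<^sup>2))"
        using eta_ray_second[OF x, of t k] tk[OF t] Hn[OF t]
        by (intro mult_left_mono) (auto simp: E_def E'_def e_def)
      also have "\<dots> = norm k * \<kappa> * ((t * norm k / E t) ^ (?n + 2) * hat (t * norm k / E t))"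
        by (simp add: H_def power_mult_distrib power_divide power_add power2_eq_square mult_ac)
      also have "\<dots> \<le> norm k * \<kappa> * (1 * 1)"
        using g[OF t] kappa hat_nonneg
        by (intro mult_left_mono mult_mono power_le_one hat_le) (auto simp: g_def)
      finally show ?thesis by simp
    qed
    ultimately have "norm (c - norm k ^ (?n + 1) * (p * e)) \<le> norm k * \<kappa> * measure lborel (cbox 0 T)"
      using kappa by (intro has_integral_bound) auto
    also have "\<dots> = \<kappa> * e / 2" using T Tk by (simp add: mult_ac)
    finally have b: "\<bar>c - norm k ^ (?n + 1) * (p * e)\<bar> \<le> \<kappa> * e"
      using kappa e by simp (smt (verit) mult_nonneg_nonneg)
    have k1: "1 \<le> norm k ^ (?n + 1)" using k by (rule one_le_power)
    have "\<bar>p - c / (norm k ^ (?n + 1) * e)\<bar> = \<bar>c - norm k ^ (?n + 1) * (p * e)\<bar> / (norm k ^ (?n + 1) * e)"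
    proof -
      have pos: "0 < norm k ^ (?n + 1) * e" using k1 e by (intro mult_pos_pos) linarith+
      have "p - c / Z = - ((c - Z * p) / Z)" if "0 < Z" for Z :: real
        using that by (simp add: field_simps)
      from this[OF pos] have "p - c / (norm k ^ (?n + 1) * e) = - ((c - norm k ^ (?n + 1) * (p * e)) / (norm k ^ (?n + 1) * e))"
        by (simp only: mult_ac)
      then show ?thesis using pos by (simp only: abs_minus_cancel abs_divide abs_of_pos)
    qed
    also have "\<dots> \<le> \<kappa> * e / (1 * e)"
      using b k1 e kappa by (intro frac_le mult_right_mono) auto
    finally have "\<bar>p - c / (norm k ^ (?n + 1) * \<eta> x)\<bar> \<le> \<kappa>" using e by (simp add: e_def)
    then show ?thesis using p0 rp by blast
  qed
  then show ?thesis by blast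
qed

text \<open>The leading term in \<open>ray_estimate\<close> depends on \<open>k\<close> through its
  norm only, so it is the same for \<open>k\<close> and \<open>- k\<close>, however large
  \<open>1 / \<eta> x\<close> may be. The two errors add up to \<open>2 * \<kappa>\<close>.\<close>

lemma ray_reflect:
  assumes "x \<in> \<Omega>" "1 \<le> norm k"
  shows "ray x (- k) \<le> ray x k + ennreal (2 * \<kappa>)"
proof -
  obtain c where c: "\<And>k. 1 \<le> norm k \<Longrightarrow> \<exists>p\<ge>0. ray x k = ennreal p \<and> \<bar>p - c / (norm k ^ (DIM('a) + 1) * \<eta> x)\<bar> \<le> \<kappa>"
    using ray_estimate assms(1) by blast
  from c[OF assms(2)] c[of "- k"] assms(2) obtain p p' where
    p: "p \<ge> 0" "ray x k = ennreal p" "\<bar>p - c / (norm k ^ (DIM('a) + 1) * \<eta> x)\<bar> \<le> \<kappa>" and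
    p': "p' \<ge> 0" "ray x (- k) = ennreal p'" "\<bar>p' - c / (norm k ^ (DIM('a) + 1) * \<eta> x)\<bar> \<le> \<kappa>"
    by (auto simp only: norm_minus_cancel)
  have "p' \<le> p + 2 * \<kappa>" using p(3) p'(3) by linarith
  then show ?thesis using p(1,2) p'(2) kappa by (simp add: ennreal_leI flip: ennreal_plus)
qed

end

section \<open>Moments of the kernel and of its adjoint\<close>

lemma integrable_bounded_support:
  fixes f :: "'a::euclidean_space \<Rightarrow> real"
  assumes "f \<in> borel_measurable borel" "\<And>h. f h \<noteq> 0 \<Longrightarrow> norm h \<le> r" "\<And>h. norm h \<le> r \<Longrightarrow> \<bar>f h\<bar> \<le> B"
  shows "integrable lborel f"
proof (rule integrableI_bounded_set[where A = "cball 0 r" and B = B])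
  show "emeasure lborel (cball (0::'a) r) < \<infinity>" by (rule emeasure_lborel_cball_finite)
qed (use assms in auto)

lemma integral_lborel_reflect:
  fixes f :: "'a::euclidean_space \<Rightarrow> real"
  assumes "f \<in> borel_measurable borel"
  shows "(\<integral>x. f (- x) \<partial>lborel) = (\<integral>x. f x \<partial>lborel)"
proof -
  have "(lborel :: 'a measure) = distr lborel borel uminus"
    using lborel_affine[of "-1" "0::'a"] by (simp add: density_1)
  then have "(\<integral>x. f x \<partial>lborel) = (\<integral>x. f x \<partial>distr lborel borel uminus)"
    by simp
  also have "\<dots> = (\<integral>x. f (- x) \<partial>lborel)"
    using assms by (subst integral_distr) auto
  finally show ?thesis by simp
qed

definition second_moment :: "'a::euclidean_space \<Rightarrow> real" where
  "second_moment b = (\<integral>z. hat (norm z) * (b \<bullet> z)\<^sup>2 \<partial>lborel)"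

text \<open>The factor \<open>4 \<kappa>\<close> is the bound \<open>2 \<kappa>\<close> of \<open>ray_reflect\<close> times \<open>b \<bullet> k \<le> 2\<close>; \<open>ln 2\<close> is the weight
  in \<open>nn_integral_rays\<close>.\<close>

definition drift_bound :: "'a::euclidean_space itself \<Rightarrow> real \<Rightarrow> real" where
  "drift_bound _ \<kappa> = 4 * \<kappa> * measure lborel (cball (0::'a) 2) / ln 2"

text \<open>In the sum of the two Taylor expansions the odd terms cancel, and the remainders of
  order four are nonnegative.\<close>

lemma cosh_ge: "exp s + exp (- s) - 2 \<ge> (s::real)\<^sup>2"
proof -
  obtain t where t: "exp s = (\<Sum>m<4. s ^ m / fact m) + exp t / fact 4 * s ^ 4"
    using Maclaurin_exp_le[of s 4] by blast
  obtain t' where t': "exp (-s) = (\<Sum>m<4. (-s) ^ m / fact m) + exp t' / fact 4 * (-s) ^ 4"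
    using Maclaurin_exp_le[of "-s" 4] by blast
  have "0 \<le> exp t / fact 4 * s ^ 4" "0 \<le> exp t' / fact 4 * (-s) ^ 4" by simp_all
  then show ?thesis unfolding t t' by (simp add: eval_nat_numeral)
qed

text \<open>If the integral vanished, so would the integrand almost everywhere, but it is positive
  on an open set that contains the multiple of \<open>b\<close> of length 1/8. Positivity is what
  lets the quadratic term in \<open>l\<close> dominate the drift.\<close>

lemma second_moment_pos:
  fixes b :: "'a::euclidean_space"
  assumes "b \<noteq> 0"
  shows "0 < second_moment b"
proof -
  let ?f = "\<lambda>z. hat (norm z) * (b \<bullet> z)\<^sup>2"
  have i: "integrable lborel ?f"
  proof (rule integrable_bounded_support)
    show "?f \<in> borel_measurable borel" by measurable
    show "norm h \<le> 1" if "?f h \<noteq> 0" for h using that hat_zero[of "norm h"] by force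
    show "\<bar>?f h\<bar> \<le> 1 * (norm b)\<^sup>2" if "norm h \<le> 1" for h
    proof -
      have "\<bar>b \<bullet> h\<bar> \<le> norm b * 1"
        using Cauchy_Schwarz_ineq2[of b h] that by (meson mult_left_mono norm_ge_zero order_trans)
      then have "(b \<bullet> h)\<^sup>2 \<le> (norm b)\<^sup>2" by (simp add: abs_le_square_iff[symmetric])
      then show ?thesis using hat_nonneg[of "norm h"] hat_le[of "norm h"] mult_mono[of "hat (norm h)" 1 "(b \<bullet> h)\<^sup>2" "(norm b)\<^sup>2"]
        by (simp add: abs_mult)
    qed
  qed
  have nn: "0 \<le> ?f z" for z using hat_nonneg by simp
  show ?thesis
  proof (rule ccontr)
    assume "\<not> ?thesis"
    then have "integral\<^sup>L lborel ?f = 0"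
      using Bochner_Integration.integral_nonneg[of lborel ?f, OF nn] by (simp add: second_moment_def)
    then have "AE z in lborel. ?f z = 0"
      using integral_nonneg_eq_0_iff_AE[OF i] nn by simp
    then have "AE z in lborel. z \<notin> {z::'a. norm z < 1/4 \<and> b \<bullet> z \<noteq> 0}"
      by eventually_elim (auto simp: hat_def)
    then have "{z::'a. norm z < 1/4 \<and> b \<bullet> z \<noteq> 0} \<in> null_sets lebesgue"
      by (subst completion.null_sets_iff_AE) (auto intro: AE_completion)
    then have "negligible {z::'a. norm z < 1/4 \<and> b \<bullet> z \<noteq> 0}"
      by (simp add: negligible_iff_null_sets)
    moreover have "open {z::'a. norm z < 1/4 \<and> b \<bullet> z \<noteq> 0}"
      by (intro open_Collect_conj open_Collect_less open_Collect_neq continuous_intros)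
    moreover have "(1 / (8 * norm b)) *\<^sub>R b \<in> {z::'a. norm z < 1/4 \<and> b \<bullet> z \<noteq> 0}"
      using assms by (simp add: field_simps)
    ultimately show False using open_not_negligible by blast
  qed
qed

context localization
begin

lemma adjoint_integrable:
  assumes x: "x \<in> \<Omega>" and [measurable]: "f \<in> borel_measurable borel"
    and B: "\<And>h. norm h \<le> \<eta> x \<Longrightarrow> \<bar>f h\<bar> \<le> B"
  shows "integrable lborel (\<lambda>h. akernel \<Omega> \<eta> hat (x + h) x * f h)"
    and "integrable lborel (\<lambda>h. akernel \<Omega> \<eta> hat x (x + h) * f h)"
proof -
  have s: "norm h \<le> \<eta> x" if "akernel \<Omega> \<eta> hat (x + h) x \<noteq> 0 \<or> akernel \<Omega> \<eta> hat x (x + h) \<noteq> 0" for h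
    using that akernel_hat_support(4)[of "x + h" x] akernel_hat_support(3)[of x "x + h"] eta_pos[OF x] by auto
  have b: "\<bar>K * f h\<bar> \<le> (2 / \<eta> x) ^ (DIM('a) + 2) * B" if "norm h \<le> \<eta> x" "0 \<le> K" "K \<le> (2 / \<eta> x) ^ (DIM('a) + 2)" for K h
    unfolding abs_mult using that B[of h] by (intro mult_mono) auto
  show "integrable lborel (\<lambda>h. akernel \<Omega> \<eta> hat (x + h) x * f h)"
    by (rule integrable_bounded_support[OF _ _ b[OF _ akernel_hat_nonneg akernel_hat_le[OF _ x]]]) (use s in auto)
  show "integrable lborel (\<lambda>h. akernel \<Omega> \<eta> hat x (x + h) * f h)"
    by (rule integrable_bounded_support[OF _ _ b[OF _ akernel_hat_nonneg akernel_hat_le[OF _ x]]]) (use s in auto)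
qed

text \<open>Both half-space moments can be as large as a multiple of \<open>1 / \<eta> x\<close>, so
  they are compared with each other instead of being estimated separately. In polar form reflection
  pairs the ray along \<open>- k\<close> with the ray along \<open>k\<close>, and
  \<open>ray_reflect\<close> leaves an error to be integrated over an annulus inside
  \<open>cball 0 2\<close>.\<close>

lemma adjoint_halves:
  assumes x: "x \<in> \<Omega>" and b: "norm b = 1"
  shows "ennreal (ln 2) * (\<integral>\<^sup>+h. ennreal (akernel \<Omega> \<eta> hat (x + h) x * max 0 (- (b \<bullet> h))) \<partial>lborel)
    \<le> ennreal (ln 2) * (\<integral>\<^sup>+h. ennreal (akernel \<Omega> \<eta> hat (x + h) x * max 0 (b \<bullet> h)) \<partial>lborel)
      + ennreal (4 * \<kappa> * measure lborel (cball (0::'a) 2))"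
proof -
  let ?S = "{k::'a. 1 \<le> norm k \<and> norm k \<le> 2}"
  have [measurable]: "?S \<in> sets borel" "cball (0::'a) 2 \<in> sets borel" by measurable
  have polar: "ennreal (ln 2) * (\<integral>\<^sup>+h. ennreal (akernel \<Omega> \<eta> hat (x + h) x * max 0 (c \<bullet> h)) \<partial>lborel)
     = (\<integral>\<^sup>+k. indicator ?S k * (ennreal (max 0 (c \<bullet> k)) * ray x k) \<partial>lborel)" for c
  proof (subst nn_integral_rays)
    show "(\<lambda>h. ennreal (akernel \<Omega> \<eta> hat (x + h) x * max 0 (c \<bullet> h))) \<in> borel_measurable borel"
      by measurable
    have "ennreal (t ^ (DIM('a) - 1)) * ennreal (akernel \<Omega> \<eta> hat (x + t *\<^sub>R k) x * max 0 (c \<bullet> t *\<^sub>R k))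
        = ennreal (max 0 (c \<bullet> k)) * ennreal (t ^ DIM('a) * akernel \<Omega> \<eta> hat (x + t *\<^sub>R k) x)" if "0 < t" for t k
    proof -
      have "max 0 (c \<bullet> t *\<^sub>R k) = t * max 0 (c \<bullet> k)" using that by (auto simp: max_def mult_le_0_iff zero_le_mult_iff)
      moreover have "t ^ (DIM('a) - 1) * t = t ^ DIM('a)" by (rule power_minus_mult) simp
      moreover have "p * (K * (t * m)) = m * ((p * t) * K)" for p K m by (simp add: mult_ac)
      ultimately have "t ^ (DIM('a) - 1) * (akernel \<Omega> \<eta> hat (x + t *\<^sub>R k) x * max 0 (c \<bullet> t *\<^sub>R k))
        = max 0 (c \<bullet> k) * (t ^ DIM('a) * akernel \<Omega> \<eta> hat (x + t *\<^sub>R k) x)"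
        by (simp only:)
      then show ?thesis using that akernel_hat_nonneg by (simp flip: ennreal_mult)
    qed
    then have "indicator {0<..} t * (ennreal (t ^ (DIM('a) - 1)) * ennreal (akernel \<Omega> \<eta> hat (x + t *\<^sub>R k) x * max 0 (c \<bullet> t *\<^sub>R k)))
        = ennreal (max 0 (c \<bullet> k)) * (indicator {0<..} t * ennreal (t ^ DIM('a) * akernel \<Omega> \<eta> hat (x + t *\<^sub>R k) x))" for t k
      by (simp add: indicator_def)
    then show "(\<integral>\<^sup>+k. indicator ?S k * (\<integral>\<^sup>+t. indicator {0<..} t * (ennreal (t ^ (DIM('a) - 1)) * ennreal (akernel \<Omega> \<eta> hat (x + t *\<^sub>R k) x * max 0 (c \<bullet> t *\<^sub>R k))) \<partial>lborel) \<partial>lborel)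
      = (\<integral>\<^sup>+k. indicator ?S k * (ennreal (max 0 (c \<bullet> k)) * ray x k) \<partial>lborel)"
      by (simp add: nn_integral_cmult ray_def)
  qed
  have "ennreal (ln 2) * (\<integral>\<^sup>+h. ennreal (akernel \<Omega> \<eta> hat (x + h) x * max 0 (- (b \<bullet> h))) \<partial>lborel)
    = (\<integral>\<^sup>+k. indicator ?S k * (ennreal (max 0 (- b \<bullet> k)) * ray x k) \<partial>lborel)"
    using polar[of "- b"] by simp
  also have "\<dots> = (\<integral>\<^sup>+k. indicator ?S (- k) * (ennreal (max 0 (- b \<bullet> - k)) * ray x (- k)) \<partial>lborel)"
    by (rule nn_integral_lborel_reflect[symmetric]) measurable
  also have "\<dots> \<le> (\<integral>\<^sup>+k. indicator ?S k * (ennreal (max 0 (b \<bullet> k)) * ray x k) + ennreal (4 * \<kappa>) * indicator (cball 0 2) k \<partial>lborel)"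
  proof (rule nn_integral_mono)
    fix k :: 'a
    show "indicator ?S (- k) * (ennreal (max 0 (- b \<bullet> - k)) * ray x (- k))
      \<le> indicator ?S k * (ennreal (max 0 (b \<bullet> k)) * ray x k) + ennreal (4 * \<kappa>) * indicator (cball 0 2) k"
    proof (cases "k \<in> ?S")
      case True
      have "max 0 (b \<bullet> k) \<le> 2" using norm_cauchy_schwarz[of b k] b True by simp
      then have m: "ennreal (max 0 (b \<bullet> k)) * ennreal (2 * \<kappa>) \<le> ennreal (4 * \<kappa>)"
        using kappa mult_right_mono[of "max 0 (b \<bullet> k)" 2 "2 * \<kappa>"] by (simp add: ennreal_leI flip: ennreal_mult)
      have "ennreal (max 0 (b \<bullet> k)) * ray x (- k) \<le> ennreal (max 0 (b \<bullet> k)) * (ray x k + ennreal (2 * \<kappa>))"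
        using ray_reflect[OF x, of k] True by (intro mult_left_mono) auto
      also have "\<dots> \<le> ennreal (max 0 (b \<bullet> k)) * ray x k + ennreal (4 * \<kappa>)"
        unfolding distrib_left by (intro add_left_mono m)
      finally show ?thesis using True by simp
    qed simp
  qed
  also have "\<dots> = (\<integral>\<^sup>+k. indicator ?S k * (ennreal (max 0 (b \<bullet> k)) * ray x k) \<partial>lborel) + ennreal (4 * \<kappa>) * emeasure lborel (cball (0::'a) 2)"
    by (subst nn_integral_add) (measurable, simp add: nn_integral_cmult_indicator)
  also have "ennreal (4 * \<kappa>) * emeasure lborel (cball (0::'a) 2) = ennreal (4 * \<kappa> * measure lborel (cball (0::'a) 2))"
    using kappa emeasure_lborel_cball_finite[of "0::'a" 2]
    by (simp add: emeasure_eq_ennreal_measure ennreal_mult less_top)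
  finally show ?thesis by (simp add: polar)
qed

lemma adjoint_first_moment:
  assumes x: "x \<in> \<Omega>" and b: "norm b = 1"
  shows "- drift_bound TYPE('a) \<kappa> \<le> (\<integral>h. akernel \<Omega> \<eta> hat (x + h) x * (b \<bullet> h) \<partial>lborel)"
proof -
  let ?q = "\<lambda>h. akernel \<Omega> \<eta> hat (x + h) x"
  have bh: "\<bar>b \<bullet> h\<bar> \<le> norm h" for h using Cauchy_Schwarz_ineq2[of b h] b by simp
  have i: "integrable lborel (\<lambda>h. ?q h * max 0 (b \<bullet> h))" "integrable lborel (\<lambda>h. ?q h * max 0 (- (b \<bullet> h)))"
    using bh by (auto intro!: adjoint_integrable[OF x, where B = "\<eta> x"] simp: abs_le_iff intro: order_trans)
       (smt (verit) bh)+
  have nn: "0 \<le> ?q h * max 0 s" for h s using akernel_hat_nonneg by simp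
  define P where "P = (\<integral>h. ?q h * max 0 (b \<bullet> h) \<partial>lborel)"
  define N where "N = (\<integral>h. ?q h * max 0 (- (b \<bullet> h)) \<partial>lborel)"
  have P0: "0 \<le> P" "0 \<le> N" unfolding P_def N_def by (auto intro!: integral_nonneg_AE nn)
  have "ennreal (ln 2) * ennreal N \<le> ennreal (ln 2) * ennreal P + ennreal (4 * \<kappa> * measure lborel (cball (0::'a) 2))"
    using adjoint_halves[OF x b] i nn unfolding P_def N_def by (simp add: nn_integral_eq_integral)
  also have "\<dots> = ennreal (ln 2 * P + 4 * \<kappa> * measure lborel (cball (0::'a) 2))"
    using P0 kappa by (simp add: ennreal_mult)
  finally have "ennreal (ln 2 * N) \<le> ennreal (ln 2 * P + 4 * \<kappa> * measure lborel (cball (0::'a) 2))"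
    using P0 by (simp add: ennreal_mult)
  then have "ln 2 * N \<le> ln 2 * P + 4 * \<kappa> * measure lborel (cball (0::'a) 2)"
    using P0 kappa by (subst (asm) ennreal_le_iff) auto
  then have "N - P \<le> drift_bound TYPE('a) \<kappa>"
    unfolding drift_bound_def by (subst pos_le_divide_eq) (auto simp: algebra_simps)
  moreover have "(\<integral>h. ?q h * (b \<bullet> h) \<partial>lborel) = P - N"
    unfolding P_def N_def by (subst Bochner_Integration.integral_diff[OF i, symmetric])
      (intro Bochner_Integration.integral_cong, auto simp: max_def)
  ultimately show ?thesis by linarith
qed

text \<open>The exponent \<open>DIM('a) + 2\<close> is the one for which the second moment is
  invariant under rescaling by \<open>\<eta> x\<close>. The support of the kernel lies in a ball
  inside \<Omega>, so the indicators do not cut it.\<close>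

lemma symmetric_second_moment:
  assumes x: "x \<in> \<Omega>"
  shows "(\<integral>h. akernel \<Omega> \<eta> hat x (x + h) * (b \<bullet> h)\<^sup>2 \<partial>lborel) = second_moment b"
proof -
  note e = eta_pos[OF x]
  have a: "akernel \<Omega> \<eta> hat x (x + h) = hat (norm h / \<eta> x) / \<eta> x ^ (DIM('a) + 2)" for h
  proof (cases "norm h < \<eta> x")
    case True
    then show ?thesis using x ball_dom[OF x True] by (simp add: akernel_def)
  next
    case False
    then have "1/4 \<le> norm h / \<eta> x" using e by (simp add: field_simps)
    then show ?thesis by (simp add: akernel_def hat_zero)
  qed
  let ?f = "\<lambda>h. hat (norm h / \<eta> x) / \<eta> x ^ (DIM('a) + 2) * (b \<bullet> h)\<^sup>2"
  have nn: "0 \<le> ?f h" for h using e hat_nonneg by simp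
  have "(\<integral>\<^sup>+h. ennreal (?f h) \<partial>lborel) = ennreal (\<eta> x ^ DIM('a)) * (\<integral>\<^sup>+h. ennreal (?f (\<eta> x *\<^sub>R h)) \<partial>lborel)"
    using e by (subst nn_integral_lborel_scale[of _ "\<eta> x"]) auto
  also have "\<dots> = (\<integral>\<^sup>+h. ennreal (\<eta> x ^ DIM('a)) * ennreal (?f (\<eta> x *\<^sub>R h)) \<partial>lborel)"
    by (subst nn_integral_cmult) auto
  also have "\<dots> = (\<integral>\<^sup>+z. ennreal (hat (norm z) * (b \<bullet> z)\<^sup>2) \<partial>lborel)"
  proof (rule nn_integral_cong)
    fix h
    have "ennreal (\<eta> x ^ DIM('a)) * ennreal (?f (\<eta> x *\<^sub>R h)) = ennreal (\<eta> x ^ DIM('a) * ?f (\<eta> x *\<^sub>R h))"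
      using e nn by (simp only: ennreal_mult[OF _ nn] zero_le_power less_imp_le)
    also have "\<eta> x ^ DIM('a) * ?f (\<eta> x *\<^sub>R h) = hat (norm h) * (b \<bullet> h)\<^sup>2"
      using e by (simp add: power_mult_distrib power_add power2_eq_square)
    finally show "ennreal (\<eta> x ^ DIM('a)) * ennreal (?f (\<eta> x *\<^sub>R h)) = ennreal (hat (norm h) * (b \<bullet> h)\<^sup>2)" .
  qed
  finally have "(\<integral>h. ?f h \<partial>lborel) = second_moment b"
    unfolding second_moment_def using nn hat_nonneg by (subst (1 2) integral_eq_nn_integral) auto
  then show ?thesis by (simp add: a)
qed

text \<open>The even kernel makes the second difference of the exponential quadratic in \<open>l\<close>; the adjoint
  kernel contributes at worst its first moment, which is linear in \<open>l\<close>, by \<open>exp s - 1 \<ge> s\<close>.\<close>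

lemma exponential_drift:
  assumes x: "x \<in> \<Omega>" and b: "norm b = 1" and l: "0 \<le> l"
  shows "l\<^sup>2 * second_moment b / 2 - l * drift_bound TYPE('a) \<kappa> \<le>
    (\<integral>h. (akernel \<Omega> \<eta> hat x (x + h) + akernel \<Omega> \<eta> hat (x + h) x) * (exp (l * (b \<bullet> h)) - 1) \<partial>lborel)"
proof -
  let ?a = "\<lambda>h. akernel \<Omega> \<eta> hat x (x + h)"
  let ?q = "\<lambda>h. akernel \<Omega> \<eta> hat (x + h) x"
  have bh: "\<bar>b \<bullet> h\<bar> \<le> norm h" for h using Cauchy_Schwarz_ineq2[of b h] b by simp
  have eb: "\<bar>exp (s * (b \<bullet> h)) - 1\<bar> \<le> exp (\<bar>s\<bar> * \<eta> x) + 1" if "norm h \<le> \<eta> x" for h s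
  proof -
    have "\<bar>s * (b \<bullet> h)\<bar> \<le> \<bar>s\<bar> * \<eta> x" using bh[of h] that by (simp add: abs_mult mult_left_mono)
    then have "exp (s * (b \<bullet> h)) \<le> exp (\<bar>s\<bar> * \<eta> x)" by simp
    then show ?thesis using exp_gt_zero[of "s * (b \<bullet> h)"] by linarith
  qed
  have ie: "integrable lborel (\<lambda>h. ?q h * (exp (s * (b \<bullet> h)) - 1))" "integrable lborel (\<lambda>h. ?a h * (exp (s * (b \<bullet> h)) - 1))" for s
    by (rule adjoint_integrable[OF x _ eb], measurable)+
  have i1: "integrable lborel (\<lambda>h. ?q h * (b \<bullet> h))"
    using bh by (intro adjoint_integrable[OF x, where B = "\<eta> x"]) (auto intro: order_trans)
  have i2: "integrable lborel (\<lambda>h. ?a h * (b \<bullet> h)\<^sup>2)"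
  proof (rule adjoint_integrable(2)[OF x])
    show "\<bar>(b \<bullet> h)\<^sup>2\<bar> \<le> (\<eta> x)\<^sup>2" if "norm h \<le> \<eta> x" for h
      using bh[of h] that by (simp add: abs_le_square_iff[symmetric])
  qed simp
  have even: "?a (- h) = ?a h" for h
  proof (cases "norm h < \<eta> x")
    case True
    then show ?thesis using ball_dom[OF x True] ball_dom[OF x, of "- h"] by (simp add: akernel_def)
  next
    case False
    then have "?a h = 0" "?a (- h) = 0" using akernel_hat_support(3)[of x "x + h"] akernel_hat_support(3)[of x "x - h"] eta_pos[OF x]
      by fastforce+
    then show ?thesis by simp
  qed
  have "(\<integral>h. ?a h * (exp (l * (b \<bullet> h)) - 1) \<partial>lborel) = (\<integral>h. ?a (- h) * (exp (l * (b \<bullet> - h)) - 1) \<partial>lborel)"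
    by (rule integral_lborel_reflect[symmetric]) measurable
  \<comment> \<open>Averaging with the reflected integral replaces the first difference of the
    exponential by the second difference that \<open>cosh_ge\<close> bounds.\<close>
  then have "2 * (\<integral>h. ?a h * (exp (l * (b \<bullet> h)) - 1) \<partial>lborel)
    = (\<integral>h. ?a h * (exp (l * (b \<bullet> h)) - 1) \<partial>lborel) + (\<integral>h. ?a h * (exp (- l * (b \<bullet> h)) - 1) \<partial>lborel)"
    unfolding even by simp
  also have "\<dots> = (\<integral>h. ?a h * (exp (l * (b \<bullet> h)) - 1) + ?a h * (exp (- l * (b \<bullet> h)) - 1) \<partial>lborel)"
    by (rule Bochner_Integration.integral_add[OF ie(2) ie(2), symmetric])
  also have "\<dots> \<ge> (\<integral>h. l\<^sup>2 * (?a h * (b \<bullet> h)\<^sup>2) \<partial>lborel)"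
  proof (rule integral_mono)
    show "l\<^sup>2 * (?a h * (b \<bullet> h)\<^sup>2) \<le> ?a h * (exp (l * (b \<bullet> h)) - 1) + ?a h * (exp (- l * (b \<bullet> h)) - 1)" for h
      using mult_left_mono[OF cosh_ge[of "l * (b \<bullet> h)"] akernel_hat_nonneg[of x "x + h"]]
      by (simp add: algebra_simps power_mult_distrib)
  qed (intro integrable_mult_right i2 Bochner_Integration.integrable_add ie)+
  finally have A: "l\<^sup>2 * second_moment b \<le> 2 * (\<integral>h. ?a h * (exp (l * (b \<bullet> h)) - 1) \<partial>lborel)"
    by (simp add: symmetric_second_moment[OF x])
  have "l * (\<integral>h. ?q h * (b \<bullet> h) \<partial>lborel) = (\<integral>h. l * (?q h * (b \<bullet> h)) \<partial>lborel)" by simp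
  also have "\<dots> \<le> (\<integral>h. ?q h * (exp (l * (b \<bullet> h)) - 1) \<partial>lborel)"
  proof (rule integral_mono)
    show "l * (?q h * (b \<bullet> h)) \<le> ?q h * (exp (l * (b \<bullet> h)) - 1)" for h
    proof -
      have "l * (b \<bullet> h) \<le> exp (l * (b \<bullet> h)) - 1" using exp_ge_add_one_self[of "l * (b \<bullet> h)"] by linarith
      from mult_left_mono[OF this akernel_hat_nonneg[of "x + h" x]] show ?thesis by (simp add: mult_ac)
    qed
  qed (intro integrable_mult_right i1 ie)+
  finally have Q: "- (l * drift_bound TYPE('a) \<kappa>) \<le> (\<integral>h. ?q h * (exp (l * (b \<bullet> h)) - 1) \<partial>lborel)"
    using mult_left_mono[OF adjoint_first_moment[OF x b] l] by simp
  show ?thesis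
    unfolding distrib_right using A Q by (subst Bochner_Integration.integral_add[OF ie(2) ie(1)]) linarith
qed

end

section \<open>Nonlocal Poincare inequality\<close>

text \<open>The difference of the two sides is a perfect square divided by
  \<open>v * w\<close>.\<close>

lemma picone:
  fixes a b v w :: real
  assumes "0 < v" "0 < w"
  shows "(w - v) * (a\<^sup>2 / w - b\<^sup>2 / v) \<le> (a - b)\<^sup>2"
proof -
  have "(a - b)\<^sup>2 - (w - v) * (a\<^sup>2 / w - b\<^sup>2 / v) = (a * v - b * w)\<^sup>2 / (v * w)"
    using assms by (simp add: field_simps power2_eq_square)
  also have "\<dots> \<ge> 0" using assms by simp
  finally show ?thesis by simp
qed

text \<open>The right-hand side integrates the positive part of \<open>f\<close> only. This leads
  from a signed Picone integrand back to an energy in \<open>ennreal\<close>.\<close>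

lemma ennreal_integral_le:
  assumes "integrable M f"
  shows "ennreal (\<integral>x. f x \<partial>M) \<le> (\<integral>\<^sup>+x. ennreal (f x) \<partial>M)"
proof -
  have fin: "(\<integral>\<^sup>+x. ennreal (f x) \<partial>M) < \<infinity>"
    using assms by (metis real_integrable_def infinity_ennreal_def top.not_eq_extremum)
  have "(\<integral>x. f x \<partial>M) \<le> enn2real (\<integral>\<^sup>+x. ennreal (f x) \<partial>M)"
    using real_lebesgue_integral_def[OF assms] by simp
  then have "ennreal (\<integral>x. f x \<partial>M) \<le> ennreal (enn2real (\<integral>\<^sup>+x. ennreal (f x) \<partial>M))"
    by (rule ennreal_leI)
  then show ?thesis by (metis ennreal_enn2real fin infinity_ennreal_def)
qed

context localization
begin

lemma energy_prod:
  assumes [measurable]: "\<psi> \<in> borel_measurable borel" "u \<in> borel_measurable borel"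
  shows "energy \<Omega> \<eta> \<psi> u =
    (\<integral>\<^sup>+p. ennreal (akernel \<Omega> \<eta> \<psi> (fst p) (snd p) * (u (fst p) - u (snd p))\<^sup>2) \<partial>(lborel \<Otimes>\<^sub>M lborel))"
proof -
  have "(\<lambda>p. ennreal (akernel \<Omega> \<eta> \<psi> (fst p) (snd p) * (u (fst p) - u (snd p))\<^sup>2)) \<in> borel_measurable (lborel \<Otimes>\<^sub>M lborel)"
    by measurable
  from lborel.nn_integral_fst[OF this] show ?thesis by (simp add: energy_def)
qed

text \<open>The supersolution is \<open>w x = 2 exp (l r) - exp (l (b \<bullet> x))\<close>: by \<open>exponential_drift\<close>, the nonlocal
  operator applied to \<open>w\<close> is at least \<open>exp (l (b \<bullet> x))\<close>.\<close>

lemma poincare_compact_support: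
  assumes [measurable]: "u \<in> borel_measurable borel"
    and supp: "\<And>x. u x \<noteq> 0 \<Longrightarrow> x \<in> \<Omega> \<and> m \<le> \<eta> x" and m: "0 < m" and bdd: "\<And>x. \<bar>u x\<bar> \<le> U"
    and b: "norm (b::'a) = 1" and l: "0 \<le> l" "1 \<le> l\<^sup>2 * second_moment b / 2 - l * drift_bound TYPE('a) \<kappa>"
    and rad: "\<And>x. x \<in> \<Omega> \<Longrightarrow> norm x \<le> r"
  shows "(\<integral>\<^sup>+x. ennreal ((u x)\<^sup>2) \<partial>lborel) \<le> ennreal (2 * exp (2 * l * r)) * energy \<Omega> \<eta> hat u"
proof -
  define M where "M = exp (l * r)"
  define E where "E = (\<lambda>x::'a. exp (l * (b \<bullet> x)))"
  \<comment> \<open>\<open>M\<close> bounds \<open>E\<close> on \<Omega>; the factor 2 keeps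
    \<open>w\<close> between \<open>M\<close> and \<open>2 * M\<close> there.\<close>
  define w where "w = (\<lambda>x. 2 * M - E x)"
  define v where "v = (\<lambda>x. (u x)\<^sup>2 / w x)"
  have M0: "0 < M" by (simp add: M_def)
  have E0: "0 < E x" for x by (simp add: E_def)
  have bx: "\<bar>l * (b \<bullet> x)\<bar> \<le> l * r" if "x \<in> \<Omega>" for x
    using Cauchy_Schwarz_ineq2[of b x] b l rad[OF that] by (simp add: abs_mult mult_left_mono)
  have EM: "E x \<le> M" "1 / M \<le> E x" if "x \<in> \<Omega>" for x
    using bx[OF that] unfolding E_def M_def by (auto simp: abs_le_iff exp_minus[symmetric] inverse_eq_divide[symmetric])
  have wM: "M \<le> w x" "w x \<le> 2 * M" "0 < w x" if "x \<in> \<Omega>" for x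
    using EM[OF that] E0[of x] M0 by (auto simp: w_def)
  have [measurable]: "E \<in> borel_measurable borel" "w \<in> borel_measurable borel" "v \<in> borel_measurable borel"
    unfolding E_def w_def v_def by measurable
  have v0: "0 \<le> v x" "v x \<le> U\<^sup>2 / M" and vs: "v x \<noteq> 0 \<Longrightarrow> x \<in> \<Omega> \<and> m \<le> \<eta> x" for x
  proof -
    show "0 \<le> v x" using wM[of x] supp[of x] by (cases "u x = 0") (auto simp: v_def)
    show "v x \<noteq> 0 \<Longrightarrow> x \<in> \<Omega> \<and> m \<le> \<eta> x" using supp[of x] by (auto simp: v_def)
    have "(u x)\<^sup>2 \<le> U\<^sup>2" using bdd[of x] by (simp add: abs_le_square_iff[symmetric])
    then show "v x \<le> U\<^sup>2 / M" using wM[of x] supp[of x] M0 by (cases "u x = 0") (auto simp: v_def intro!: frac_le)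
  qed
  let ?A = "akernel \<Omega> \<eta> hat"
  let ?L2 = "lborel \<Otimes>\<^sub>M lborel :: ('a \<times> 'a) measure"
  have domfin: "emeasure lborel \<Omega> < \<infinity>" using bounded_dom by (rule emeasure_bounded_finite)
  have int: "integrable ?L2 (\<lambda>p. f (fst p) (snd p))"
    if [measurable]: "(\<lambda>p. f (fst p) (snd p)) \<in> borel_measurable ?L2"
      and f: "\<And>x y. x \<in> \<Omega> \<Longrightarrow> y \<in> \<Omega> \<Longrightarrow> \<bar>f x y\<bar> \<le> B" "\<And>x y. x \<notin> \<Omega> \<or> y \<notin> \<Omega> \<Longrightarrow> f x y = (0::real)" for f and B :: real
  proof (rule integrableI_bounded_set[where A = "\<Omega> \<times> \<Omega>" and B = B])
    show "emeasure ?L2 (\<Omega> \<times> \<Omega>) < \<infinity>"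
      using domfin by (simp add: lborel.emeasure_pair_measure_Times ennreal_mult_less_top)
    show "AE p in ?L2. p \<in> \<Omega> \<times> \<Omega> \<longrightarrow> norm (f (fst p) (snd p)) \<le> B"
      using f(1) by (intro AE_I2 impI) (auto simp: mem_Times_iff)
    show "AE p in ?L2. p \<notin> \<Omega> \<times> \<Omega> \<longrightarrow> f (fst p) (snd p) = 0"
      by (intro AE_I2 impI f(2)) (auto simp: mem_Times_iff)
  qed measurable
  \<comment> \<open>The support margin \<open>m\<close> and the bound \<open>U\<close> serve
    integrability: here they justify Fubini and the exchange of variables. Neither reaches the final
    constant.\<close>
  define B where "B = (2 / m) ^ (DIM('a) + 2) * (U\<^sup>2 / M) * M"
  have Ab: "\<bar>?A x y * (E y' - E x') * v z\<bar> \<le> B"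
    if "x \<in> \<Omega>" "y \<in> \<Omega>" "x' \<in> \<Omega>" "y' \<in> \<Omega>" "z = x \<or> z = y" for x y z x' y'
  proof (cases "v z = 0")
    case True
    then show ?thesis using m M0 by (simp add: B_def)
  next
    case False
    then have z: "z \<in> \<Omega>" "m \<le> \<eta> z" using vs by auto
    have "?A x y \<le> (2 / \<eta> z) ^ (DIM('a) + 2)" using akernel_hat_le[of z x y] that z by auto
    also have "\<dots> \<le> (2 / m) ^ (DIM('a) + 2)" using z m by (intro power_mono divide_left_mono) auto
    finally have a: "\<bar>?A x y\<bar> \<le> (2 / m) ^ (DIM('a) + 2)" using akernel_hat_nonneg by simp
    have e: "\<bar>E y' - E x'\<bar> \<le> M" using EM(1)[of x'] EM(1)[of y'] E0[of x'] E0[of y'] that by auto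
    have "\<bar>?A x y * (E y' - E x') * v z\<bar> = \<bar>?A x y\<bar> * \<bar>v z\<bar> * \<bar>E y' - E x'\<bar>" by (simp add: abs_mult)
    also have "\<dots> \<le> B" unfolding B_def using a e v0[of z] m M0 by (intro mult_mono mult_nonneg_nonneg) auto
    finally show ?thesis .
  qed
  have A0: "?A x y = 0" if "x \<notin> \<Omega> \<or> y \<notin> \<Omega>" for x y using that by (auto simp: akernel_def)
  \<comment> \<open>\<open>f1 + f2\<close> is the Picone integrand with \<open>v x\<close> and
    \<open>v y\<close> separated. Exchanging the variables turns \<open>f2\<close> into
    \<open>f3\<close>, so that \<open>v x\<close> factors out of \<open>f1 + f3\<close>; this is
    where the adjoint kernel enters.\<close>
  define f1 where "f1 = (\<lambda>x y. ?A x y * (E y - E x) * v x)"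
  define f2 where "f2 = (\<lambda>x y. ?A x y * (E x - E y) * v y)"
  define f3 where "f3 = (\<lambda>x y. ?A y x * (E y - E x) * v x)"
  have i1: "integrable ?L2 (\<lambda>p. f1 (fst p) (snd p))"
    unfolding f1_def by (rule int[where B = B]) (auto intro: Ab simp: A0)
  have i2: "integrable ?L2 (\<lambda>p. f2 (fst p) (snd p))"
    unfolding f2_def by (rule int[where B = B]) (auto intro: Ab simp: A0)
  have i3: "integrable ?L2 (\<lambda>p. f3 (fst p) (snd p))"
    unfolding f3_def by (rule int[where B = B]) (auto intro: Ab simp: A0)
  have swap: "(\<integral>p. f2 (fst p) (snd p) \<partial>?L2) = (\<integral>p. f3 (fst p) (snd p) \<partial>?L2)"
    using lborel_pair.integral_product_swap[OF borel_measurable_integrable[OF i2]]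
    by (simp add: f2_def f3_def case_prod_unfold)
  have pt: "f1 x y + f2 x y \<le> ?A x y * (u x - u y)\<^sup>2" for x y
  proof (cases "x \<in> \<Omega> \<and> y \<in> \<Omega>")
    case True
    have "(w x - w y) * (v x - v y) \<le> (u x - u y)\<^sup>2"
      unfolding v_def using wM True by (intro picone) auto
    then have "(E y - E x) * (v x - v y) \<le> (u x - u y)\<^sup>2"
      by (simp add: w_def)
    from mult_left_mono[OF this akernel_hat_nonneg[of x y]] show ?thesis
      by (simp add: f1_def f2_def algebra_simps)
  next
    case False
    then show ?thesis using A0[of x y] by (auto simp: f1_def f2_def)
  qed
  define F where "F = (\<lambda>x y. f1 x y + f3 x y)"
  have iF: "integrable ?L2 (\<lambda>(x, y). F x y)"
    unfolding F_def case_prod_unfold by (intro Bochner_Integration.integrable_add i1 i3)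
  have inner: "v x * E x \<le> (\<integral>y. F x y \<partial>lborel)" for x
  proof (cases "x \<in> \<Omega>")
    case False
    then have "v x = 0" using vs by blast
    then show ?thesis by (simp add: F_def f1_def f3_def)
  next
    case x: True
    have "(\<integral>y. F x y \<partial>lborel) = (\<integral>y. F x y \<partial>distr lborel borel ((+) x))"
      by (simp add: lborel_distr_plus)
    also have "\<dots> = (\<integral>h. F x (x + h) \<partial>lborel)"
      by (rule integral_distr) (auto simp: F_def f1_def f3_def)
    also have "\<dots> = (\<integral>h. v x * E x * ((?A x (x + h) + ?A (x + h) x) * (exp (l * (b \<bullet> h)) - 1)) \<partial>lborel)"
      by (intro Bochner_Integration.integral_cong) (auto simp: F_def f1_def f3_def E_def inner_add_right exp_add distrib_left algebra_simps)
    also have "\<dots> = v x * E x * (\<integral>h. (?A x (x + h) + ?A (x + h) x) * (exp (l * (b \<bullet> h)) - 1) \<partial>lborel)"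
      by simp
    also have "\<dots> \<ge> v x * E x * 1"
      using exponential_drift[OF x b l(1)] l(2) v0[of x] E0[of x] by (intro mult_left_mono) auto
    finally show ?thesis by simp
  qed
  \<comment> \<open>\<open>2 * exp (2 * l * r)\<close> is \<open>2 * M * M\<close>: one factor
    \<open>2 * M\<close> from the upper bound on \<open>w\<close>, one factor \<open>M\<close> from
    the lower bound \<open>1 / M\<close> on \<open>E\<close>.\<close>
  have lower: "1 / (2 * exp (2 * l * r)) * (u x)\<^sup>2 \<le> v x * E x" for x
  proof (cases "u x = 0")
    case False
    then have x: "x \<in> \<Omega>" using supp by blast
    have "2 * exp (2 * l * r) = 2 * M * M" by (simp add: M_def exp_add[symmetric])
    then have "1 / (2 * exp (2 * l * r)) * (u x)\<^sup>2 = (u x)\<^sup>2 / (2 * M) * (1 / M)" by simp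
    also have "\<dots> \<le> v x * E x"
      unfolding v_def using wM[OF x] EM[OF x] M0 E0[of x] by (intro mult_mono frac_le) auto
    finally show ?thesis .
  qed (simp add: v_def)
  have iu2: "integrable lborel (\<lambda>x. (u x)\<^sup>2)"
  proof (rule integrableI_bounded_set[where A = \<Omega> and B = "U\<^sup>2"])
    show "AE x in lborel. x \<in> \<Omega> \<longrightarrow> norm ((u x)\<^sup>2) \<le> U\<^sup>2"
      using bdd by (intro AE_I2 impI) (auto simp: abs_le_square_iff[symmetric] intro: order_trans[OF _ abs_ge_self])
  qed (use supp domfin in auto)
  then have iu: "integrable lborel (\<lambda>x. 1 / (2 * exp (2 * l * r)) * (u x)\<^sup>2)"
    by (rule integrable_mult_right)
  have "1 / (2 * exp (2 * l * r)) * (\<integral>x. (u x)\<^sup>2 \<partial>lborel) = (\<integral>x. 1 / (2 * exp (2 * l * r)) * (u x)\<^sup>2 \<partial>lborel)"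
    by simp
  also have "\<dots> \<le> (\<integral>x. (\<integral>y. F x y \<partial>lborel) \<partial>lborel)"
    using iu lborel_pair.integrable_fst[OF iF] by (rule integral_mono) (rule order_trans[OF lower inner])
  also have "\<dots> = (\<integral>p. f1 (fst p) (snd p) + f2 (fst p) (snd p) \<partial>?L2)"
    using lborel_pair.integral_fst[OF iF] swap
    by (simp add: F_def case_prod_unfold Bochner_Integration.integral_add[OF i1 i3] Bochner_Integration.integral_add[OF i1 i2])
  finally have "ennreal (1 / (2 * exp (2 * l * r)) * (\<integral>x. (u x)\<^sup>2 \<partial>lborel))
      \<le> ennreal (\<integral>p. f1 (fst p) (snd p) + f2 (fst p) (snd p) \<partial>?L2)"
    by (rule ennreal_leI)
  also have "\<dots> \<le> (\<integral>\<^sup>+p. ennreal (f1 (fst p) (snd p) + f2 (fst p) (snd p)) \<partial>?L2)"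
    by (rule ennreal_integral_le) (intro Bochner_Integration.integrable_add i1 i2)
  also have "\<dots> \<le> energy \<Omega> \<eta> hat u"
    by (subst energy_prod) (auto intro!: nn_integral_mono ennreal_leI pt)
  finally have fin: "ennreal (1 / (2 * exp (2 * l * r)) * (\<integral>x. (u x)\<^sup>2 \<partial>lborel)) \<le> energy \<Omega> \<eta> hat u" .
  have "(\<integral>\<^sup>+x. ennreal ((u x)\<^sup>2) \<partial>lborel) = ennreal (\<integral>x. (u x)\<^sup>2 \<partial>lborel)"
    using iu2 by (intro nn_integral_eq_integral) auto
  also have "\<dots> = ennreal (2 * exp (2 * l * r)) * ennreal (1 / (2 * exp (2 * l * r)) * (\<integral>x. (u x)\<^sup>2 \<partial>lborel))"
    by (subst ennreal_mult'[symmetric]) auto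
  also have "\<dots> \<le> ennreal (2 * exp (2 * l * r)) * energy \<Omega> \<eta> hat u"
    by (intro mult_left_mono fin) auto
  finally show ?thesis .
qed

end

text \<open>The constant is fixed before \<open>\<eta>\<close>, \<open>u\<close>, \<open>m\<close>
  and \<open>U\<close>: it is built from \<Omega> and \<kappa> alone, which is the uniformity in
  \<delta>.\<close>

lemma poincare_constant:
  fixes \<Omega> :: "'a::euclidean_space set"
  assumes "bounded \<Omega>" "0 \<le> \<kappa>"
  shows "\<exists>C\<ge>0. \<forall>\<eta> G u m U. localization \<Omega> \<eta> G \<kappa> \<longrightarrow> u \<in> borel_measurable borel \<longrightarrow>
    (\<forall>x. u x \<noteq> 0 \<longrightarrow> x \<in> \<Omega> \<and> m \<le> \<eta> x) \<longrightarrow> 0 < m \<longrightarrow> (\<forall>x. \<bar>u x\<bar> \<le> U) \<longrightarrow>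
    (\<integral>\<^sup>+x. ennreal ((u x)\<^sup>2) \<partial>lborel) \<le> ennreal C * energy \<Omega> \<eta> hat u"
proof -
  obtain b :: 'a where b: "b \<in> Basis" using nonempty_Basis by blast
  have nb: "norm b = 1" and b0: "b \<noteq> 0" using b nonzero_Basis by auto
  obtain r where r: "\<And>x. x \<in> \<Omega> \<Longrightarrow> norm x \<le> r" using assms(1) by (auto simp: bounded_iff)
  define D where "D = drift_bound TYPE('a) \<kappa>"
  define S where "S = second_moment b"
  \<comment> \<open>The first summand makes \<open>l * S / 2\<close> at least \<open>D + 1\<close>;
    the second makes \<open>l\<close> at least 1, so that multiplying by \<open>l\<close> keeps the
    gap of 1.\<close>
  define l where "l = 2 * (D + 1) / S + 1"
  have S: "0 < S" unfolding S_def by (rule second_moment_pos[OF b0])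
  have D: "0 \<le> D" unfolding D_def drift_bound_def using assms(2) by simp
  have l1: "1 \<le> l" using S D by (simp add: l_def)
  have "l * S / 2 = D + 1 + S / 2" using S by (simp add: l_def field_simps)
  then have "1 \<le> l * S / 2 - D" using S by linarith
  then have "1 * 1 \<le> l * (l * S / 2 - D)" using l1 by (intro mult_mono) auto
  then have l2: "1 \<le> l\<^sup>2 * S / 2 - l * D" by (simp add: power2_eq_square algebra_simps)
  have "(\<integral>\<^sup>+x. ennreal ((u x)\<^sup>2) \<partial>lborel) \<le> ennreal (2 * exp (2 * l * r)) * energy \<Omega> \<eta> hat u"
    if "localization \<Omega> \<eta> G \<kappa>" "u \<in> borel_measurable borel" "\<forall>x. u x \<noteq> 0 \<longrightarrow> x \<in> \<Omega> \<and> m \<le> \<eta> x"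
      "0 < m" "\<forall>x. \<bar>u x\<bar> \<le> U" for \<eta> G u m U
    using localization.poincare_compact_support[OF that(1,2), of m U b l r] that(3-5) nb l1 l2 r
    unfolding D_def S_def by auto
  then show ?thesis by (intro exI[of _ "2 * exp (2 * l * r)"]) auto
qed

section \<open>Riesz representation for semi-inner products\<close>

text \<open>The discriminant criterion. The degenerate case \<open>c = 0\<close> has to be covered
  because forms that are only semidefinite are fed into it.\<close>

lemma quadratic_nonneg_bound:
  fixes a b c :: real
  assumes "\<And>t. 0 \<le> a + 2 * t * b + t\<^sup>2 * c" "0 \<le> c"
  shows "b\<^sup>2 \<le> a * c"
proof (cases "c = 0")
  case True
  have "b = 0"
  proof (rule ccontr)
    assume "b \<noteq> 0"
    \<comment> \<open>At this \<open>t\<close> the affine function \<open>a + 2 * t * b\<close>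
      takes the value -1.\<close>
    then show False using assms(1)[of "- (a + 1) / (2 * b)"] True by (simp add: field_simps)
  qed
  then show ?thesis using True by simp
next
  case False
  then have "0 < c" using assms(2) by simp
  have "0 \<le> a + 2 * (- b / c) * b + (- b / c)\<^sup>2 * c" by (rule assms(1))
  also have "\<dots> = a - b\<^sup>2 / c" using \<open>0 < c\<close> by (simp add: power2_eq_square field_simps)
  finally show ?thesis using \<open>0 < c\<close> by (simp add: field_simps)
qed

lemma tendsto_zero_of_square:
  fixes a :: "nat \<Rightarrow> real"
  assumes "(\<lambda>n. (a n)\<^sup>2) \<longlonglongrightarrow> 0"
  shows "a \<longlonglongrightarrow> 0"
  using tendsto_real_sqrt[OF assms] by (simp add: tendsto_rabs_zero_iff)

text \<open>Vectors are functions, not equivalence classes, so the form is only semidefinite and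
  solutions are not unique as functions. Uniqueness up to null sets is recovered later from
  coercivity.\<close>

locale semi_inner =
  fixes V :: "('a \<Rightarrow> real) set" and B :: "('a \<Rightarrow> real) \<Rightarrow> ('a \<Rightarrow> real) \<Rightarrow> real"
  assumes V_ne: "V \<noteq> {}"
    and V_add: "u \<in> V \<Longrightarrow> v \<in> V \<Longrightarrow> (\<lambda>x. u x + v x) \<in> V"
    and V_scale: "u \<in> V \<Longrightarrow> (\<lambda>x. c * u x) \<in> V"
    and B_sym: "u \<in> V \<Longrightarrow> v \<in> V \<Longrightarrow> B u v = B v u"
    and B_add: "u \<in> V \<Longrightarrow> v \<in> V \<Longrightarrow> w \<in> V \<Longrightarrow> B (\<lambda>x. u x + v x) w = B u w + B v w"
    and B_scale: "u \<in> V \<Longrightarrow> w \<in> V \<Longrightarrow> B (\<lambda>x. c * u x) w = c * B u w"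
    and B_pos: "u \<in> V \<Longrightarrow> 0 \<le> B u u"
begin

lemma V_diff: "u \<in> V \<Longrightarrow> v \<in> V \<Longrightarrow> (\<lambda>x. u x - v x) \<in> V"
  using V_add[of u "\<lambda>x. (- 1) * v x"] V_scale[of v "- 1"] by simp

lemma B_combine:
  assumes "u \<in> V" "v \<in> V"
  shows "B (\<lambda>x. u x + t * v x) (\<lambda>x. u x + t * v x) = B u u + 2 * t * B u v + t\<^sup>2 * B v v"
proof -
  note tv = V_scale[OF assms(2), of t]
  note s = V_add[OF assms(1) tv]
  have "B (\<lambda>x. u x + t * v x) w = B u w + t * B v w" if "w \<in> V" for w
    using B_add[OF assms(1) tv that] B_scale[OF assms(2) that] by simp
  from this[OF s] this[OF assms(1)] this[OF assms(2)] show ?thesis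
    using B_sym[OF assms(1) s] B_sym[OF assms(2) s] B_sym[OF assms]
    by (simp add: algebra_simps power2_eq_square)
qed

lemma B_diff_self:
  assumes "u \<in> V" "v \<in> V"
  shows "B (\<lambda>x. u x - v x) (\<lambda>x. u x - v x) = B u u - 2 * B u v + B v v"
  using B_combine[OF assms, of "- 1"] by simp

lemma B_diff_left:
  assumes "u \<in> V" "v \<in> V" "w \<in> V"
  shows "B (\<lambda>x. u x - v x) w = B u w - B v w"
  using B_add[OF assms(1) V_scale[OF assms(2), of "- 1"] assms(3)] B_scale[OF assms(2,3), of "- 1"] by simp

lemma B_Cauchy_Schwarz: "u \<in> V \<Longrightarrow> v \<in> V \<Longrightarrow> (B u v)\<^sup>2 \<le> B u u * B v v"
  by (rule quadratic_nonneg_bound) (auto simp: B_combine[symmetric] intro!: B_pos V_add V_scale)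

text \<open>A minimizing sequence of \<open>B v v - 2 f v\<close> is Cauchy by the parallelogram identity.\<close>

lemma riesz_representation:
  assumes f_add: "\<And>u v. u \<in> V \<Longrightarrow> v \<in> V \<Longrightarrow> f (\<lambda>x. u x + v x) = f u + f v"
    and f_scale: "\<And>u c. u \<in> V \<Longrightarrow> f (\<lambda>x. c * u x) = c * f u"
    and f_bound: "\<And>u. u \<in> V \<Longrightarrow> (f u)\<^sup>2 \<le> K * B u u" and K: "0 \<le> K"
    and complete: "\<And>X. (\<And>n::nat. X n \<in> V) \<Longrightarrow>
      (\<And>e. 0 < e \<Longrightarrow> \<exists>N. \<forall>m\<ge>N. \<forall>n\<ge>N. B (\<lambda>x. X m x - X n x) (\<lambda>x. X m x - X n x) < e) \<Longrightarrow>
      \<exists>u\<in>V. (\<lambda>n. B (\<lambda>x. X n x - u x) (\<lambda>x. X n x - u x)) \<longlonglongrightarrow> 0"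
  shows "\<exists>u\<in>V. \<forall>v\<in>V. B u v = f v"
proof -
  define J where "J = (\<lambda>v. B v v - 2 * f v)"
  have Jlow: "- K \<le> J v" if "v \<in> V" for v
  proof -
    \<comment> \<open>The arithmetic-geometric mean inequality lets \<open>K + B v v\<close> absorb
      \<open>2 * f v\<close>.\<close>
    have "\<bar>f v\<bar> \<le> sqrt (K * B v v)" using f_bound[OF that] by (rule real_le_rsqrt[of "\<bar>f v\<bar>", simplified])
    also have "\<dots> \<le> (K + B v v) / 2" using K B_pos[OF that] by (rule arith_geo_mean_sqrt)
    finally show ?thesis by (simp add: J_def)
  qed
  define m where "m = Inf (J ` V)"
  have bdd: "bdd_below (J ` V)" using Jlow by (auto simp: bdd_below_def)
  have mle: "m \<le> J v" if "v \<in> V" for v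
    unfolding m_def using bdd that by (intro cInf_lower) auto
  have "\<exists>v\<in>V. J v < m + 1 / real (Suc n)" for n
    using cInf_lessD[of "J ` V" "m + 1 / real (Suc n)"] V_ne by (auto simp: m_def)
  then obtain X where XV: "\<And>n. X n \<in> V" and XJ: "\<And>n. J (X n) < m + 1 / real (Suc n)" by metis
  have f_comb: "f (\<lambda>x. u x + t * v x) = f u + t * f v" if "u \<in> V" "v \<in> V" for u v t
    using f_add[OF that(1) V_scale[OF that(2), of t]] f_scale[OF that(2), of t] by simp
  have cauchy: "B (\<lambda>x. X i x - X j x) (\<lambda>x. X i x - X j x) \<le> 2 / real (Suc i) + 2 / real (Suc j)" for i j
  proof -
    \<comment> \<open>Half of \<open>X i\<close>, so that the midpoint of \<open>X i\<close> and
      \<open>X j\<close> has the form to which \<open>B_combine\<close> and \<open>f_comb\<close>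
      apply. \<open>J\<close> at the midpoint is at least \<open>m\<close>; this bounds the mixed
      term \<open>B (X i) (X j)\<close> from below.\<close>
    define a where "a = (\<lambda>x. 1/2 * X i x)"
    have aV: "a \<in> V" unfolding a_def by (rule V_scale[OF XV])
    have mV: "(\<lambda>x. a x + 1/2 * X j x) \<in> V" by (rule V_add[OF aV V_scale[OF XV]])
    have Ba: "B a w = 1/2 * B (X i) w" "f a = 1/2 * f (X i)" if "w \<in> V" for w
      using B_scale[OF XV[of i] that, of "1/2"] f_scale[OF XV[of i], of "1/2"] by (simp_all add: a_def)
    have "B a a = 1/4 * B (X i) (X i)"
      using Ba(1)[OF aV] Ba(1)[OF XV[of i]] B_sym[OF XV[of i] aV] by simp
    then have "J (\<lambda>x. a x + 1/2 * X j x) = 1/4 * (B (X i) (X i) + 2 * B (X i) (X j) + B (X j) (X j)) - (f (X i) + f (X j))"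
      using B_combine[OF aV XV[of j], of "1/2"] f_comb[OF aV XV[of j], of "1/2"] Ba[OF XV[of j]]
      unfolding J_def by (simp only: power_divide one_power2) simp
    moreover have "4 * y \<le> S - 4 * F" if "z = 1/4 * S - F" "y \<le> z" for y z S F :: real
      using that by simp
    ultimately have "4 * m \<le> B (X i) (X i) + 2 * B (X i) (X j) + B (X j) (X j) - 4 * (f (X i) + f (X j))"
      using mle[OF mV] by blast
    moreover have "2 * J (X i) + 2 * J (X j) \<le> 4 * m + 2 / real (Suc i) + 2 / real (Suc j)"
      using XJ[of i] XJ[of j] by simp
    ultimately show ?thesis
      unfolding B_diff_self[OF XV XV] by (simp add: J_def)
  qed
  have "\<exists>u\<in>V. (\<lambda>n. B (\<lambda>x. X n x - u x) (\<lambda>x. X n x - u x)) \<longlonglongrightarrow> 0"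
  proof (rule complete[OF XV])
    fix e :: real assume "0 < e"
    then obtain N where N: "inverse (real (Suc N)) < e / 4" using reals_Archimedean[of "e / 4"] by auto
    have "B (\<lambda>x. X i x - X j x) (\<lambda>x. X i x - X j x) < e" if "N \<le> i" "N \<le> j" for i j
    proof -
      have "2 / real (Suc i) \<le> 2 / real (Suc N)" "2 / real (Suc j) \<le> 2 / real (Suc N)"
        using that by (auto intro!: divide_left_mono)
      then show ?thesis using cauchy[of i j] N by (simp add: inverse_eq_divide)
    qed
    then show "\<exists>N. \<forall>m\<ge>N. \<forall>n\<ge>N. B (\<lambda>x. X m x - X n x) (\<lambda>x. X m x - X n x) < e" by blast
  qed
  then obtain u where u: "u \<in> V" and lim: "(\<lambda>n. B (\<lambda>x. X n x - u x) (\<lambda>x. X n x - u x)) \<longlonglongrightarrow> 0" by blast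
  have "B u v = f v" if v: "v \<in> V" for v
  proof -
    \<comment> \<open>Since \<open>X n\<close> minimizes \<open>J\<close> up to
      \<open>1 / real (Suc n)\<close>, perturbing it by \<open>t * v\<close> gives a quadratic in
      \<open>t\<close> that stays nonnegative after adding this error. Its discriminant yields the
      Euler-Lagrange equation approximately, before passing to the limit.\<close>
    have var: "(B (X n) v - f v)\<^sup>2 \<le> (1 / real (Suc n)) * B v v" for n
    proof (rule quadratic_nonneg_bound[OF _ B_pos[OF v]])
      fix t
      have "m \<le> J (\<lambda>x. X n x + t * v x)" by (intro mle V_add XV V_scale v)
      also have "\<dots> = J (X n) + 2 * t * (B (X n) v - f v) + t\<^sup>2 * B v v"
        using B_combine[OF XV v] f_comb[OF XV v] by (simp add: J_def algebra_simps)
      finally show "0 \<le> 1 / real (Suc n) + 2 * t * (B (X n) v - f v) + t\<^sup>2 * B v v"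
        using XJ[of n] by linarith
    qed
    have "(\<lambda>n. (1 / real (Suc n)) * B v v) \<longlonglongrightarrow> 0 * B v v"
      by (intro tendsto_intros) (rule LIMSEQ_Suc[OF lim_1_over_n])
    then have "(\<lambda>n. (1 / real (Suc n)) * B v v) \<longlonglongrightarrow> 0" by simp
    then have "(\<lambda>n. (B (X n) v - f v)\<^sup>2) \<longlonglongrightarrow> 0"
      by (rule tendsto_sandwich[OF _ _ tendsto_const, rotated 2]) (use var in auto)
    then have l1: "(\<lambda>n. B (X n) v - f v) \<longlonglongrightarrow> 0" by (rule tendsto_zero_of_square)
    have "(\<lambda>n. B (\<lambda>x. X n x - u x) (\<lambda>x. X n x - u x) * B v v) \<longlonglongrightarrow> 0 * B v v"
      by (intro tendsto_intros lim)
    then have "(\<lambda>n. B (\<lambda>x. X n x - u x) (\<lambda>x. X n x - u x) * B v v) \<longlonglongrightarrow> 0" by simp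
    then have "(\<lambda>n. (B (\<lambda>x. X n x - u x) v)\<^sup>2) \<longlonglongrightarrow> 0"
      by (rule tendsto_sandwich[OF _ _ tendsto_const, rotated 2])
        (use B_Cauchy_Schwarz[OF V_diff[OF XV u] v] in auto)
    then have "(\<lambda>n. (B (X n) v - B u v)\<^sup>2) \<longlonglongrightarrow> 0"
      by (simp add: B_diff_left[OF XV u v])
    then have l2: "(\<lambda>n. B (X n) v - B u v) \<longlonglongrightarrow> 0" by (rule tendsto_zero_of_square)
    have "(\<lambda>n. (B (X n) v - f v) - (B (X n) v - B u v)) \<longlonglongrightarrow> 0 - 0"
      by (rule tendsto_diff[OF l1 l2])
    then have "(\<lambda>n::nat. B u v - f v) \<longlonglongrightarrow> 0" by simp
    from LIMSEQ_unique[OF this tendsto_const] show ?thesis by simp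
  qed
  then show ?thesis using u by blast
qed

end

section \<open>Borel representatives\<close>

text \<open>Fubini on \<open>lborel \<Otimes>\<^sub>M lborel\<close> needs Borel functions, whereas elements of \<open>W_space\<close> are only Lebesgue
  measurable.\<close>

definition rep :: "'a::euclidean_space set \<Rightarrow> ('a \<Rightarrow> real) \<Rightarrow> ('a \<Rightarrow> real) \<Rightarrow> bool" where
  "rep \<Omega> u u' \<longleftrightarrow> u' \<in> borel_measurable borel \<and> (\<forall>x. x \<notin> \<Omega> \<longrightarrow> u' x = 0) \<and>
     (AE x in lborel. x \<in> \<Omega> \<longrightarrow> u x = u' x)"

lemma lebesgue_integral_cong_AE':
  fixes f g :: "'a::euclidean_space \<Rightarrow> real"
  assumes "f \<in> borel_measurable borel" "AE x in lborel. f x = g x"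
  shows "(\<integral>x. g x \<partial>lebesgue) = (\<integral>x. f x \<partial>lborel)"
proof -
  have f: "f \<in> borel_measurable lebesgue" using assms(1) by (simp add: measurable_completion)
  have ae: "AE x in lebesgue. f x = g x" using assms(2) by (rule AE_completion)
  have "(\<integral>x. f x \<partial>lebesgue) = (\<integral>x. g x \<partial>lebesgue)"
    using f borel_measurable_AE[OF f ae] ae by (rule integral_cong_AE)
  then show ?thesis using assms(1) by (simp add: integral_completion)
qed

lemma nn_integral_lebesgue_on:
  assumes "\<Omega> \<in> sets borel"
  shows "(\<integral>\<^sup>+x. f x \<partial>lebesgue_on \<Omega>) = (\<integral>\<^sup>+x. f x * indicator \<Omega> x \<partial>lborel)"
  using assms by (subst nn_integral_restrict_space) (auto simp: nn_integral_completion sets_completionI_sets)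

lemma integral_lebesgue_on:
  fixes f :: "'a::euclidean_space \<Rightarrow> real"
  assumes "\<Omega> \<in> sets borel"
  shows "(\<integral>x. f x \<partial>lebesgue_on \<Omega>) = (\<integral>x. indicator \<Omega> x * f x \<partial>lebesgue)"
  using assms by (subst integral_restrict_space) (auto simp: sets_completionI_sets)

lemma rep_exists:
  assumes "\<Omega> \<in> sets borel" "u \<in> borel_measurable (lebesgue_on \<Omega>)"
  shows "\<exists>u'. rep \<Omega> u u'"
proof -
  have "(\<lambda>x. if x \<in> \<Omega> then u x else 0) \<in> borel_measurable lebesgue"
    using assms by (subst borel_measurable_if) (auto simp: sets_completionI_sets)
  then obtain g where g: "g \<in> borel_measurable lborel" "AE x in lborel. (if x \<in> \<Omega> then u x else 0) = g x"
    using completion_ex_borel_measurable_real by blast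
  have "rep \<Omega> u (\<lambda>x. indicator \<Omega> x * g x)"
    unfolding rep_def
  proof (intro conjI)
    show "(\<lambda>x. indicator \<Omega> x * g x) \<in> borel_measurable borel" using g(1) assms(1) by simp
    show "AE x in lborel. x \<in> \<Omega> \<longrightarrow> u x = indicator \<Omega> x * g x" using g(2) by eventually_elim auto
  qed auto
  then show ?thesis by blast
qed

lemma rep_measurable: "rep \<Omega> u u' \<Longrightarrow> u' \<in> borel_measurable borel"
  and rep_zero: "rep \<Omega> u u' \<Longrightarrow> x \<notin> \<Omega> \<Longrightarrow> u' x = 0"
  and rep_AE: "rep \<Omega> u u' \<Longrightarrow> AE x in lborel. x \<in> \<Omega> \<longrightarrow> u x = u' x"
  by (auto simp: rep_def)

lemma rep_combine:
  assumes "rep \<Omega> u u'" "rep \<Omega> v v'"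
  shows "rep \<Omega> (\<lambda>x. a * u x + b * v x) (\<lambda>x. a * u' x + b * v' x)"
proof -
  have "AE x in lborel. x \<in> \<Omega> \<longrightarrow> a * u x + b * v x = a * u' x + b * v' x"
    using rep_AE[OF assms(1)] rep_AE[OF assms(2)] by eventually_elim auto
  then show ?thesis using assms by (auto simp: rep_def)
qed

lemma rep_add: "rep \<Omega> u u' \<Longrightarrow> rep \<Omega> v v' \<Longrightarrow> rep \<Omega> (\<lambda>x. u x + v x) (\<lambda>x. u' x + v' x)"
  and rep_diff: "rep \<Omega> u u' \<Longrightarrow> rep \<Omega> v v' \<Longrightarrow> rep \<Omega> (\<lambda>x. u x - v x) (\<lambda>x. u' x - v' x)"
  and rep_scale: "rep \<Omega> u u' \<Longrightarrow> rep \<Omega> (\<lambda>x. c * u x) (\<lambda>x. c * u' x)"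
  using rep_combine[of \<Omega> u u' v v' 1 1] rep_combine[of \<Omega> u u' v v' 1 "- 1"] rep_combine[of \<Omega> u u' u u' c 0] by simp_all

section \<open>Squared norms and the form on Borel representatives\<close>

definition ssq :: "('a::euclidean_space \<Rightarrow> real) \<Rightarrow> ennreal" where
  "ssq u = (\<integral>\<^sup>+x. ennreal ((u x)\<^sup>2) \<partial>lborel)"

lemma ssq_combine_le:
  assumes [measurable]: "u \<in> borel_measurable borel" "v \<in> borel_measurable borel"
  shows "ssq (\<lambda>x. a * u x + b * v x) \<le> ennreal (2 * a\<^sup>2) * ssq u + ennreal (2 * b\<^sup>2) * ssq v"
proof -
  have p: "ennreal ((a * u x + b * v x)\<^sup>2) \<le> ennreal (2 * a\<^sup>2) * ennreal ((u x)\<^sup>2) + ennreal (2 * b\<^sup>2) * ennreal ((v x)\<^sup>2)" for x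
  proof -
    have "(a * u x + b * v x)\<^sup>2 \<le> 2 * a\<^sup>2 * (u x)\<^sup>2 + 2 * b\<^sup>2 * (v x)\<^sup>2"
      using sum_squares_bound[of "a * u x" "b * v x"] by (simp add: power2_eq_square algebra_simps)
    then have "ennreal ((a * u x + b * v x)\<^sup>2) \<le> ennreal (2 * a\<^sup>2 * (u x)\<^sup>2 + 2 * b\<^sup>2 * (v x)\<^sup>2)"
      by (rule ennreal_leI)
    also have "\<dots> = ennreal (2 * a\<^sup>2) * ennreal ((u x)\<^sup>2) + ennreal (2 * b\<^sup>2) * ennreal ((v x)\<^sup>2)"
      by (subst ennreal_plus) (simp_all only: ennreal_mult zero_le_power2 mult_nonneg_nonneg zero_le_numeral)
    finally show ?thesis .
  qed
  show ?thesis unfolding ssq_def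
    by (rule order_trans[OF nn_integral_mono[OF p]]) (simp add: nn_integral_add nn_integral_cmult)
qed

text \<open>The counterpart of \<open>B_form\<close> as one integral over the product space. Where
  the integrand is integrable, symmetry and linearity are immediate for it, unlike for an iterated
  integral of Lebesgue measurable functions.\<close>

definition bilin :: "'a::euclidean_space set \<Rightarrow> ('a \<Rightarrow> real) \<Rightarrow> (real \<Rightarrow> real) \<Rightarrow> ('a \<Rightarrow> real) \<Rightarrow> ('a \<Rightarrow> real) \<Rightarrow> real" where
  "bilin \<Omega> \<eta> \<psi> u v = (\<integral>p. (akernel \<Omega> \<eta> \<psi> (fst p) (snd p) + akernel \<Omega> \<eta> \<psi> (snd p) (fst p)) / 2 *
     (u (fst p) - u (snd p)) * (v (fst p) - v (snd p)) \<partial>(lborel \<Otimes>\<^sub>M lborel))"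

context localization
begin

lemma W_norm2_rep:
  assumes r: "rep \<Omega> u u'"
  shows "W_norm2 \<Omega> R \<eta> u = ssq u' + energy \<Omega> \<eta> (indicator {..R}) u'"
proof -
  note ae = rep_AE[OF r] and z = rep_zero[OF r]
  have "(\<integral>\<^sup>+x. ennreal ((u x)\<^sup>2) \<partial>lebesgue_on \<Omega>) = ssq u'"
    unfolding nn_integral_lebesgue_on[OF dom_borel] ssq_def
    by (rule nn_integral_cong_AE) (use ae z in \<open>auto simp: indicator_def\<close>)
  moreover have "W_seminorm2 \<Omega> R \<eta> u = energy \<Omega> \<eta> (indicator {..R}) u'"
    unfolding W_seminorm2_def nn_integral_lebesgue_on[OF dom_borel] energy_def
  proof (rule nn_integral_cong_AE)
    have S: "\<Omega> \<inter> {y. norm (y - x) \<le> R * \<eta> x} \<in> sets borel" for x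
      by (intro sets.Int dom_borel borel_closed closed_Collect_le continuous_intros)
    show "AE x in lborel. (\<integral>\<^sup>+y. ennreal (\<bar>u x - u y\<bar>\<^sup>2 / \<eta> x ^ (DIM('a) + 2)) \<partial>lebesgue_on (\<Omega> \<inter> {y. norm (y - x) \<le> R * \<eta> x})) * indicator \<Omega> x
      = (\<integral>\<^sup>+y. ennreal (akernel \<Omega> \<eta> (indicator {..R}) x y * (u' x - u' y)\<^sup>2) \<partial>lborel)"
      using ae
    proof eventually_elim
      case (elim x)
      show ?case
      proof (cases "x \<in> \<Omega>")
        case False
        then show ?thesis by (simp add: akernel_def)
      next
        case True
        have "(\<integral>\<^sup>+y. ennreal (\<bar>u x - u y\<bar>\<^sup>2 / \<eta> x ^ (DIM('a) + 2)) \<partial>lebesgue_on (\<Omega> \<inter> {y. norm (y - x) \<le> R * \<eta> x}))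
          = (\<integral>\<^sup>+y. ennreal (akernel \<Omega> \<eta> (indicator {..R}) x y * (u' x - u' y)\<^sup>2) \<partial>lborel)"
          unfolding nn_integral_lebesgue_on[OF S]
        proof (rule nn_integral_cong_AE)
          show "AE y in lborel. ennreal (\<bar>u x - u y\<bar>\<^sup>2 / \<eta> x ^ (DIM('a) + 2)) * indicator (\<Omega> \<inter> {y. norm (y - x) \<le> R * \<eta> x}) y
            = ennreal (akernel \<Omega> \<eta> (indicator {..R}) x y * (u' x - u' y)\<^sup>2)"
            using ae
          proof eventually_elim
            case (elim y)
            have "norm (y - x) / \<eta> x \<le> R \<longleftrightarrow> norm (y - x) \<le> R * \<eta> x"
              using eta_pos[OF True] by (simp add: pos_divide_le_eq)
            then show ?case using True elim \<open>x \<in> \<Omega> \<longrightarrow> u x = u' x\<close>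
              by (auto simp: akernel_def indicator_def)
          qed
        qed
        then show ?thesis using True by simp
      qed
    qed
  qed
  ultimately show ?thesis by (simp add: W_norm2_def)
qed

text \<open>\<open>max 0\<close> extends \<open>\<rho>\<close> from the half-line, where alone it is
  controlled, to all reals; the arguments that occur are nonnegative, so nothing changes.\<close>

lemma loc_kernel_akernel:
  assumes "x \<in> \<Omega>" "y \<in> \<Omega>"
  shows "loc_kernel \<rho> \<eta> 2 x y =
    (akernel \<Omega> \<eta> (\<lambda>t. \<rho> (max 0 t)) x y + akernel \<Omega> \<eta> (\<lambda>t. \<rho> (max 0 t)) y x) / 2"
proof -
  have p: "\<eta> z powr (real DIM('a) + 2) = \<eta> z ^ (DIM('a) + 2)" if "z \<in> \<Omega>" for z
    using powr_realpow[OF eta_pos[OF that], of "DIM('a) + 2"] by (simp only: of_nat_add of_nat_numeral)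
  have "0 \<le> norm (y - x) / \<eta> x" "0 \<le> norm (y - x) / \<eta> y"
    using eta_pos assms by (auto intro!: divide_nonneg_pos)
  then show ?thesis using assms
    by (simp add: loc_kernel_def akernel_def p norm_minus_commute max_absorb2 add_divide_distrib)
qed

text \<open>The exceptional null sets are removed in two layers, first for the outer point and then,
  with that point fixed, for the inner one. Integrability on the product then turns the iterated
  integral into \<open>bilin\<close>.\<close>

lemma B_form_rep:
  assumes [measurable]: "(\<lambda>t. \<rho> (max 0 t)) \<in> borel_measurable borel"
    and u: "rep \<Omega> u u'" and v: "rep \<Omega> v v'"
    and int: "integrable (lborel \<Otimes>\<^sub>M lborel) (\<lambda>p. (akernel \<Omega> \<eta> (\<lambda>t. \<rho> (max 0 t)) (fst p) (snd p) + akernel \<Omega> \<eta> (\<lambda>t. \<rho> (max 0 t)) (snd p) (fst p)) / 2 *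
       (u' (fst p) - u' (snd p)) * (v' (fst p) - v' (snd p)))"
  shows "B_form \<Omega> \<rho> \<eta> u v = bilin \<Omega> \<eta> (\<lambda>t. \<rho> (max 0 t)) u' v'"
proof -
  let ?A = "akernel \<Omega> \<eta> (\<lambda>t. \<rho> (max 0 t))"
  define g where "g = (\<lambda>x y. (?A x y + ?A y x) / 2 * (u' x - u' y) * (v' x - v' y))"
  have [measurable]: "u' \<in> borel_measurable borel" "v' \<in> borel_measurable borel"
    using u v by (auto simp: rep_measurable)
  have gm [measurable]: "(\<lambda>p. g (f1 p) (f2 p)) \<in> borel_measurable M"
    if [measurable]: "f1 \<in> M \<rightarrow>\<^sub>M borel" "f2 \<in> M \<rightarrow>\<^sub>M borel" for f1 f2 and M :: "'b measure"
    unfolding g_def by measurable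
  have "B_form \<Omega> \<rho> \<eta> u v = (\<integral>x. indicator \<Omega> x * (\<integral>y. indicator \<Omega> y * (loc_kernel \<rho> \<eta> 2 x y * (u x - u y) * (v x - v y)) \<partial>lebesgue) \<partial>lebesgue)"
    unfolding B_form_def integral_lebesgue_on[OF dom_borel] by (simp only:)
  also have "\<dots> = (\<integral>x. (\<integral>y. g x y \<partial>lborel) \<partial>lborel)"
  proof (rule lebesgue_integral_cong_AE')
    show "(\<lambda>x. \<integral>y. g x y \<partial>lborel) \<in> borel_measurable borel" by measurable
    show "AE x in lborel. (\<integral>y. g x y \<partial>lborel) = indicator \<Omega> x * (\<integral>y. indicator \<Omega> y * (loc_kernel \<rho> \<eta> 2 x y * (u x - u y) * (v x - v y)) \<partial>lebesgue)"
      using rep_AE[OF u] rep_AE[OF v]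
    proof eventually_elim
      case (elim x)
      show ?case
      proof (cases "x \<in> \<Omega>")
        case False
        then show ?thesis by (simp add: g_def akernel_def)
      next
        case True
        have "(\<integral>y. indicator \<Omega> y * (loc_kernel \<rho> \<eta> 2 x y * (u x - u y) * (v x - v y)) \<partial>lebesgue) = (\<integral>y. g x y \<partial>lborel)"
        proof (rule lebesgue_integral_cong_AE')
          show "g x \<in> borel_measurable borel" by measurable
          show "AE y in lborel. g x y = indicator \<Omega> y * (loc_kernel \<rho> \<eta> 2 x y * (u x - u y) * (v x - v y))"
            using rep_AE[OF u] rep_AE[OF v]
          proof eventually_elim
            case (elim y)
            then show ?case using True \<open>x \<in> \<Omega> \<longrightarrow> u x = u' x\<close> \<open>x \<in> \<Omega> \<longrightarrow> v x = v' x\<close>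
              by (cases "y \<in> \<Omega>") (auto simp: g_def loc_kernel_akernel, simp add: akernel_def)
          qed
        qed
        then show ?thesis using True by simp
      qed
    qed
  qed
  also have "\<dots> = bilin \<Omega> \<eta> (\<lambda>t. \<rho> (max 0 t)) u' v'"
    unfolding bilin_def using lborel_pair.integral_fst[of g] int by (simp add: g_def case_prod_unfold)
  finally show ?thesis .
qed

end

section \<open>Test functions, localization functions and admissible kernels\<close>

lemma Ck_on_combine:
  assumes "Ck_on k f UNIV" "Ck_on k g UNIV"
  shows "Ck_on k (\<lambda>x. a * f x + b * g x) UNIV"
  using assms
proof (induction k arbitrary: f g)
  case 0
  then show ?case by (auto intro!: continuous_intros)
next
  case (Suc k)
  have d: "f differentiable at x" "g differentiable at x" for x using Suc.prems by auto
  have p: "partial_deriv c (\<lambda>x. a * f x + b * g x) = (\<lambda>x. a * partial_deriv c f x + b * partial_deriv c g x)" for c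
  proof
    fix x
    have "((\<lambda>x. a * f x + b * g x) has_derivative
        (\<lambda>h. a * frechet_derivative f (at x) h + b * frechet_derivative g (at x) h)) (at x)"
      using d[of x] by (auto intro!: derivative_eq_intros simp: frechet_derivative_works)
    from frechet_derivative_at[OF this, symmetric] show "partial_deriv c (\<lambda>x. a * f x + b * g x) x = a * partial_deriv c f x + b * partial_deriv c g x"
      by (simp add: partial_deriv_def)
  qed
  have "(\<lambda>x. a * f x + b * g x) differentiable at x" for x
    using d[of x] by simp
  moreover have "Ck_on k (partial_deriv c (\<lambda>x. a * f x + b * g x)) UNIV" if "c \<in> Basis" for c
    unfolding p using Suc.prems that by (intro Suc.IH) auto
  ultimately show ?case by simp
qed

lemma test_function_combine:
  assumes "test_function \<Omega> f" "test_function \<Omega> g"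
  shows "test_function \<Omega> (\<lambda>x. a * f x + b * g x)"
proof -
  let ?h = "\<lambda>x. a * f x + b * g x"
  have s: "closure {x. ?h x \<noteq> 0} \<subseteq> closure {x. f x \<noteq> 0} \<union> closure {x. g x \<noteq> 0}"
    unfolding closure_Un[symmetric] by (rule closure_mono) auto
  have "compact (closure {x. f x \<noteq> 0} \<union> closure {x. g x \<noteq> 0})"
    using assms by (auto simp: test_function_def intro: compact_Un)
  from compact_Int_closed[OF this closed_closure[of "{x. ?h x \<noteq> 0}"]]
  have "compact (closure {x. ?h x \<noteq> 0})" unfolding Int_absorb1[OF s] .
  moreover have "closure {x. ?h x \<noteq> 0} \<subseteq> \<Omega>"
    using s assms unfolding test_function_def by blast
  moreover have "Ck_on k ?h UNIV" for k
    using assms unfolding test_function_def by (intro Ck_on_combine) auto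
  ultimately show ?thesis unfolding test_function_def by blast
qed

lemma test_function_zero:
  fixes \<Omega> :: "'a::euclidean_space set"
  shows "test_function \<Omega> (\<lambda>x. 0)"
proof -
  have "Ck_on k (\<lambda>x::'a. 0) UNIV" for k
  proof (induction k)
    case (Suc k)
    have "partial_deriv b (\<lambda>x::'a. 0) = (\<lambda>x. 0)" for b
      by (rule ext) (simp add: partial_deriv_def)
    then show ?case using Suc by simp
  qed simp
  then show ?thesis by (simp add: test_function_def)
qed

lemma test_function_cont: "test_function \<Omega> f \<Longrightarrow> continuous_on UNIV f"
  unfolding test_function_def by (elim conjE, drule spec[of _ 0]) simp

section \<open>From bounds on derivatives to the localization axioms\<close>

lemma gradient_inner: "gradient f x \<bullet> h = (\<Sum>b\<in>Basis. partial_deriv b f x * (h \<bullet> b))"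
  by (simp add: gradient_def inner_sum_left inner_commute[of h])

lemma has_derivative_gradient:
  assumes "f differentiable (at x)"
  shows "(f has_derivative (\<lambda>h. gradient f x \<bullet> h)) (at x)"
proof -
  have d: "(f has_derivative frechet_derivative f (at x)) (at x)"
    using assms by (simp add: frechet_derivative_works)
  then interpret l: bounded_linear "frechet_derivative f (at x)" by (rule has_derivative_bounded_linear)
  have "frechet_derivative f (at x) h = gradient f x \<bullet> h" for h
  proof -
    have "frechet_derivative f (at x) h = frechet_derivative f (at x) (\<Sum>b\<in>Basis. (h \<bullet> b) *\<^sub>R b)"
      by (simp add: euclidean_representation)
    also have "\<dots> = (\<Sum>b\<in>Basis. (h \<bullet> b) * partial_deriv b f x)"
      by (simp add: l.sum l.scaleR partial_deriv_def)
    also have "\<dots> = gradient f x \<bullet> h"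
      by (simp add: gradient_inner mult.commute)
    finally show ?thesis .
  qed
  then have "frechet_derivative f (at x) = (\<lambda>h. gradient f x \<bullet> h)" by (rule ext)
  with d show ?thesis by simp
qed

text \<open>Cauchy-Schwarz over pairs of basis vectors: the Frobenius norm is the Euclidean norm of
  the matrix entries, and the squares of the products of coordinates sum to \<open>norm h\<close> to
  the fourth power.\<close>

lemma hessian_bound:
  "\<bar>\<Sum>b\<in>Basis. \<Sum>c\<in>Basis. partial_deriv c (partial_deriv b f) x * (h \<bullet> c) * (h \<bullet> b)\<bar> \<le> hessian_norm f x * (norm h)\<^sup>2"
proof -
  let ?I = "Basis \<times> Basis"
  let ?a = "\<lambda>p. partial_deriv (snd p) (partial_deriv (fst p) f) x"
  let ?h = "\<lambda>p. (h \<bullet> snd p) * (h \<bullet> fst p)"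
  have "(\<Sum>p\<in>?I. ?a p * ?h p)\<^sup>2 \<le> (\<Sum>p\<in>?I. (?a p)\<^sup>2) * (\<Sum>p\<in>?I. (?h p)\<^sup>2)"
    by (rule Cauchy_Schwarz_ineq_sum)
  also have "(\<Sum>p\<in>?I. (?a p)\<^sup>2) = (hessian_norm f x)\<^sup>2"
  proof -
    have "hessian_norm f x = sqrt (\<Sum>p\<in>?I. (?a p)\<^sup>2)"
      by (simp add: hessian_norm_def sum.cartesian_product case_prod_unfold)
    then show ?thesis by (simp add: sum_nonneg)
  qed
  also have "(\<Sum>p\<in>?I. (?h p)\<^sup>2) = ((norm h)\<^sup>2)\<^sup>2"
  proof -
    have n: "(\<Sum>b\<in>Basis. (h \<bullet> b)\<^sup>2) = (norm h)\<^sup>2"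
      unfolding power2_norm_eq_inner by (subst euclidean_inner) (simp add: power2_eq_square)
    have "(\<Sum>p\<in>?I. (?h p)\<^sup>2) = (\<Sum>b\<in>Basis. \<Sum>c\<in>Basis. (h \<bullet> b)\<^sup>2 * (h \<bullet> c)\<^sup>2)"
      by (simp add: sum.cartesian_product case_prod_unfold power_mult_distrib mult.commute)
    also have "\<dots> = ((norm h)\<^sup>2)\<^sup>2" by (simp add: sum_product[symmetric] n power2_eq_square[of "(norm h)\<^sup>2"])
    finally show ?thesis .
  qed
  finally have "(\<Sum>p\<in>?I. ?a p * ?h p)\<^sup>2 \<le> (hessian_norm f x * (norm h)\<^sup>2)\<^sup>2" by (simp add: power_mult_distrib)
  moreover have "0 \<le> hessian_norm f x * (norm h)\<^sup>2" by (simp add: hessian_norm_def sum_nonneg)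
  ultimately have "\<bar>\<Sum>p\<in>?I. ?a p * ?h p\<bar> \<le> hessian_norm f x * (norm h)\<^sup>2" by (simp only: abs_le_square_iff[symmetric] abs_of_nonneg)
  then show ?thesis by (simp add: sum.cartesian_product case_prod_unfold mult.assoc)
qed

text \<open>The entries of \<open>delta0\<close> have separate tasks. The one with 9 makes the
  gradient at most 1/3. The one with 2 gives \<open>\<kappa>bar * sqrt \<delta> < 1\<close>, hence
  \<eta> is smaller than the distance to the boundary and the ball of radius \<open>\<eta> x\<close>
  lies in \<Omega>.\<close>

lemma localization_of_functions:
  fixes \<Omega> :: "'a::euclidean_space set"
  assumes dom: "bounded_C2_domain \<Omega>" and loc: "localization_functions \<Omega> \<kappa>0 \<kappa>1 \<kappa>2 \<kappa>bar \<eta>"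
    and k: "0 < \<kappa>1" "0 < \<kappa>2" "0 < \<kappa>bar" and \<delta>: "0 < \<delta>" "\<delta> < delta0 \<kappa>1 \<kappa>bar"
  shows "localization \<Omega> (\<eta> \<delta>) (gradient (\<eta> \<delta>)) \<kappa>2"
proof -
  define e where "e = \<eta> \<delta>"
  have op: "open \<Omega>" and bd: "bounded \<Omega>" using dom by (auto simp: bounded_C2_domain_def)
  have L: "(\<forall>x\<in>\<Omega>. 0 < e x)" "C2_closure \<Omega> e" "(\<forall>x\<in>\<Omega>. norm (gradient e x) \<le> \<kappa>1 * sqrt \<delta>)"
    "(\<forall>x\<in>\<Omega>. hessian_norm e x \<le> \<kappa>2)" "(\<forall>x\<in>\<Omega>. e x \<le> \<kappa>bar * min \<delta> ((bdist \<Omega> x)\<^sup>2))"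
    using loc[unfolded localization_functions_def, THEN spec[of _ \<delta>], THEN mp, OF conjI[OF \<delta>]]
    unfolding e_def by - (elim conjE, assumption)+
  have d1: "\<delta> < 1 / (9 * \<kappa>1\<^sup>2)" and d2: "\<delta> < 1 / (2 * \<kappa>bar\<^sup>2)" using \<delta>(2) by (auto simp: delta0_def)
  have g3: "\<kappa>1 * sqrt \<delta> \<le> 1/3"
  proof (rule power2_le_imp_le)
    show "(\<kappa>1 * sqrt \<delta>)\<^sup>2 \<le> (1/3)\<^sup>2"
      using d1 k(1) \<delta>(1) by (simp add: power_mult_distrib power2_eq_square field_simps)
  qed simp
  have kb: "\<kappa>bar * sqrt \<delta> < 1"
  proof (rule power2_less_imp_less)
    show "(\<kappa>bar * sqrt \<delta>)\<^sup>2 < 1\<^sup>2"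
      using d2 k(3) \<delta>(1) by (simp add: power_mult_distrib power2_eq_square field_simps)
  qed simp
  have pos: "0 < e x" if "x \<in> \<Omega>" for x using L(1) that by blast
  have ed: "e x < bdist \<Omega> x" if x: "x \<in> \<Omega>" for x
  proof -
    define d where "d = bdist \<Omega> x"
    have le: "e x \<le> \<kappa>bar * min \<delta> (d\<^sup>2)" using L(5) x by (simp add: d_def)
    have d0: "0 \<le> d" by (simp add: d_def bdist_def infdist_nonneg)
    have "d \<noteq> 0" using le pos[OF x] \<delta>(1) by auto
    then have dp: "0 < d" using d0 by simp
    \<comment> \<open>The minimum of two nonnegative numbers is at most their geometric
      mean.\<close>
    have "min \<delta> (d\<^sup>2) \<le> sqrt \<delta> * d"
    proof (cases "sqrt \<delta> \<le> d")
      case True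
      then have "sqrt \<delta> * sqrt \<delta> \<le> sqrt \<delta> * d" using \<delta>(1) by (intro mult_left_mono) auto
      then show ?thesis using \<delta>(1) by simp
    next
      case False
      then have "d * d \<le> sqrt \<delta> * d" using d0 by (intro mult_right_mono) auto
      then show ?thesis by (simp add: power2_eq_square min_le_iff_disj)
    qed
    then have "e x \<le> \<kappa>bar * sqrt \<delta> * d" using le k(3) by (metis mult.assoc mult_left_mono less_imp_le order_trans)
    also have "\<dots> < 1 * d" using kb dp by (intro mult_strict_right_mono)
    finally show ?thesis by (simp add: d_def)
  qed
  have ball: "x + h \<in> \<Omega>" if x: "x \<in> \<Omega>" and h: "norm h < e x" for x h
  proof (rule ccontr)
    assume "x + h \<notin> \<Omega>"
    \<comment> \<open>A segment that leaves \<Omega> meets the boundary, at a point no farther from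
      \<open>x\<close> than \<open>norm h\<close>.\<close>
    then have "closed_segment x (x + h) \<inter> frontier \<Omega> \<noteq> {}"
      using x by (intro connected_Int_frontier) auto
    then obtain z where z: "z \<in> closed_segment x (x + h)" "z \<in> frontier \<Omega>" by blast
    have "bdist \<Omega> x \<le> dist x z" unfolding bdist_def by (rule infdist_le[OF z(2)])
    also have "\<dots> \<le> norm h" using dist_in_closed_segment(1)[of z x "x + h"] z(1) by (simp add: dist_norm norm_minus_commute)
    finally show False using h ed[OF x] by simp
  qed
  have C2: "e differentiable (at x)" "b \<in> Basis \<Longrightarrow> partial_deriv b e differentiable (at x)" if "x \<in> \<Omega>" for x b
    using L(2) that by (auto simp: C2_closure_def numeral_2_eq_2)
  have der: "(e has_derivative (\<lambda>h. gradient e x \<bullet> h)) (at x)" if "x \<in> \<Omega>" for x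
    by (rule has_derivative_gradient[OF C2(1)[OF that]])
  have seg: "x + t *\<^sub>R h \<in> \<Omega>" if "x \<in> \<Omega>" "norm h < e x" "0 \<le> t" "t \<le> 1" for x h and t :: real
  proof (rule ball[OF that(1)])
    have "norm (t *\<^sub>R h) \<le> norm h" using that(3,4) by (simp add: mult_left_le_one_le)
    then show "norm (t *\<^sub>R h) < e x" using that(2) by simp
  qed
  have line: "((\<lambda>t. f (x + t *\<^sub>R h)) has_real_derivative (gradient f (x + t *\<^sub>R h) \<bullet> h)) (at t)"
    if "f differentiable (at (x + t *\<^sub>R h))" for f :: "'a \<Rightarrow> real" and x h t
  proof -
    have "((\<lambda>t. x + t *\<^sub>R h) has_derivative (\<lambda>s. s *\<^sub>R h)) (at t)"
      by (auto intro!: derivative_eq_intros)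
    then have "((\<lambda>t. f (x + t *\<^sub>R h)) has_derivative (\<lambda>s. gradient f (x + t *\<^sub>R h) \<bullet> (s *\<^sub>R h))) (at t)"
      using has_derivative_gradient[OF that] by (rule has_derivative_compose)
    then show ?thesis by (rule has_derivative_imp_has_field_derivative) simp
  qed
  have lip: "\<bar>e (x + h) - e x\<bar> \<le> norm h / 3" if x: "x \<in> \<Omega>" and h: "norm h < e x" for x h
  proof -
    have "\<exists>z>0. z < 1 \<and> e (x + 1 *\<^sub>R h) - e (x + 0 *\<^sub>R h) = (1 - 0) * (gradient e (x + z *\<^sub>R h) \<bullet> h)"
      by (rule MVT2) (auto intro!: line C2(1) seg x h)
    then obtain z where z: "0 < z" "z < 1" "e (x + h) - e x = gradient e (x + z *\<^sub>R h) \<bullet> h" by auto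
    have "norm (gradient e (x + z *\<^sub>R h)) \<le> 1/3" using L(3) seg[OF x h, of z] z g3 by fastforce
    then have "\<bar>gradient e (x + z *\<^sub>R h) \<bullet> h\<bar> \<le> 1/3 * norm h"
      using Cauchy_Schwarz_ineq2[of "gradient e (x + z *\<^sub>R h)" h] by (meson mult_right_mono norm_ge_zero order_trans)
    then show ?thesis using z(3) by simp
  qed
  have second: "\<bar>e (x + h) - gradient e (x + h) \<bullet> h - e x\<bar> \<le> \<kappa>2 * (norm h)\<^sup>2" if x: "x \<in> \<Omega>" and h: "norm h < e x" for x h
  proof -
    define Q where "Q = (\<lambda>t. \<Sum>b\<in>Basis. \<Sum>c\<in>Basis. partial_deriv c (partial_deriv b e) (x + t *\<^sub>R h) * (h \<bullet> c) * (h \<bullet> b))"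
    have dG: "((\<lambda>t. gradient e (x + t *\<^sub>R h) \<bullet> h) has_real_derivative Q t) (at t)" if "0 \<le> t" "t \<le> 1" for t
    proof -
      have "((\<lambda>t. \<Sum>b\<in>Basis. partial_deriv b e (x + t *\<^sub>R h) * (h \<bullet> b)) has_real_derivative
          (\<Sum>b\<in>Basis. (gradient (partial_deriv b e) (x + t *\<^sub>R h) \<bullet> h) * (h \<bullet> b))) (at t)"
        by (intro DERIV_sum DERIV_cmult_right line C2(2) seg x h that)
      moreover have "(\<Sum>b\<in>Basis. (gradient (partial_deriv b e) (x + t *\<^sub>R h) \<bullet> h) * (h \<bullet> b)) = Q t"
        unfolding Q_def by (intro sum.cong refl) (simp add: gradient_inner sum_distrib_right)
      moreover have "(\<lambda>t. \<Sum>b\<in>Basis. partial_deriv b e (x + t *\<^sub>R h) * (h \<bullet> b)) = (\<lambda>t. gradient e (x + t *\<^sub>R h) \<bullet> h)"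
        by (rule ext) (simp add: gradient_inner)
      ultimately show ?thesis by simp
    qed
    \<comment> \<open>Mean value theorem for \<eta> minus \<open>t\<close> times its derivative
      along the segment: the first order terms cancel in the derivative and \<open>- t * Q t\<close>
      remains.\<close>
    have "\<exists>z>0. z < 1 \<and> (e (x + 1 *\<^sub>R h) - 1 * (gradient e (x + 1 *\<^sub>R h) \<bullet> h)) - (e (x + 0 *\<^sub>R h) - 0 * (gradient e (x + 0 *\<^sub>R h) \<bullet> h))
      = (1 - 0) * (- z * Q z)"
    proof (rule MVT2)
      show "((\<lambda>t. e (x + t *\<^sub>R h) - t * (gradient e (x + t *\<^sub>R h) \<bullet> h)) has_real_derivative - t * Q t) (at t)" if "0 \<le> t" "t \<le> 1" for t
        by (rule derivative_eq_intros line[OF C2(1)[OF seg[OF x h that]]] dG[OF that] refl)+ simp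
    qed simp
    then obtain z where z: "0 < z" "z < 1" "e (x + h) - gradient e (x + h) \<bullet> h - e x = - z * Q z" by auto
    have "\<bar>Q z\<bar> \<le> hessian_norm e (x + z *\<^sub>R h) * (norm h)\<^sup>2" unfolding Q_def by (rule hessian_bound)
    also have "\<dots> \<le> \<kappa>2 * (norm h)\<^sup>2" using L(4) seg[OF x h, of z] z by (intro mult_right_mono) auto
    finally have "\<bar>Q z\<bar> \<le> \<kappa>2 * (norm h)\<^sup>2" .
    moreover have "\<bar>- z * Q z\<bar> \<le> \<bar>Q z\<bar>" using z by (simp add: abs_mult mult_left_le_one_le)
    ultimately show ?thesis using z(3) by simp
  qed
  show ?thesis
    unfolding e_def[symmetric]
    by (unfold_locales) (use op bd k pos ball lip der second in auto)
qed

text \<open>The kernel is enclosed between multiples of two interval indicators, both with horizon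
  below 1, which makes its energy accessible to \<open>energy_radius\<close>.\<close>

lemma admissible_kernel_bounds:
  assumes "admissible_kernel \<rho>"
  obtains \<rho>0 r0 R0 M where "0 < \<rho>0" "0 < r0" "r0 < 1" "0 < R0" "R0 < 1" "0 \<le> M"
    "(\<lambda>t. \<rho> (max 0 t)) \<in> borel_measurable borel" "\<And>t. 0 \<le> \<rho> (max 0 t)"
    "\<And>t. 0 \<le> t \<Longrightarrow> \<rho> (max 0 t) \<le> M * indicator {..R0} t"
    "\<And>t. 0 \<le> t \<Longrightarrow> \<rho>0 * indicator {..r0} t \<le> \<rho> (max 0 t)"
proof -
  from assms obtain \<rho>0 r0 R0 \<rho>' where h: "0 < \<rho>0" "0 < r0" "r0 < R0" "R0 < 1"
    "\<forall>r\<ge>0. (\<rho> has_real_derivative \<rho>' r) (at r within {0..})" "\<forall>r\<ge>0. 0 \<le> \<rho> r"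
    "closure {r. 0 \<le> r \<and> \<rho> r \<noteq> 0} \<subseteq> {0..<R0}" "\<forall>r\<in>{0..r0}. \<rho>0 \<le> \<rho> r"
    unfolding admissible_kernel_def by (elim exE conjE) (rule that; assumption)
  have c: "continuous_on {0..} \<rho>"
    using h(5) by (auto intro!: DERIV_continuous_on[of _ _ \<rho>'])
  have "continuous_on {0..R0} \<rho>" using c by (rule continuous_on_subset) auto
  then have "bounded (\<rho> ` {0..R0})" by (intro compact_imp_bounded compact_continuous_image) auto
  then obtain M where "\<forall>y\<in>\<rho> ` {0..R0}. norm y \<le> M" unfolding bounded_iff by blast
  then have M: "\<bar>\<rho> r\<bar> \<le> M" if "r \<in> {0..R0}" for r using that by simp
  have z: "\<rho> r = 0" if "R0 < r" for r
  proof (rule ccontr)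
    assume "\<rho> r \<noteq> 0"
    then have "r \<in> closure {r. 0 \<le> r \<and> \<rho> r \<noteq> 0}" using that h(2,3) by (intro closure_subset[THEN subsetD]) auto
    then show False using h(7) that by auto
  qed
  show ?thesis
  proof (rule that[of \<rho>0 r0 R0 M])
    have "continuous_on UNIV (\<lambda>t. \<rho> (max 0 t))"
      by (rule continuous_on_compose2[OF c]) (auto intro!: continuous_intros)
    then show "(\<lambda>t. \<rho> (max 0 t)) \<in> borel_measurable borel" by (rule borel_measurable_continuous_onI)
    show "0 \<le> M" using M[of 0] h(2,3) by auto
    show "\<rho> (max 0 t) \<le> M * indicator {..R0} t" if "0 \<le> t" for t
      using M[of t] z[of t] that by (auto simp: indicator_def max_absorb2)
    show "\<rho>0 * indicator {..r0} t \<le> \<rho> (max 0 t)" if "0 \<le> t" for t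
      using h(2,6,8) that by (auto simp: indicator_def max_absorb2)
  qed (use h in auto)
qed

lemma energy_radius_constant:
  assumes "0 < R" "0 < R'" "R' < 1"
  shows "\<exists>C\<ge>0. \<forall>(\<Omega> :: 'a::euclidean_space set) \<eta> G \<kappa> u. localization \<Omega> \<eta> G \<kappa> \<longrightarrow> u \<in> borel_measurable borel \<longrightarrow>
    energy \<Omega> \<eta> (indicator {..R'}) u \<le> ennreal C * energy \<Omega> \<eta> (indicator {..R}) u"
proof -
  obtain N where N: "3 * R' / (2 * R) < real N" using reals_Archimedean2 by blast
  then have "0 < N" using assms by (intro gr0I) (auto simp: field_simps)
  moreover have "3 * R' \<le> 2 * real N * R" using N assms by (simp add: field_simps)
  ultimately show ?thesis
    using localization.energy_radius[OF _ _ assms(1,2,3)]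
    by (intro exI[of _ "real N ^ (DIM('a) + 2) * (4/3) ^ (DIM('a) + 2)"]) auto
qed

section \<open>Energy inequalities and density of test functions\<close>

context localization
begin

lemma energy_mono:
  assumes [measurable]: "\<psi>' \<in> borel_measurable borel" "u \<in> borel_measurable borel"
    and c: "0 \<le> c" and le: "\<And>t. 0 \<le> t \<Longrightarrow> \<psi> t \<le> c * \<psi>' t"
  shows "energy \<Omega> \<eta> \<psi> u \<le> ennreal c * energy \<Omega> \<eta> \<psi>' u"
proof -
  have k: "akernel \<Omega> \<eta> \<psi> x y \<le> c * akernel \<Omega> \<eta> \<psi>' x y" for x y
    using eta_pos[of x] le[of "norm (y - x) / \<eta> x"]
    by (auto simp: akernel_def indicator_def divide_right_mono)
  have "energy \<Omega> \<eta> \<psi> u \<le> (\<integral>\<^sup>+x. \<integral>\<^sup>+y. ennreal c * ennreal (akernel \<Omega> \<eta> \<psi>' x y * (u x - u y)\<^sup>2) \<partial>lborel \<partial>lborel)"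
    unfolding energy_def
    using c mult_right_mono[OF k] by (intro nn_integral_mono) (auto simp: ennreal_mult'[symmetric] mult.assoc intro!: ennreal_leI)
  also have "\<dots> = ennreal c * energy \<Omega> \<eta> \<psi>' u"
    unfolding energy_def by (simp add: nn_integral_cmult)
  finally show ?thesis .
qed

lemma energy_combine_le:
  assumes [measurable]: "\<psi> \<in> borel_measurable borel" "u \<in> borel_measurable borel" "v \<in> borel_measurable borel"
    and nn: "\<And>t. 0 \<le> t \<Longrightarrow> 0 \<le> \<psi> t"
  shows "energy \<Omega> \<eta> \<psi> (\<lambda>x. a * u x + b * v x) \<le> ennreal (2 * a\<^sup>2) * energy \<Omega> \<eta> \<psi> u + ennreal (2 * b\<^sup>2) * energy \<Omega> \<eta> \<psi> v"
proof -
  have p: "ennreal (akernel \<Omega> \<eta> \<psi> x y * ((a * u x + b * v x) - (a * u y + b * v y))\<^sup>2) \<le>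
    ennreal (2 * a\<^sup>2) * ennreal (akernel \<Omega> \<eta> \<psi> x y * (u x - u y)\<^sup>2) +
    ennreal (2 * b\<^sup>2) * ennreal (akernel \<Omega> \<eta> \<psi> x y * (v x - v y)\<^sup>2)" for x y
  proof -
    have k: "0 \<le> akernel \<Omega> \<eta> \<psi> x y" by (rule akernel_nonneg[OF nn])
    have "((a * u x + b * v x) - (a * u y + b * v y))\<^sup>2 \<le> 2 * a\<^sup>2 * (u x - u y)\<^sup>2 + 2 * b\<^sup>2 * (v x - v y)\<^sup>2"
      using sum_squares_bound[of "a * (u x - u y)" "b * (v x - v y)"]
      by (simp add: power2_eq_square algebra_simps)
    from mult_left_mono[OF this k] show ?thesis
      using k by (simp add: ennreal_leI algebra_simps flip: ennreal_mult' ennreal_plus)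
  qed
  show ?thesis unfolding energy_def
    by (rule order_trans[OF nn_integral_mono[OF nn_integral_mono[OF p]]])
      (simp add: nn_integral_add nn_integral_cmult)
qed

lemma W_norm2_combine_le:
  assumes "rep \<Omega> u u'" "rep \<Omega> v v'"
  shows "W_norm2 \<Omega> R \<eta> (\<lambda>x. a * u x + b * v x) \<le> ennreal (2 * a\<^sup>2) * W_norm2 \<Omega> R \<eta> u + ennreal (2 * b\<^sup>2) * W_norm2 \<Omega> R \<eta> v"
proof -
  note m = rep_measurable[OF assms(1)] rep_measurable[OF assms(2)]
  have i: "indicator {..R} \<in> borel_measurable borel" "0 \<le> t \<Longrightarrow> 0 \<le> (indicator {..R} t :: real)" for t :: real
    by auto
  show ?thesis
    unfolding W_norm2_rep[OF rep_combine[OF assms]] W_norm2_rep[OF assms(1)] W_norm2_rep[OF assms(2)]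
    using add_mono[OF ssq_combine_le[OF m, of a b] energy_combine_le[OF i(1) m i(2), of a b]]
    by (simp add: algebra_simps)
qed

lemma test_function_rep:
  assumes "test_function \<Omega> \<phi>"
  shows "rep \<Omega> \<phi> \<phi>"
  unfolding rep_def
proof (intro conjI allI impI)
  show "\<phi> \<in> borel_measurable borel" by (rule borel_measurable_continuous_onI[OF test_function_cont[OF assms]])
  show "\<phi> x = 0" if "x \<notin> \<Omega>" for x
    using assms that closure_subset[of "{x. \<phi> x \<noteq> 0}"] by (auto simp: test_function_def)
qed simp

text \<open>The continuous positive function \<eta> attains a positive minimum on the compact
  support. The resulting \<open>m\<close> depends on \<open>\<phi>\<close>, which
  \<open>poincare_constant\<close> tolerates.\<close>

lemma test_function_support:
  assumes "test_function \<Omega> \<phi>"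
  shows "\<exists>m U. 0 < m \<and> (\<forall>x. \<phi> x \<noteq> 0 \<longrightarrow> x \<in> \<Omega> \<and> m \<le> \<eta> x) \<and> (\<forall>x. \<bar>\<phi> x\<bar> \<le> U)"
proof -
  define K where "K = closure {x. \<phi> x \<noteq> 0}"
  have K: "compact K" "K \<subseteq> \<Omega>" and s: "\<And>x. \<phi> x \<noteq> 0 \<Longrightarrow> x \<in> K"
    using assms closure_subset[of "{x. \<phi> x \<noteq> 0}"] by (auto simp: test_function_def K_def)
  have "bounded (\<phi> ` K)"
    using K(1) continuous_on_subset[OF test_function_cont[OF assms]]
    by (intro compact_imp_bounded compact_continuous_image) auto
  then obtain U where "\<forall>y\<in>\<phi> ` K. norm y \<le> U" unfolding bounded_iff by blast
  then have U: "\<bar>\<phi> x\<bar> \<le> U" if "x \<in> K" for x using that by simp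
  have U': "\<bar>\<phi> x\<bar> \<le> max U 0" for x using U[OF s, of x] by (cases "\<phi> x = 0") auto
  show ?thesis
  proof (cases "K = {}")
    case True
    then have "\<phi> x = 0" for x using s by auto
    then show ?thesis by (intro exI[of _ 1]) auto
  next
    case False
    then obtain x0 where x0: "x0 \<in> K" "\<And>y. y \<in> K \<Longrightarrow> \<eta> x0 \<le> \<eta> y"
      using continuous_attains_inf[OF K(1) False continuous_on_subset[OF eta_cont K(2)]] by blast
    then have "0 < \<eta> x0" using K(2) eta_pos by blast
    then show ?thesis using x0 s K(2) U' by (intro exI[of _ "\<eta> x0"] exI[of _ "max U 0"]) blast
  qed
qed

text \<open>The inequality \<open>(a + b)\<^sup>2 \<le> 2 * a\<^sup>2 + 2 * b\<^sup>2\<close> is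
  used twice, from \<open>u'\<close> to \<open>\<phi>\<close> on the left and from
  \<open>\<phi>\<close> back to \<open>u'\<close> on the right; hence the factor 4.\<close>

lemma W0_poincare:
  assumes C: "0 \<le> C" and poin: "\<And>\<phi>. test_function \<Omega> \<phi> \<Longrightarrow> ssq \<phi> \<le> ennreal C * energy \<Omega> \<eta> (indicator {..R}) \<phi>"
    and u: "u \<in> W0_space \<Omega> R \<eta>" and r: "rep \<Omega> u u'"
  shows "ssq u' \<le> ennreal (4 * C) * energy \<Omega> \<eta> (indicator {..R}) u'"
proof (rule ennreal_le_epsilon)
  fix e :: real assume e: "0 < e"
  let ?E = "energy \<Omega> \<eta> (indicator {..R})"
  \<comment> \<open>The approximation errors sum to \<open>2 * \<epsilon>\<^sup>2\<close> on the
    left and \<open>4 * C * \<epsilon>\<^sup>2\<close> on the right.\<close>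
  define \<epsilon> where "\<epsilon> = sqrt (e / (2 + 4 * C))"
  have \<epsilon>: "0 < \<epsilon>" "(2 + 4 * C) * \<epsilon>\<^sup>2 = e" using e C by (auto simp: \<epsilon>_def add_pos_nonneg)
  obtain \<phi> where \<phi>: "test_function \<Omega> \<phi>" "W_norm2 \<Omega> R \<eta> (\<lambda>x. u x - \<phi> x) < ennreal (\<epsilon>\<^sup>2)"
    using u \<epsilon>(1) by (auto simp: W0_space_def)
  note rp = test_function_rep[OF \<phi>(1)]
  note rd = rep_diff[OF r rp]
  have m: "u' \<in> borel_measurable borel" "\<phi> \<in> borel_measurable borel" "(\<lambda>x. u' x - \<phi> x) \<in> borel_measurable borel"
    using rep_measurable[OF r] rep_measurable[OF rp] rep_measurable[OF rd] by auto
  have n: "ssq (\<lambda>x. u' x - \<phi> x) + ?E (\<lambda>x. u' x - \<phi> x) \<le> ennreal (\<epsilon>\<^sup>2)"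
    using \<phi>(2) unfolding W_norm2_rep[OF rd] by simp
  have n1: "ssq (\<lambda>x. u' x - \<phi> x) \<le> ennreal (\<epsilon>\<^sup>2)" and n2: "?E (\<lambda>x. u' x - \<phi> x) \<le> ennreal (\<epsilon>\<^sup>2)"
    using n by (auto intro: order_trans[OF _ n])
  have i: "indicator {..R} \<in> borel_measurable borel" "0 \<le> t \<Longrightarrow> 0 \<le> (indicator {..R} t :: real)" for t :: real
    by auto
  have "ssq u' \<le> ennreal 2 * ssq (\<lambda>x. u' x - \<phi> x) + ennreal 2 * ssq \<phi>"
    using ssq_combine_le[OF m(3,2), of 1 1] by simp
  also have "\<dots> \<le> ennreal 2 * ennreal (\<epsilon>\<^sup>2) + ennreal 2 * (ennreal C * ?E \<phi>)"
    by (intro add_mono mult_left_mono n1 poin \<phi>(1)) auto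
  also have "?E \<phi> \<le> ennreal 2 * ?E u' + ennreal 2 * ?E (\<lambda>x. u' x - \<phi> x)"
    using energy_combine_le[OF i(1) m(1,3) i(2), of 1 "- 1"] by simp
  also have "ennreal 2 * ?E u' + ennreal 2 * ?E (\<lambda>x. u' x - \<phi> x) \<le> ennreal 2 * ?E u' + ennreal 2 * ennreal (\<epsilon>\<^sup>2)"
    by (intro add_mono mult_left_mono n2) auto
  also have "ennreal 2 * ennreal (\<epsilon>\<^sup>2) + ennreal 2 * (ennreal C * (ennreal 2 * ?E u' + ennreal 2 * ennreal (\<epsilon>\<^sup>2)))
     = ennreal (4 * C) * ?E u' + ennreal ((2 + 4 * C) * \<epsilon>\<^sup>2)"
  proof -
    have "ennreal ((2 + 4 * C) * \<epsilon>\<^sup>2) = ennreal 2 * ennreal (\<epsilon>\<^sup>2) + ennreal 2 * (ennreal C * (ennreal 2 * ennreal (\<epsilon>\<^sup>2)))"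
    proof -
      have "(2 + 4 * C) * \<epsilon>\<^sup>2 = 2 * \<epsilon>\<^sup>2 + 2 * (C * (2 * \<epsilon>\<^sup>2))" by (simp add: algebra_simps)
      also have "ennreal \<dots> = ennreal (2 * \<epsilon>\<^sup>2) + ennreal (2 * (C * (2 * \<epsilon>\<^sup>2)))"
        using C by (intro ennreal_plus) auto
      finally show ?thesis
        using C by (simp only: ennreal_mult zero_le_power2 mult_nonneg_nonneg zero_le_numeral)
    qed
    moreover have "ennreal (4 * C) * ?E u' = ennreal 2 * (ennreal C * (ennreal 2 * ?E u'))"
    proof -
      have "4 * C = 2 * (C * 2)" by simp
      then have "ennreal (4 * C) = ennreal 2 * (ennreal C * ennreal 2)"
        using C by (simp only: ennreal_mult mult_nonneg_nonneg zero_le_numeral)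
      then show ?thesis by (simp add: mult.assoc)
    qed
    ultimately show ?thesis by (simp only: distrib_left ac_simps)
  qed
  finally show "ssq u' \<le> ennreal (4 * C) * ?E u' + ennreal e" using \<epsilon>(2) by (simp add: mult_left_mono)
qed

end

section \<open>Completeness\<close>

lemma fatou_bound:
  fixes f :: "nat \<Rightarrow> 'a \<Rightarrow> real"
  assumes [measurable]: "\<And>j. f j \<in> borel_measurable M"
    and lim: "\<And>x. (\<lambda>j. f j x) \<longlonglongrightarrow> g x" and c: "\<And>j. (\<integral>\<^sup>+x. ennreal (f j x) \<partial>M) \<le> c"
  shows "(\<integral>\<^sup>+x. ennreal (g x) \<partial>M) \<le> c"
proof -
  have "(\<integral>\<^sup>+x. ennreal (g x) \<partial>M) = (\<integral>\<^sup>+x. liminf (\<lambda>j. ennreal (f j x)) \<partial>M)"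
    by (intro nn_integral_cong lim_imp_Liminf[symmetric] tendsto_ennrealI lim) simp
  also have "\<dots> \<le> liminf (\<lambda>j. \<integral>\<^sup>+x. ennreal (f j x) \<partial>M)"
    by (rule nn_integral_liminf) measurable
  also have "\<dots> \<le> liminf (\<lambda>j::nat. c)"
    by (rule Liminf_mono) (simp add: c)
  also have "\<dots> = c" by (simp add: Liminf_const)
  finally show ?thesis .
qed

context localization
begin

lemma W_space_rep:
  assumes "u \<in> W_space \<Omega> R \<eta>"
  shows "\<exists>u'. rep \<Omega> u u'"
  using assms by (intro rep_exists dom_borel) (auto simp: W_space_def)

lemma W0_imp_W: "u \<in> W0_space \<Omega> R \<eta> \<Longrightarrow> u \<in> W_space \<Omega> R \<eta>"
  by (simp add: W0_space_def)

lemma W_space_combine: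
  assumes "u \<in> W_space \<Omega> R \<eta>" "v \<in> W_space \<Omega> R \<eta>"
  shows "(\<lambda>x. a * u x + b * v x) \<in> W_space \<Omega> R \<eta>"
proof -
  obtain u' v' where r: "rep \<Omega> u u'" "rep \<Omega> v v'" using W_space_rep assms by blast
  have "W_norm2 \<Omega> R \<eta> (\<lambda>x. a * u x + b * v x) \<le> ennreal (2 * a\<^sup>2) * W_norm2 \<Omega> R \<eta> u + ennreal (2 * b\<^sup>2) * W_norm2 \<Omega> R \<eta> v"
    by (rule W_norm2_combine_le[OF r])
  also have "\<dots> < \<infinity>" using assms by (auto simp: W_space_def ennreal_mult_less_top)
  finally show ?thesis using assms by (auto simp: W_space_def)
qed

lemma W0_space_combine:
  assumes u: "u \<in> W0_space \<Omega> R \<eta>" and v: "v \<in> W0_space \<Omega> R \<eta>"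
  shows "(\<lambda>x. a * u x + b * v x) \<in> W0_space \<Omega> R \<eta>"
proof -
  note W = W0_imp_W[OF u] W0_imp_W[OF v]
  obtain u' v' where r: "rep \<Omega> u u'" "rep \<Omega> v v'" using W_space_rep W by blast
  have "\<exists>\<phi>. test_function \<Omega> \<phi> \<and> W_norm2 \<Omega> R \<eta> (\<lambda>x. (a * u x + b * v x) - \<phi> x) < ennreal (\<epsilon>\<^sup>2)" if "0 < \<epsilon>" for \<epsilon>
  proof -
    define c where "c = 2 * a\<^sup>2 + 2 * b\<^sup>2 + 1"
    have c: "1 \<le> c" by (simp add: c_def)
    define e where "e = \<epsilon> / sqrt c"
    have e: "0 < e" "c * e\<^sup>2 = \<epsilon>\<^sup>2" using c that by (auto simp: e_def power_divide)
    obtain \<phi>1 \<phi>2 where p: "test_function \<Omega> \<phi>1" "W_norm2 \<Omega> R \<eta> (\<lambda>x. u x - \<phi>1 x) < ennreal (e\<^sup>2)"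
      "test_function \<Omega> \<phi>2" "W_norm2 \<Omega> R \<eta> (\<lambda>x. v x - \<phi>2 x) < ennreal (e\<^sup>2)"
      using u v e(1) unfolding W0_space_def by blast
    have "W_norm2 \<Omega> R \<eta> (\<lambda>x. (a * u x + b * v x) - (a * \<phi>1 x + b * \<phi>2 x)) = W_norm2 \<Omega> R \<eta> (\<lambda>x. a * (u x - \<phi>1 x) + b * (v x - \<phi>2 x))"
      by (simp add: algebra_simps)
    also have "\<dots> \<le> ennreal (2 * a\<^sup>2) * W_norm2 \<Omega> R \<eta> (\<lambda>x. u x - \<phi>1 x) + ennreal (2 * b\<^sup>2) * W_norm2 \<Omega> R \<eta> (\<lambda>x. v x - \<phi>2 x)"
      by (rule W_norm2_combine_le[OF rep_diff[OF r(1) test_function_rep[OF p(1)]] rep_diff[OF r(2) test_function_rep[OF p(3)]]])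
    also have "\<dots> \<le> ennreal (2 * a\<^sup>2) * ennreal (e\<^sup>2) + ennreal (2 * b\<^sup>2) * ennreal (e\<^sup>2)"
      using p by (intro add_mono mult_left_mono) auto
    also have "\<dots> = ennreal ((c - 1) * e\<^sup>2)"
      by (simp add: c_def distrib_right ennreal_mult)
    also have "\<dots> < ennreal (\<epsilon>\<^sup>2)"
      using c e by (intro ennreal_lessI) (auto simp: left_diff_distrib)
    finally show ?thesis using test_function_combine[OF p(1,3)] by blast
  qed
  then show ?thesis using W_space_combine[OF W] unfolding W0_space_def by blast
qed

lemma W_norm_sq:
  assumes "u \<in> W_space \<Omega> R \<eta>"
  shows "ennreal ((W_norm \<Omega> R \<eta> u)\<^sup>2) = W_norm2 \<Omega> R \<eta> u"
  using assms by (simp add: W_norm_def W_space_def ennreal_enn2real)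

lemma W_norm_nonneg: "0 \<le> W_norm \<Omega> R \<eta> u"
  by (simp add: W_norm_def)

lemma W_norm_scale:
  assumes "u \<in> W_space \<Omega> R \<eta>"
  shows "W_norm \<Omega> R \<eta> (\<lambda>x. c * u x) = \<bar>c\<bar> * W_norm \<Omega> R \<eta> u"
proof -
  obtain u' where r: "rep \<Omega> u u'" using W_space_rep assms by blast
  note [measurable] = rep_measurable[OF r]
  have [measurable]: "(indicator {..R} :: real \<Rightarrow> real) \<in> borel_measurable borel" by simp
  have "ssq (\<lambda>x. c * u' x) = ennreal (c\<^sup>2) * ssq u'"
    unfolding ssq_def by (subst nn_integral_cmult[symmetric]) (auto simp: power_mult_distrib ennreal_mult)
  moreover have "energy \<Omega> \<eta> (indicator {..R}) (\<lambda>x. c * u' x) = ennreal (c\<^sup>2) * energy \<Omega> \<eta> (indicator {..R}) u'"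
  proof -
    have "ennreal (akernel \<Omega> \<eta> (indicator {..R}) x y * (c * u' x - c * u' y)\<^sup>2)
      = ennreal (c\<^sup>2) * ennreal (akernel \<Omega> \<eta> (indicator {..R}) x y * (u' x - u' y)\<^sup>2)" for x y
    proof -
      have "akernel \<Omega> \<eta> (indicator {..R}) x y * (c * u' x - c * u' y)\<^sup>2 = c\<^sup>2 * (akernel \<Omega> \<eta> (indicator {..R}) x y * (u' x - u' y)\<^sup>2)"
        by (simp add: power_mult_distrib flip: right_diff_distrib)
      then show ?thesis by (simp only: ennreal_mult'[OF zero_le_power2])
    qed
    then show ?thesis unfolding energy_def by (simp add: nn_integral_cmult)
  qed
  ultimately have "W_norm2 \<Omega> R \<eta> (\<lambda>x. c * u x) = ennreal (c\<^sup>2) * W_norm2 \<Omega> R \<eta> u"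
    unfolding W_norm2_rep[OF rep_scale[OF r]] W_norm2_rep[OF r] by (simp add: distrib_left)
  then show ?thesis by (simp add: W_norm_def enn2real_mult real_sqrt_mult)
qed

text \<open>The Riesz-Fischer argument: a rapidly converging subsequence has increments that are
  summable in the mean, because \<Omega> has finite measure, and so converges almost everywhere.
  Fatou's lemma transfers the Cauchy bound to the limit, for both parts of the norm.\<close>

lemma W0_complete:
  assumes X: "\<And>n::nat. X n \<in> W0_space \<Omega> R \<eta>"
    and cauchy: "\<And>e. 0 < e \<Longrightarrow> \<exists>N. \<forall>m\<ge>N. \<forall>n\<ge>N. W_norm2 \<Omega> R \<eta> (\<lambda>x. X m x - X n x) \<le> ennreal e"
  shows "\<exists>u\<in>W0_space \<Omega> R \<eta>. \<forall>e>0. \<exists>N. \<forall>n\<ge>N. W_norm2 \<Omega> R \<eta> (\<lambda>x. X n x - u x) \<le> ennreal e"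
proof -
  have "\<forall>k. \<exists>N. \<forall>m\<ge>N. \<forall>n\<ge>N. W_norm2 \<Omega> R \<eta> (\<lambda>x. X m x - X n x) \<le> ennreal ((1/4) ^ k)"
    using cauchy by simp
  then obtain N where N: "\<And>k m n. N k \<le> m \<Longrightarrow> N k \<le> n \<Longrightarrow> W_norm2 \<Omega> R \<eta> (\<lambda>x. X m x - X n x) \<le> ennreal ((1/4) ^ k)"
    by metis
  \<comment> \<open>Partial sums make the indices monotone while each stays above the threshold
    \<open>N k\<close>.\<close>
  define \<sigma> where "\<sigma> = (\<lambda>k. \<Sum>i\<le>k. N i)"
  have \<sigma>N: "N k \<le> \<sigma> k" for k unfolding \<sigma>_def by (rule member_le_sum) auto
  have \<sigma>mono: "\<sigma> k \<le> \<sigma> j" if "k \<le> j" for k j unfolding \<sigma>_def using that by (intro sum_mono2) auto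
  have close: "W_norm2 \<Omega> R \<eta> (\<lambda>x. X (\<sigma> k) x - X n x) \<le> ennreal ((1/4) ^ k)" if "\<sigma> k \<le> n" for k n
    using N[of k "\<sigma> k" n] \<sigma>N[of k] that by simp
  have "\<forall>k. \<exists>y. rep \<Omega> (X (\<sigma> k)) y" using W_space_rep W0_imp_W X by blast
  then obtain Y where Y: "\<And>k. rep \<Omega> (X (\<sigma> k)) (Y k)" by metis
  have [measurable]: "Y k \<in> borel_measurable borel" for k by (rule rep_measurable[OF Y])
  define D where "D = (\<lambda>k x. Y k x - Y (Suc k) x)"
  have [measurable]: "D k \<in> borel_measurable borel" for k unfolding D_def by measurable
  have Dssq: "ssq (D k) \<le> ennreal ((1/4) ^ k)" for k
  proof -
    have n: "ssq (D k) + energy \<Omega> \<eta> (indicator {..R}) (D k) \<le> ennreal ((1/4) ^ k)"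
      using close[OF \<sigma>mono, of k "Suc k"] unfolding W_norm2_rep[OF rep_diff[OF Y Y]] D_def by simp
    show ?thesis by (rule order_trans[OF _ n]) simp
  qed
  have D0: "D k x = 0" if "x \<notin> \<Omega>" for k x using rep_zero[OF Y that] by (simp add: D_def)
  define \<mu> where "\<mu> = measure lborel \<Omega>"
  have \<mu>: "emeasure lborel \<Omega> = ennreal \<mu>" unfolding \<mu>_def
    using emeasure_bounded_finite[OF bounded_dom] by (simp add: emeasure_eq_ennreal_measure less_top)
  have \<mu>0: "0 \<le> \<mu>" by (simp add: \<mu>_def)
  have Dint: "(\<integral>\<^sup>+x. ennreal \<bar>D k x\<bar> \<partial>lborel) \<le> ennreal ((1 + \<mu>) * (1/2) ^ k)" for k
  proof -
    \<comment> \<open>The weights are balanced: as the squared norm of \<open>D k\<close> is at most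
      \<open>(1/4) ^ k\<close>, both terms contribute a multiple of
      \<open>(1/2) ^ k\<close>.\<close>
    have p: "\<bar>d\<bar> \<le> 2 ^ k * d\<^sup>2 + (1/2) ^ k" for d :: real
    proof -
      have "2 * (2 ^ k * \<bar>d\<bar>) * 1 \<le> (2 ^ k * \<bar>d\<bar>)\<^sup>2 + 1\<^sup>2" by (rule sum_squares_bound)
      moreover have "0 \<le> 2 ^ k * \<bar>d\<bar>" by simp
      ultimately have "2 ^ k * \<bar>d\<bar> \<le> (2 ^ k * \<bar>d\<bar>)\<^sup>2 + 1" unfolding one_power2 by linarith
      then have "(1/2) ^ k * (2 ^ k * \<bar>d\<bar>) \<le> (1/2) ^ k * ((2 ^ k * \<bar>d\<bar>)\<^sup>2 + 1)" by (intro mult_left_mono) auto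
      then show ?thesis by (simp add: power_one_over power2_eq_square field_simps)
    qed
    have "ennreal \<bar>D k x\<bar> \<le> ennreal (2 ^ k) * ennreal ((D k x)\<^sup>2) + ennreal ((1/2) ^ k) * indicator \<Omega> x" for x
    proof (cases "x \<in> \<Omega>")
      case True
      have "ennreal \<bar>D k x\<bar> \<le> ennreal (2 ^ k * (D k x)\<^sup>2 + (1/2) ^ k)" by (rule ennreal_leI[OF p])
      also have "\<dots> = ennreal (2 ^ k) * ennreal ((D k x)\<^sup>2) + ennreal ((1/2) ^ k)"
        by (subst ennreal_plus) (simp_all only: ennreal_mult zero_le_power2 mult_nonneg_nonneg zero_le_numeral zero_le_power zero_le_divide_1_iff)
      finally show ?thesis using True by simp
    qed (simp add: D0)
    then have "(\<integral>\<^sup>+x. ennreal \<bar>D k x\<bar> \<partial>lborel) \<le> (\<integral>\<^sup>+x. ennreal (2 ^ k) * ennreal ((D k x)\<^sup>2) + ennreal ((1/2) ^ k) * indicator \<Omega> x \<partial>lborel)"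
      by (rule nn_integral_mono)
    also have "\<dots> = ennreal (2 ^ k) * ssq (D k) + ennreal ((1/2) ^ k) * ennreal \<mu>"
      by (subst nn_integral_add) (auto simp: nn_integral_cmult nn_integral_cmult_indicator ssq_def \<mu>)
    also have "\<dots> \<le> ennreal (2 ^ k) * ennreal ((1/4) ^ k) + ennreal ((1/2) ^ k) * ennreal \<mu>"
      by (intro add_mono mult_left_mono Dssq) auto
    also have "\<dots> = ennreal (2 ^ k * (1/4) ^ k + (1/2) ^ k * \<mu>)"
      using \<mu>0 by (simp add: ennreal_mult)
    also have "2 ^ k * (1/4) ^ k + (1/2) ^ k * \<mu> = (1 + \<mu>) * (1/2) ^ k"
      by (simp add: distrib_right flip: power_mult_distrib)
    finally show ?thesis .
  qed
  have "(\<integral>\<^sup>+x. (\<Sum>k. ennreal \<bar>D k x\<bar>) \<partial>lborel) = (\<Sum>k. \<integral>\<^sup>+x. ennreal \<bar>D k x\<bar> \<partial>lborel)"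
    by (rule nn_integral_suminf) measurable
  also have "\<dots> \<le> (\<Sum>k. ennreal ((1 + \<mu>) * (1/2) ^ k))"
    by (intro suminf_le Dint) auto
  also have "\<dots> = ennreal (\<Sum>k. (1 + \<mu>) * (1/2) ^ k)"
    using \<mu>0 by (intro suminf_ennreal2 summable_mult summable_geometric) auto
  finally have "(\<integral>\<^sup>+x. (\<Sum>k. ennreal \<bar>D k x\<bar>) \<partial>lborel) \<noteq> \<infinity>"
    by (auto simp: top_unique)
  then have "AE x in lborel. (\<Sum>k. ennreal \<bar>D k x\<bar>) \<noteq> \<infinity>"
    by (intro nn_integral_PInf_AE) auto
  then have conv: "AE x in lborel. convergent (\<lambda>k. Y k x)"
  proof eventually_elim
    case (elim x)
    then have "summable (\<lambda>k. \<bar>D k x\<bar>)" by (intro summable_suminf_not_top) auto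
    then have "summable (\<lambda>k. D k x)" by (rule summable_rabs_cancel)
    then have "convergent (\<lambda>n. \<Sum>k<n. D k x)" by (simp add: summable_iff_convergent)
    moreover have "(\<Sum>k<n. D k x) = Y 0 x - Y n x" for n by (induction n) (auto simp: D_def)
    ultimately have "convergent (\<lambda>n. Y 0 x - Y n x)" by simp
    then show "convergent (\<lambda>k. Y k x)" using convergent_diff[OF convergent_const[of "Y 0 x"]] by fastforce
  qed
  \<comment> \<open>Setting the sequence to 0 where it diverges keeps the representatives valid and
    gives pointwise convergence everywhere, so Fatou applies without exceptional sets.\<close>
  define Z where "Z = (\<lambda>k x. if convergent (\<lambda>k. Y k x) then Y k x else 0)"
  have "Measurable.pred borel (\<lambda>x. Cauchy (\<lambda>k. Y k x))"
    unfolding pred_def by (rule sets_Collect_Cauchy) measurable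
  then have [measurable]: "Measurable.pred borel (\<lambda>x. convergent (\<lambda>k. Y k x))"
    by (simp add: Cauchy_convergent_iff)
  have Zm [measurable]: "Z k \<in> borel_measurable borel" for k unfolding Z_def by measurable
  have Z: "rep \<Omega> (X (\<sigma> k)) (Z k)" for k
    unfolding rep_def
  proof (intro conjI)
    show "AE x in lborel. x \<in> \<Omega> \<longrightarrow> X (\<sigma> k) x = Z k x"
      using rep_AE[OF Y, of k] conv by eventually_elim (auto simp: Z_def)
  qed (auto simp: Z_def rep_zero[OF Y])
  define u where "u = (\<lambda>x. lim (\<lambda>k. Z k x))"
  have lim: "(\<lambda>k. Z k x) \<longlonglongrightarrow> u x" for x
  proof -
    have "convergent (\<lambda>k. Z k x)" by (cases "convergent (\<lambda>k. Y k x)") (auto simp: Z_def convergent_const)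
    then show ?thesis by (simp add: u_def convergent_LIMSEQ_iff)
  qed
  have um [measurable]: "u \<in> borel_measurable borel"
    by (rule borel_measurable_LIMSEQ_real[where u = Z]) (use lim in auto)
  have u0: "u x = 0" if "x \<notin> \<Omega>" for x
    using that by (simp add: u_def rep_zero[OF Z])
  have ru: "rep \<Omega> u u" using u0 by (simp add: rep_def)
  have uW: "W_norm2 \<Omega> R \<eta> (\<lambda>x. X (\<sigma> k) x - u x) \<le> ennreal (2 * (1/4) ^ k)" for k
  proof -
    have [measurable]: "(indicator {..R} :: real \<Rightarrow> real) \<in> borel_measurable borel" by simp
    define d where "d = (\<lambda>j x. Z k x - Z (k + j) x)"
    have [measurable]: "d j \<in> borel_measurable borel" for j unfolding d_def by measurable
    have dlim: "(\<lambda>j. d j x) \<longlonglongrightarrow> Z k x - u x" for x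
      unfolding d_def using LIMSEQ_ignore_initial_segment[OF lim, of k x]
      by (intro tendsto_intros) (simp add: add.commute)
    have dn: "ssq (d j) + energy \<Omega> \<eta> (indicator {..R}) (d j) \<le> ennreal ((1/4) ^ k)" for j
      using close[OF \<sigma>mono, of k "k + j"] unfolding W_norm2_rep[OF rep_diff[OF Z Z]] d_def by simp
    have d1: "ssq (d j) \<le> ennreal ((1/4) ^ k)" and d2: "energy \<Omega> \<eta> (indicator {..R}) (d j) \<le> ennreal ((1/4) ^ k)" for j
      using dn[of j] by (auto intro: order_trans[OF _ dn[of j]])
    have "ssq (\<lambda>x. Z k x - u x) \<le> ennreal ((1/4) ^ k)"
      unfolding ssq_def by (rule fatou_bound[where f = "\<lambda>j x. (d j x)\<^sup>2"])
        (auto intro!: tendsto_intros dlim d1[unfolded ssq_def])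
    moreover have "energy \<Omega> \<eta> (indicator {..R}) (\<lambda>x. Z k x - u x) \<le> ennreal ((1/4) ^ k)"
    proof (subst energy_prod)
      show "(\<integral>\<^sup>+p. ennreal (akernel \<Omega> \<eta> (indicator {..R}) (fst p) (snd p) * ((Z k (fst p) - u (fst p)) - (Z k (snd p) - u (snd p)))\<^sup>2) \<partial>(lborel \<Otimes>\<^sub>M lborel)) \<le> ennreal ((1/4) ^ k)"
      proof (rule fatou_bound[where f = "\<lambda>j p. akernel \<Omega> \<eta> (indicator {..R}) (fst p) (snd p) * (d j (fst p) - d j (snd p))\<^sup>2"])
        show "(\<lambda>p. akernel \<Omega> \<eta> (indicator {..R}) (fst p) (snd p) * (d j (fst p) - d j (snd p))\<^sup>2) \<in> borel_measurable (lborel \<Otimes>\<^sub>M lborel)" for j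
          by measurable
        show "(\<integral>\<^sup>+p. ennreal (akernel \<Omega> \<eta> (indicator {..R}) (fst p) (snd p) * (d j (fst p) - d j (snd p))\<^sup>2) \<partial>(lborel \<Otimes>\<^sub>M lborel)) \<le> ennreal ((1/4) ^ k)" for j
          using d2[of j] by (subst (asm) energy_prod) auto
      qed (intro tendsto_intros dlim)
    qed measurable
    ultimately have "W_norm2 \<Omega> R \<eta> (\<lambda>x. X (\<sigma> k) x - u x) \<le> ennreal ((1/4) ^ k) + ennreal ((1/4) ^ k)"
      unfolding W_norm2_rep[OF rep_diff[OF Z ru]] by (rule add_mono)
    also have "\<dots> = ennreal (2 * (1/4) ^ k)" by (simp flip: ennreal_plus)
    finally show ?thesis .
  qed
  \<comment> \<open>6 covers the larger of the two later needs, \<open>2 * 2 + 2\<close>; the other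
    one is \<open>2 * 2\<close>.\<close>
  have small: "\<exists>k. 6 * (1/4) ^ k < e" if "0 < e" for e :: real
    using real_arch_pow_inv[of "e / 6" "1/4"] that by (auto simp: mult.commute)
  have diff_le: "W_norm2 \<Omega> R \<eta> (\<lambda>x. v x - w x) \<le> 2 * W_norm2 \<Omega> R \<eta> v + 2 * W_norm2 \<Omega> R \<eta> w"
    if "rep \<Omega> v v'" "rep \<Omega> w w'" for v v' w w'
    using W_norm2_combine_le[OF that, of R 1 "- 1"] by simp
  have uW0: "u \<in> W0_space \<Omega> R \<eta>"
  proof -
    have "u \<in> borel_measurable (lebesgue_on \<Omega>)"
      by (intro measurable_restrict_space1 measurable_completion) simp
    moreover have "W_norm2 \<Omega> R \<eta> u < \<infinity>"
    proof -
      have "W_norm2 \<Omega> R \<eta> u = W_norm2 \<Omega> R \<eta> (\<lambda>x. X (\<sigma> 0) x - (X (\<sigma> 0) x - u x))" by simp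
      also have "\<dots> \<le> 2 * W_norm2 \<Omega> R \<eta> (X (\<sigma> 0)) + 2 * W_norm2 \<Omega> R \<eta> (\<lambda>x. X (\<sigma> 0) x - u x)"
        by (rule diff_le[OF Z rep_diff[OF Z ru]])
      also have "\<dots> \<le> 2 * W_norm2 \<Omega> R \<eta> (X (\<sigma> 0)) + 2 * ennreal (2 * (1/4) ^ 0)"
        by (intro add_mono mult_left_mono uW) auto
      also have "\<dots> < \<infinity>" using W0_imp_W[OF X, of "\<sigma> 0"] by (auto simp: W_space_def ennreal_mult_less_top)
      finally show ?thesis .
    qed
    moreover have "\<exists>\<phi>. test_function \<Omega> \<phi> \<and> W_norm2 \<Omega> R \<eta> (\<lambda>x. u x - \<phi> x) < ennreal (\<epsilon>\<^sup>2)" if "0 < \<epsilon>" for \<epsilon>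
    proof -
      have half: "0 < \<epsilon> / 2" using that by simp
      have "0 < \<epsilon>\<^sup>2 / 2" using that by simp
      from small[OF this] obtain k where k: "6 * (1/4) ^ k < \<epsilon>\<^sup>2 / 2" by blast
      obtain \<phi> where \<phi>: "test_function \<Omega> \<phi>" "W_norm2 \<Omega> R \<eta> (\<lambda>x. X (\<sigma> k) x - \<phi> x) < ennreal ((\<epsilon> / 2)\<^sup>2)"
        using X[of "\<sigma> k"] half unfolding W0_space_def by blast
      have "W_norm2 \<Omega> R \<eta> (\<lambda>x. u x - \<phi> x) = W_norm2 \<Omega> R \<eta> (\<lambda>x. (X (\<sigma> k) x - \<phi> x) - (X (\<sigma> k) x - u x))" by simp
      also have "\<dots> \<le> 2 * W_norm2 \<Omega> R \<eta> (\<lambda>x. X (\<sigma> k) x - \<phi> x) + 2 * W_norm2 \<Omega> R \<eta> (\<lambda>x. X (\<sigma> k) x - u x)"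
        by (rule diff_le[OF rep_diff[OF Z test_function_rep[OF \<phi>(1)]] rep_diff[OF Z ru]])
      also have "\<dots> \<le> ennreal 2 * ennreal ((\<epsilon> / 2)\<^sup>2) + ennreal 2 * ennreal (2 * (1/4) ^ k)"
        unfolding ennreal_numeral using \<phi>(2) by (intro add_mono mult_left_mono uW) auto
      also have "\<dots> = ennreal (2 * (\<epsilon> / 2)\<^sup>2 + 2 * (2 * (1/4) ^ k))"
        by (subst (1 2) ennreal_mult[symmetric]) (auto simp flip: ennreal_plus)
      also have "\<dots> < ennreal (\<epsilon>\<^sup>2)"
      proof (rule ennreal_lessI)
        show "0 < \<epsilon>\<^sup>2" using that by simp
        have "2 * (\<epsilon> / 2)\<^sup>2 = \<epsilon>\<^sup>2 / 2" by (simp add: power_divide)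
        moreover have "0 < (1/4 :: real) ^ k" by simp
        ultimately show "2 * (\<epsilon> / 2)\<^sup>2 + 2 * (2 * (1/4) ^ k) < \<epsilon>\<^sup>2" using k by linarith
      qed
      finally show ?thesis using \<phi>(1) by blast
    qed
    ultimately show ?thesis unfolding W0_space_def W_space_def by blast
  qed
  have "\<exists>N. \<forall>n\<ge>N. W_norm2 \<Omega> R \<eta> (\<lambda>x. X n x - u x) \<le> ennreal e" if e: "0 < e" for e
  proof -
    obtain k where k: "6 * (1/4) ^ k < e" using small[OF e] by blast
    have "W_norm2 \<Omega> R \<eta> (\<lambda>x. X n x - u x) \<le> ennreal e" if n: "\<sigma> k \<le> n" for n
    proof -
      obtain x' where x': "rep \<Omega> (X n) x'" using W_space_rep[OF W0_imp_W[OF X]] by blast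
      have "W_norm2 \<Omega> R \<eta> (\<lambda>x. X n x - u x) = W_norm2 \<Omega> R \<eta> (\<lambda>x. (X (\<sigma> k) x - u x) - (X (\<sigma> k) x - X n x))" by simp
      also have "\<dots> \<le> 2 * W_norm2 \<Omega> R \<eta> (\<lambda>x. X (\<sigma> k) x - u x) + 2 * W_norm2 \<Omega> R \<eta> (\<lambda>x. X (\<sigma> k) x - X n x)"
        by (rule diff_le[OF rep_diff[OF Z ru] rep_diff[OF Z x']])
      also have "\<dots> \<le> ennreal 2 * ennreal (2 * (1/4) ^ k) + ennreal 2 * ennreal ((1/4) ^ k)"
        unfolding ennreal_numeral by (intro add_mono mult_left_mono uW close n) auto
      also have "\<dots> = ennreal (2 * (2 * (1/4) ^ k) + 2 * (1/4) ^ k)"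
        by (subst (1 2) ennreal_mult[symmetric]) (auto simp flip: ennreal_plus)
      also have "\<dots> \<le> ennreal e" using k by (intro ennreal_leI) simp
      finally show ?thesis .
    qed
    then show ?thesis by blast
  qed
  then show ?thesis using uW0 by blast
qed

end

section \<open>Well-posedness\<close>

text \<open>The interface between the estimates and the Hilbert space argument: the upper bound
  holds for all Borel functions, the lower bound only on the closure of the test functions, which
  excludes nonzero constants.\<close>

locale nonlocal_form = localization +
  fixes \<rho> :: "real \<Rightarrow> real" and R C1 C2 :: real
  assumes kernel_measurable [measurable]: "(\<lambda>t. \<rho> (max 0 t)) \<in> borel_measurable borel"
    and kernel_nonneg: "0 \<le> \<rho> (max 0 t)"
    and C1: "0 \<le> C1" and C2: "0 \<le> C2"
    and energy_upper: "u \<in> borel_measurable borel \<Longrightarrow>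
      energy \<Omega> \<eta> (\<lambda>t. \<rho> (max 0 t)) u \<le> ennreal C1 * energy \<Omega> \<eta> (indicator {..R}) u"
    and energy_coercive: "u \<in> W0_space \<Omega> R \<eta> \<Longrightarrow> rep \<Omega> u u' \<Longrightarrow>
      W_norm2 \<Omega> R \<eta> u \<le> ennreal C2 * energy \<Omega> \<eta> (\<lambda>t. \<rho> (max 0 t)) u'"
begin

abbreviation "\<psi> \<equiv> \<lambda>t. \<rho> (max 0 t)"
abbreviation "sym_kernel p \<equiv> (akernel \<Omega> \<eta> \<psi> (fst p) (snd p) + akernel \<Omega> \<eta> \<psi> (snd p) (fst p)) / 2"
abbreviation "B \<equiv> B_form \<Omega> \<rho> \<eta>"
abbreviation "nrm \<equiv> W_norm \<Omega> R \<eta>"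
abbreviation "V \<equiv> W0_space \<Omega> R \<eta>"

lemma sym_kernel_nonneg: "0 \<le> sym_kernel p"
  by (intro divide_nonneg_nonneg add_nonneg_nonneg akernel_nonneg kernel_nonneg) simp

text \<open>The squared increment is symmetric, so symmetrizing the kernel does not change the
  energy. This lets bounds for the one-sided kernel apply to \<open>B_form\<close>.\<close>

lemma energy_symmetric:
  assumes [measurable]: "u \<in> borel_measurable borel"
  shows "(\<integral>\<^sup>+p. ennreal (sym_kernel p * (u (fst p) - u (snd p))\<^sup>2) \<partial>(lborel \<Otimes>\<^sub>M lborel)) = energy \<Omega> \<eta> \<psi> u"
proof -
  define f where "f = (\<lambda>x y. ennreal (akernel \<Omega> \<eta> \<psi> x y * (u x - u y)\<^sup>2))"
  have [measurable]: "(\<lambda>p. f (a p) (b p)) \<in> borel_measurable M"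
    if [measurable]: "a \<in> M \<rightarrow>\<^sub>M borel" "b \<in> M \<rightarrow>\<^sub>M borel" for a b and M :: "'b measure"
    unfolding f_def by measurable
  have p: "ennreal (sym_kernel p * (u (fst p) - u (snd p))\<^sup>2) = ennreal (1/2) * f (fst p) (snd p) + ennreal (1/2) * f (snd p) (fst p)" for p
  proof -
    have k: "0 \<le> akernel \<Omega> \<eta> \<psi> x y" for x y by (rule akernel_nonneg[OF kernel_nonneg])
    have "sym_kernel p * (u (fst p) - u (snd p))\<^sup>2 = 1/2 * (akernel \<Omega> \<eta> \<psi> (fst p) (snd p) * (u (fst p) - u (snd p))\<^sup>2)
      + 1/2 * (akernel \<Omega> \<eta> \<psi> (snd p) (fst p) * (u (snd p) - u (fst p))\<^sup>2)"
      by (simp add: power2_commute[of "u (snd p)"] add_divide_distrib distrib_right)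
    also have "ennreal \<dots> = ennreal (1/2 * (akernel \<Omega> \<eta> \<psi> (fst p) (snd p) * (u (fst p) - u (snd p))\<^sup>2))
      + ennreal (1/2 * (akernel \<Omega> \<eta> \<psi> (snd p) (fst p) * (u (snd p) - u (fst p))\<^sup>2))"
      using k by (intro ennreal_plus) auto
    finally show ?thesis unfolding f_def by (subst (1 2) ennreal_mult'[symmetric]) auto
  qed
  have E: "energy \<Omega> \<eta> \<psi> u = (\<integral>\<^sup>+x. \<integral>\<^sup>+y. f x y \<partial>lborel \<partial>lborel)"
    by (simp add: energy_def f_def)
  have E1: "(\<integral>\<^sup>+p. f (fst p) (snd p) \<partial>(lborel \<Otimes>\<^sub>M lborel)) = energy \<Omega> \<eta> \<psi> u"
    unfolding E using lborel.nn_integral_fst[of "\<lambda>p. f (fst p) (snd p)" lborel] by simp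
  have "(\<integral>\<^sup>+p. f (snd p) (fst p) \<partial>(lborel \<Otimes>\<^sub>M lborel)) = (\<integral>\<^sup>+x. \<integral>\<^sup>+y. f y x \<partial>lborel \<partial>lborel)"
    using lborel.nn_integral_fst[of "\<lambda>p. f (snd p) (fst p)" lborel] by simp
  also have "\<dots> = (\<integral>\<^sup>+y. \<integral>\<^sup>+x. f y x \<partial>lborel \<partial>lborel)"
    by (rule lborel_pair.Fubini') measurable
  finally have E2: "(\<integral>\<^sup>+p. f (snd p) (fst p) \<partial>(lborel \<Otimes>\<^sub>M lborel)) = energy \<Omega> \<eta> \<psi> u" by (simp add: E)
  have "(\<integral>\<^sup>+p. ennreal (sym_kernel p * (u (fst p) - u (snd p))\<^sup>2) \<partial>(lborel \<Otimes>\<^sub>M lborel))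
     = ennreal (1/2) * energy \<Omega> \<eta> \<psi> u + ennreal (1/2) * energy \<Omega> \<eta> \<psi> u"
    unfolding p by (subst nn_integral_add) (simp_all add: nn_integral_cmult E1 E2)
  also have "\<dots> = (ennreal (1/2) + ennreal (1/2)) * energy \<Omega> \<eta> \<psi> u" by (simp only: distrib_right)
  also have "ennreal (1/2) + ennreal (1/2) = 1" by (subst ennreal_plus[symmetric]) auto
  finally show ?thesis by simp
qed

lemma square_integrable:
  assumes [measurable]: "u \<in> borel_measurable borel" and "energy \<Omega> \<eta> \<psi> u < \<infinity>"
  shows "integrable (lborel \<Otimes>\<^sub>M lborel) (\<lambda>p. sym_kernel p * (u (fst p) - u (snd p))\<^sup>2)"
proof (rule integrableI_nonneg)
  show "(\<lambda>p. sym_kernel p * (u (fst p) - u (snd p))\<^sup>2) \<in> borel_measurable (lborel \<Otimes>\<^sub>M lborel)" by measurable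
  show "AE p in lborel \<Otimes>\<^sub>M lborel. 0 \<le> sym_kernel p * (u (fst p) - u (snd p))\<^sup>2"
    using sym_kernel_nonneg by (intro AE_I2 mult_nonneg_nonneg) auto
  show "(\<integral>\<^sup>+p. ennreal (sym_kernel p * (u (fst p) - u (snd p))\<^sup>2) \<partial>(lborel \<Otimes>\<^sub>M lborel)) < \<infinity>"
    unfolding energy_symmetric[OF assms(1)] by (rule assms(2))
qed

lemma form_integrable:
  assumes [measurable]: "u \<in> borel_measurable borel" "v \<in> borel_measurable borel"
    and "energy \<Omega> \<eta> \<psi> u < \<infinity>" "energy \<Omega> \<eta> \<psi> v < \<infinity>"
  shows "integrable (lborel \<Otimes>\<^sub>M lborel) (\<lambda>p. sym_kernel p * (u (fst p) - u (snd p)) * (v (fst p) - v (snd p)))"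
proof (rule Bochner_Integration.integrable_bound)
  show "integrable (lborel \<Otimes>\<^sub>M lborel) (\<lambda>p. sym_kernel p * (u (fst p) - u (snd p))\<^sup>2 + sym_kernel p * (v (fst p) - v (snd p))\<^sup>2)"
    by (intro Bochner_Integration.integrable_add square_integrable assms)
  show "AE p in lborel \<Otimes>\<^sub>M lborel. norm (sym_kernel p * (u (fst p) - u (snd p)) * (v (fst p) - v (snd p)))
    \<le> norm (sym_kernel p * (u (fst p) - u (snd p))\<^sup>2 + sym_kernel p * (v (fst p) - v (snd p))\<^sup>2)"
  proof (rule AE_I2)
    fix p :: "'a \<times> 'a"
    define a where "a = u (fst p) - u (snd p)"
    define b where "b = v (fst p) - v (snd p)"
    have "2 * \<bar>a\<bar> * \<bar>b\<bar> \<le> \<bar>a\<bar>\<^sup>2 + \<bar>b\<bar>\<^sup>2" by (rule sum_squares_bound)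
    moreover have "0 \<le> \<bar>a\<bar> * \<bar>b\<bar>" by simp
    ultimately have "\<bar>a * b\<bar> \<le> a\<^sup>2 + b\<^sup>2" unfolding abs_mult power2_abs by linarith
    from mult_left_mono[OF this sym_kernel_nonneg[of p]]
    have "norm (sym_kernel p * a * b) \<le> norm (sym_kernel p * a\<^sup>2 + sym_kernel p * b\<^sup>2)"
      using sym_kernel_nonneg[of p] by (simp only: real_norm_def abs_mult abs_of_nonneg distrib_left mult.assoc zero_le_power2 add_nonneg_nonneg mult_nonneg_nonneg)
    then show "norm (sym_kernel p * (u (fst p) - u (snd p)) * (v (fst p) - v (snd p)))
      \<le> norm (sym_kernel p * (u (fst p) - u (snd p))\<^sup>2 + sym_kernel p * (v (fst p) - v (snd p))\<^sup>2)"
      by (simp only: a_def b_def)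
  qed
qed measurable

lemma energy_finite:
  assumes "u \<in> W_space \<Omega> R \<eta>" "rep \<Omega> u u'"
  shows "energy \<Omega> \<eta> \<psi> u' < \<infinity>"
proof -
  have "energy \<Omega> \<eta> (indicator {..R}) u' \<le> W_norm2 \<Omega> R \<eta> u" unfolding W_norm2_rep[OF assms(2)] by simp
  also have "\<dots> < \<infinity>" using assms(1) by (simp add: W_space_def)
  finally have "ennreal C1 * energy \<Omega> \<eta> (indicator {..R}) u' < \<infinity>" by (simp add: ennreal_mult_less_top)
  then show ?thesis using energy_upper[OF rep_measurable[OF assms(2)]] by (rule le_less_trans[rotated])
qed

lemma B_bilin:
  assumes "u \<in> W_space \<Omega> R \<eta>" "v \<in> W_space \<Omega> R \<eta>" "rep \<Omega> u u'" "rep \<Omega> v v'"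
  shows "B u v = bilin \<Omega> \<eta> \<psi> u' v'"
    and "integrable (lborel \<Otimes>\<^sub>M lborel) (\<lambda>p. sym_kernel p * (u' (fst p) - u' (snd p)) * (v' (fst p) - v' (snd p)))"
proof -
  show i: "integrable (lborel \<Otimes>\<^sub>M lborel) (\<lambda>p. sym_kernel p * (u' (fst p) - u' (snd p)) * (v' (fst p) - v' (snd p)))"
    using assms by (intro form_integrable energy_finite) (auto simp: rep_measurable)
  show "B u v = bilin \<Omega> \<eta> \<psi> u' v'"
    by (rule B_form_rep[OF kernel_measurable assms(3,4) i])
qed

lemma B_self:
  assumes "u \<in> W_space \<Omega> R \<eta>" "rep \<Omega> u u'"
  shows "ennreal (B u u) = energy \<Omega> \<eta> \<psi> u'" "0 \<le> B u u"
proof -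
  note [measurable] = rep_measurable[OF assms(2)]
  have "B u u = (\<integral>p. sym_kernel p * (u' (fst p) - u' (snd p))\<^sup>2 \<partial>(lborel \<Otimes>\<^sub>M lborel))"
    unfolding B_bilin(1)[OF assms(1,1,2,2)] bilin_def by (simp add: power2_eq_square mult.assoc)
  moreover have "ennreal (\<integral>p. sym_kernel p * (u' (fst p) - u' (snd p))\<^sup>2 \<partial>(lborel \<Otimes>\<^sub>M lborel)) = energy \<Omega> \<eta> \<psi> u'"
    unfolding energy_symmetric[OF rep_measurable[OF assms(2)], symmetric]
    using sym_kernel_nonneg
    by (intro nn_integral_eq_integral[symmetric] square_integrable energy_finite[OF assms] rep_measurable[OF assms(2)]) (auto intro!: AE_I2 mult_nonneg_nonneg)
  moreover have "0 \<le> (\<integral>p. sym_kernel p * (u' (fst p) - u' (snd p))\<^sup>2 \<partial>(lborel \<Otimes>\<^sub>M lborel))"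
    using sym_kernel_nonneg by (intro Bochner_Integration.integral_nonneg mult_nonneg_nonneg) auto
  ultimately show "ennreal (B u u) = energy \<Omega> \<eta> \<psi> u'" "0 \<le> B u u" by (simp_all only:)
qed

lemma coercive:
  assumes "u \<in> V"
  shows "W_norm2 \<Omega> R \<eta> u \<le> ennreal (C2 * B u u)" "(nrm u)\<^sup>2 \<le> C2 * B u u"
proof -
  note w = W0_imp_W[OF assms]
  obtain u' where r: "rep \<Omega> u u'" using W_space_rep[OF w] by blast
  show 1: "W_norm2 \<Omega> R \<eta> u \<le> ennreal (C2 * B u u)"
    using energy_coercive[OF assms r] C2 B_self[OF w r] by (simp add: ennreal_mult)
  show "(nrm u)\<^sup>2 \<le> C2 * B u u"
    using 1 C2 B_self(2)[OF w r] unfolding W_norm_sq[OF w, symmetric] by (subst (asm) ennreal_le_iff) auto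
qed

lemma B_bounded:
  assumes "u \<in> W_space \<Omega> R \<eta>"
  shows "ennreal (B u u) \<le> ennreal C1 * W_norm2 \<Omega> R \<eta> u"
proof -
  obtain u' where r: "rep \<Omega> u u'" using W_space_rep[OF assms] by blast
  have "energy \<Omega> \<eta> \<psi> u' \<le> ennreal C1 * energy \<Omega> \<eta> (indicator {..R}) u'"
    by (rule energy_upper[OF rep_measurable[OF r]])
  also have "\<dots> \<le> ennreal C1 * W_norm2 \<Omega> R \<eta> u"
    unfolding W_norm2_rep[OF r] by (intro mult_left_mono) auto
  finally show ?thesis unfolding B_self(1)[OF assms r] .
qed

lemma zero_in_V: "(\<lambda>x. 0) \<in> V"
proof -
  have z: "W_norm2 \<Omega> R \<eta> (\<lambda>x. 0) = 0"
    using W_norm2_rep[OF test_function_rep[OF test_function_zero]] by (simp add: ssq_def energy_def)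
  show ?thesis
    unfolding W0_space_def W_space_def
    using z test_function_zero[of \<Omega>] by (auto intro!: exI[of _ "\<lambda>x. 0"])
qed

sublocale semi_inner V B
proof
  fix u v w :: "'a \<Rightarrow> real" and c :: real
  show "V \<noteq> {}" using zero_in_V by blast
  show "(\<lambda>x. u x + v x) \<in> V" if "u \<in> V" "v \<in> V"
    using W0_space_combine[OF that, of 1 1] by simp
  show scale: "(\<lambda>x. c * u x) \<in> V" if "u \<in> V"
    using W0_space_combine[OF that that, of c 0] by simp
  show "0 \<le> B u u" if "u \<in> V"
    using B_self(2) W_space_rep W0_imp_W[OF that] by blast
  show "B u v = B v u" if "u \<in> V" "v \<in> V"
  proof -
    note W = W0_imp_W[OF that(1)] W0_imp_W[OF that(2)]
    obtain u' v' where r: "rep \<Omega> u u'" "rep \<Omega> v v'" using W_space_rep W by blast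
    show ?thesis unfolding B_bilin(1)[OF W r] B_bilin(1)[OF W(2,1) r(2,1)] bilin_def by (simp add: mult_ac)
  qed
  show "B (\<lambda>x. u x + v x) w = B u w + B v w" if "u \<in> V" "v \<in> V" "w \<in> V"
  proof -
    note W = W0_imp_W[OF that(1)] W0_imp_W[OF that(2)] W0_imp_W[OF that(3)]
    obtain u' v' w' where r: "rep \<Omega> u u'" "rep \<Omega> v v'" "rep \<Omega> w w'" using W_space_rep W by metis
    have s: "(\<lambda>x. u x + v x) \<in> W_space \<Omega> R \<eta>" using W_space_combine[OF W(1,2), of 1 1] by simp
    have "K * ((a + c) - (b + d)) * e = K * (a - b) * e + K * (c - d) * e" for K a b c d e :: real
      by (simp add: algebra_simps)
    then show ?thesis
      unfolding B_bilin(1)[OF s W(3) rep_add[OF r(1,2)] r(3)] B_bilin(1)[OF W(1,3) r(1,3)] B_bilin(1)[OF W(2,3) r(2,3)] bilin_def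
      by (subst Bochner_Integration.integral_add[OF B_bilin(2)[OF W(1,3) r(1,3)] B_bilin(2)[OF W(2,3) r(2,3)], symmetric])
        (simp only:)
  qed
  show "B (\<lambda>x. c * u x) w = c * B u w" if "u \<in> V" "w \<in> V"
  proof -
    note W = W0_imp_W[OF that(1)] W0_imp_W[OF that(2)]
    obtain u' w' where r: "rep \<Omega> u u'" "rep \<Omega> w w'" using W_space_rep W by blast
    have "K * (c * a - c * b) * d = c * (K * (a - b) * d)" for K a b d :: real
      by (simp add: algebra_simps)
    then show ?thesis
      unfolding B_bilin(1)[OF W0_imp_W[OF scale[OF that(1)]] W(2) rep_scale[OF r(1)] r(2)] B_bilin(1)[OF W r] bilin_def
      by (simp only: integral_mult_right_zero)
  qed
qed

text \<open>The real supremum has to be shown bounded before it can serve as a bound. Vectors of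
  norm zero cannot be normalized; for them the bound with \<open>K\<close> gives
  \<open>f u = 0\<close>.\<close>

lemma dual_bound:
  assumes f: "f \<in> W0_dual \<Omega> R \<eta>" and u: "u \<in> V"
  shows "\<bar>f u\<bar> \<le> W0_dual_norm \<Omega> R \<eta> f * nrm u" "0 \<le> W0_dual_norm \<Omega> R \<eta> f"
proof -
  obtain K where K: "\<And>u. u \<in> V \<Longrightarrow> \<bar>f u\<bar> \<le> K * nrm u" using f unfolding W0_dual_def by blast
  have fs: "f (\<lambda>x. c * u x) = c * f u" if "u \<in> V" for c u using f that by (auto simp: W0_dual_def)
  have bdd: "bdd_above ((\<lambda>u. \<bar>f u\<bar>) ` {u \<in> V. nrm u \<le> 1})"
  proof (rule bdd_aboveI2)
    fix u assume "u \<in> {u \<in> V. nrm u \<le> 1}"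
    then have "\<bar>f u\<bar> \<le> K * nrm u" "nrm u \<le> 1" using K by auto
    moreover have "K * nrm u \<le> \<bar>K\<bar> * nrm u" by (intro mult_right_mono W_norm_nonneg) auto
    moreover have "\<bar>K\<bar> * nrm u \<le> \<bar>K\<bar> * 1" using \<open>nrm u \<le> 1\<close> by (intro mult_left_mono) auto
    ultimately show "\<bar>f u\<bar> \<le> \<bar>K\<bar>" by linarith
  qed
  have up: "\<bar>f v\<bar> \<le> W0_dual_norm \<Omega> R \<eta> f" if "v \<in> V" "nrm v \<le> 1" for v
    unfolding W0_dual_norm_def using that by (intro cSUP_upper[OF _ bdd]) auto
  show "0 \<le> W0_dual_norm \<Omega> R \<eta> f"
    using up[OF V_scale[OF u, of 0]] W_norm_scale[OF W0_imp_W[OF u], of 0] abs_ge_zero order_trans by fastforce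
  show "\<bar>f u\<bar> \<le> W0_dual_norm \<Omega> R \<eta> f * nrm u"
  proof (cases "nrm u = 0")
    case True
    then show ?thesis using K[OF u] by simp
  next
    case False
    then have p: "0 < nrm u" using W_norm_nonneg[of R u] by simp
    have "nrm (\<lambda>x. 1 / nrm u * u x) = 1"
      unfolding W_norm_scale[OF W0_imp_W[OF u]] using p by simp
    then have "\<bar>f (\<lambda>x. 1 / nrm u * u x)\<bar> \<le> W0_dual_norm \<Omega> R \<eta> f"
      by (intro up V_scale u) (simp only: order_refl)
    then have "\<bar>f u\<bar> / nrm u \<le> W0_dual_norm \<Omega> R \<eta> f"
      unfolding fs[OF u] using p by (simp add: abs_mult)
    then show ?thesis using p by (simp add: pos_divide_le_eq)
  qed
qed

lemma V_complete:
  assumes X: "\<And>n::nat. X n \<in> V"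
    and cauchy: "\<And>e. 0 < e \<Longrightarrow> \<exists>N. \<forall>m\<ge>N. \<forall>n\<ge>N. B (\<lambda>x. X m x - X n x) (\<lambda>x. X m x - X n x) < e"
  shows "\<exists>u\<in>V. (\<lambda>n. B (\<lambda>x. X n x - u x) (\<lambda>x. X n x - u x)) \<longlonglongrightarrow> 0"
proof -
  have "\<exists>u\<in>V. \<forall>e>0. \<exists>N. \<forall>n\<ge>N. W_norm2 \<Omega> R \<eta> (\<lambda>x. X n x - u x) \<le> ennreal e"
  proof (rule W0_complete[OF X])
    fix e :: real assume e: "0 < e"
    \<comment> \<open>Adding 1 avoids a division by zero, as \<open>C2\<close> is only known to be
      nonnegative.\<close>
    define e' where "e' = e / (C2 + 1)"
    have e': "0 < e'" using e C2 by (simp add: e'_def)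
    obtain N where N: "\<And>m n. N \<le> m \<Longrightarrow> N \<le> n \<Longrightarrow> B (\<lambda>x. X m x - X n x) (\<lambda>x. X m x - X n x) < e'"
      using cauchy[OF e'] by blast
    have "W_norm2 \<Omega> R \<eta> (\<lambda>x. X m x - X n x) \<le> ennreal e" if "N \<le> m" "N \<le> n" for m n
    proof -
      have "C2 * B (\<lambda>x. X m x - X n x) (\<lambda>x. X m x - X n x) \<le> C2 * e'"
        using N[OF that] C2 by (intro mult_left_mono) auto
      also have "\<dots> \<le> (C2 + 1) * e'" using e' by (intro mult_right_mono) auto
      also have "\<dots> = e" using C2 by (simp add: e'_def)
      finally show ?thesis using coercive(1)[OF V_diff[OF X X]] by (meson ennreal_leI order_trans)
    qed
    then show "\<exists>N. \<forall>m\<ge>N. \<forall>n\<ge>N. W_norm2 \<Omega> R \<eta> (\<lambda>x. X m x - X n x) \<le> ennreal e" by blast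
  qed
  then obtain u where u: "u \<in> V" and lim: "\<And>e. 0 < e \<Longrightarrow> \<exists>N. \<forall>n\<ge>N. W_norm2 \<Omega> R \<eta> (\<lambda>x. X n x - u x) \<le> ennreal e"
    by blast
  have "(\<lambda>n. B (\<lambda>x. X n x - u x) (\<lambda>x. X n x - u x)) \<longlonglongrightarrow> 0"
  proof (rule LIMSEQ_I)
    fix e :: real assume e: "0 < e"
    define e' where "e' = e / (C1 + 1)"
    have e': "0 < e'" using e C1 by (simp add: e'_def)
    obtain N where N: "\<And>n. N \<le> n \<Longrightarrow> W_norm2 \<Omega> R \<eta> (\<lambda>x. X n x - u x) \<le> ennreal e'" using lim[OF e'] by blast
    have "norm (B (\<lambda>x. X n x - u x) (\<lambda>x. X n x - u x) - 0) < e" if n: "N \<le> n" for n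
    proof -
      note d = V_diff[OF X u, of n]
      have "ennreal (B (\<lambda>x. X n x - u x) (\<lambda>x. X n x - u x)) \<le> ennreal C1 * ennreal e'"
        by (rule order_trans[OF B_bounded[OF W0_imp_W[OF d]]]) (intro mult_left_mono N n, simp)
      also have "\<dots> = ennreal (C1 * e')" using C1 e' by (simp add: ennreal_mult)
      finally have "B (\<lambda>x. X n x - u x) (\<lambda>x. X n x - u x) \<le> C1 * e'"
        using C1 e' by (subst (asm) ennreal_le_iff) auto
      also have "\<dots> < (C1 + 1) * e'" using e' by (intro mult_strict_right_mono) auto
      also have "\<dots> = e" using C1 by (simp add: e'_def)
      finally show ?thesis using B_pos[OF d] by simp
    qed
    then show "\<exists>N. \<forall>n\<ge>N. norm (B (\<lambda>x. X n x - u x) (\<lambda>x. X n x - u x) - 0) < e" by blast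
  qed
  then show ?thesis using u by blast
qed

text \<open>Completeness in the energy comes from its equivalence with the squared norm. Uniqueness
  tests the equation for the difference of two solutions with that difference; the energy estimate
  tests with \<open>u\<close> itself and cancels one factor \<open>nrm u\<close>.\<close>

lemma well_posed:
  assumes f: "f \<in> W0_dual \<Omega> R \<eta>"
  shows "\<exists>u. weak_solution \<Omega> R \<rho> \<eta> f u \<and>
    (\<forall>w. weak_solution \<Omega> R \<rho> \<eta> f w \<longrightarrow> (AE x in lebesgue_on \<Omega>. w x = u x)) \<and>
    nrm u \<le> C2 * W0_dual_norm \<Omega> R \<eta> f"
proof -
  define F where "F = W0_dual_norm \<Omega> R \<eta> f"
  have "\<exists>u\<in>V. \<forall>v\<in>V. B u v = f v"
  proof (rule riesz_representation)
    show "f (\<lambda>x. u x + v x) = f u + f v" if "u \<in> V" "v \<in> V" for u v using f that by (auto simp: W0_dual_def)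
    show "f (\<lambda>x. c * u x) = c * f u" if "u \<in> V" for u c using f that by (auto simp: W0_dual_def)
    show "(f u)\<^sup>2 \<le> (F\<^sup>2 * C2) * B u u" if u: "u \<in> V" for u
    proof -
      have "(f u)\<^sup>2 \<le> (F * nrm u)\<^sup>2"
        using dual_bound[OF f u] W_norm_nonneg[of R u] unfolding F_def by (simp add: abs_le_square_iff[symmetric] abs_mult)
      also have "\<dots> \<le> F\<^sup>2 * (C2 * B u u)"
        unfolding power_mult_distrib using coercive(2)[OF u] by (intro mult_left_mono) auto
      finally show ?thesis by (simp add: mult.assoc)
    qed
    show "0 \<le> F\<^sup>2 * C2" using C2 by simp
  qed (rule V_complete)
  then obtain u where u: "u \<in> V" and sol: "\<And>v. v \<in> V \<Longrightarrow> B u v = f v" by blast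
  have "AE x in lebesgue_on \<Omega>. w x = u x" if w: "weak_solution \<Omega> R \<rho> \<eta> f w" for w
  proof -
    have wV: "w \<in> V" and ws: "\<And>v. v \<in> V \<Longrightarrow> B w v = f v" using w by (auto simp: weak_solution_def)
    note d = V_diff[OF wV u]
    have "B (\<lambda>x. w x - u x) (\<lambda>x. w x - u x) = 0"
      using B_diff_left[OF wV u d] sol[OF d] ws[OF d] by simp
    then have z: "W_norm2 \<Omega> R \<eta> (\<lambda>x. w x - u x) = 0" using coercive(1)[OF d] by simp
    obtain d' where r: "rep \<Omega> (\<lambda>x. w x - u x) d'" using W_space_rep[OF W0_imp_W[OF d]] by blast
    have "ssq d' = 0" using z unfolding W_norm2_rep[OF r] by simp
    then have "AE x in lborel. ennreal ((d' x)\<^sup>2) = 0"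
      unfolding ssq_def using rep_measurable[OF r] by (subst (asm) nn_integral_0_iff_AE) auto
    then have "AE x in lborel. x \<in> \<Omega> \<longrightarrow> w x = u x"
      using rep_AE[OF r] by eventually_elim auto
    then have "AE x in lebesgue. x \<in> \<Omega> \<longrightarrow> w x = u x" by (rule AE_completion)
    then show ?thesis by (subst AE_restrict_space_iff) (auto simp: sets_completionI_sets)
  qed
  moreover have "nrm u \<le> C2 * F"
  proof (cases "nrm u = 0")
    case True
    then show ?thesis using C2 dual_bound(2)[OF f u] by (simp add: F_def)
  next
    case False
    then have p: "0 < nrm u" using W_norm_nonneg[of R u] by simp
    have "nrm u * nrm u \<le> C2 * f u" using coercive(2)[OF u] sol[OF u] by (simp add: power2_eq_square)
    also have "\<dots> \<le> C2 * (F * nrm u)" using dual_bound(1)[OF f u] C2 by (intro mult_left_mono) (auto simp: F_def)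
    finally have "nrm u * nrm u \<le> (C2 * F) * nrm u" by (simp add: mult.assoc)
    then show ?thesis using p by (simp only: mult_le_cancel_right_pos)
  qed
  ultimately show ?thesis using u sol unfolding weak_solution_def F_def by blast
qed

end

section \<open>Uniform constants and conclusion\<close>

theorem theorem5p2:
  fixes \<Omega> :: "'a::euclidean_space set"
    and \<kappa>0 \<kappa>1 \<kappa>2 \<kappa>bar R :: real
    and \<rho> :: "real \<Rightarrow> real"
  assumes "bounded_C2_domain \<Omega>"
    and "0 < \<kappa>0" "\<kappa>0 < 1" "0 < \<kappa>1" "0 < \<kappa>2" "0 < \<kappa>bar"
    and "admissible_kernel \<rho>"
    and "0 < R" "R < 1"
  shows "\<exists>C>0. \<forall>\<eta>. localization_functions \<Omega> \<kappa>0 \<kappa>1 \<kappa>2 \<kappa>bar \<eta> \<longrightarrow>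
    (\<forall>\<delta>. 0 < \<delta> \<and> \<delta> < delta0 \<kappa>1 \<kappa>bar \<longrightarrow>
      (\<forall>u\<in>W0_space \<Omega> R (\<eta> \<delta>). (W_norm \<Omega> R (\<eta> \<delta>) u)\<^sup>2 \<le> C * B_form \<Omega> \<rho> (\<eta> \<delta>) u u) \<and>
      (\<forall>f\<in>W0_dual \<Omega> R (\<eta> \<delta>).
        \<exists>u. weak_solution \<Omega> R \<rho> (\<eta> \<delta>) f u \<and>
            (\<forall>w. weak_solution \<Omega> R \<rho> (\<eta> \<delta>) f w \<longrightarrow> (AE x in lebesgue_on \<Omega>. w x = u x)) \<and>
            W_norm \<Omega> R (\<eta> \<delta>) u \<le> C * W0_dual_norm \<Omega> R (\<eta> \<delta>) f))"
proof -
  obtain \<rho>0 r0 R0 M where k: "0 < \<rho>0" "0 < r0" "r0 < 1" "0 < R0" "R0 < 1" "0 \<le> M"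
    "(\<lambda>t. \<rho> (max 0 t)) \<in> borel_measurable borel" "\<And>t. 0 \<le> \<rho> (max 0 t)"
    "\<And>t. 0 \<le> t \<Longrightarrow> \<rho> (max 0 t) \<le> M * indicator {..R0} t"
    "\<And>t. 0 \<le> t \<Longrightarrow> \<rho>0 * indicator {..r0} t \<le> \<rho> (max 0 t)"
    using admissible_kernel_bounds[OF assms(7)] by blast
  \<comment> \<open>Three changes of horizon: from the support of the kernel to \<open>R\<close> for
    boundedness, from \<open>R\<close> to the radius where the kernel is bounded below for
    coercivity, and from 1/4, the horizon of \<open>hat\<close>, to \<open>R\<close> for the
    Poincare inequality.\<close>
  note radius = energy_radius_constant[where 'a='a]
  obtain Ca where Ca: "0 \<le> Ca" "\<And>\<eta> G \<kappa> u. localization \<Omega> \<eta> G \<kappa> \<Longrightarrow> u \<in> borel_measurable borel \<Longrightarrow>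
    energy \<Omega> \<eta> (indicator {..R0}) u \<le> ennreal Ca * energy \<Omega> \<eta> (indicator {..R}) u"
    using radius[OF assms(8) k(4,5)] by blast
  obtain Cb where Cb: "0 \<le> Cb" "\<And>\<eta> G \<kappa> u. localization \<Omega> \<eta> G \<kappa> \<Longrightarrow> u \<in> borel_measurable borel \<Longrightarrow>
    energy \<Omega> \<eta> (indicator {..R}) u \<le> ennreal Cb * energy \<Omega> \<eta> (indicator {..r0}) u"
    using radius[OF k(2) assms(8,9)] by blast
  have quarter: "0 < (1/4 :: real)" "(1/4 :: real) < 1" by simp_all
  obtain Cc where Cc: "0 \<le> Cc" "\<And>\<eta> G \<kappa> u. localization \<Omega> \<eta> G \<kappa> \<Longrightarrow> u \<in> borel_measurable borel \<Longrightarrow>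
    energy \<Omega> \<eta> (indicator {..1/4}) u \<le> ennreal Cc * energy \<Omega> \<eta> (indicator {..R}) u"
    using radius[OF assms(8) quarter] by blast
  obtain Cp where Cp: "0 \<le> Cp" "\<And>\<eta> G u m U. localization \<Omega> \<eta> G \<kappa>2 \<Longrightarrow> u \<in> borel_measurable borel \<Longrightarrow>
    (\<forall>x. u x \<noteq> 0 \<longrightarrow> x \<in> \<Omega> \<and> m \<le> \<eta> x) \<Longrightarrow> 0 < m \<Longrightarrow> (\<forall>x. \<bar>u x\<bar> \<le> U) \<Longrightarrow>
    (\<integral>\<^sup>+x. ennreal ((u x)\<^sup>2) \<partial>lborel) \<le> ennreal Cp * energy \<Omega> \<eta> hat u"
    using poincare_constant[of \<Omega> \<kappa>2] assms(1,5) unfolding bounded_C2_domain_def by (meson less_imp_le)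
  \<comment> \<open>The first factor bounds the squared norm by the energy at horizon
    \<open>R\<close>, with 4 from \<open>W0_poincare\<close> and 1 for the seminorm; the second
    passes to the energy of \<rho>. The final summand makes the constant positive.\<close>
  define C2 where "C2 = (4 * (Cp * Cc) + 1) * (Cb * (1 / \<rho>0)) + 1"
  have C2: "0 < C2" using Cp(1) Cc(1) Cb(1) k(1) by (auto simp: C2_def intro!: add_nonneg_pos)
  have main: "nonlocal_form \<Omega> (\<eta> \<delta>) (gradient (\<eta> \<delta>)) \<kappa>2 \<rho> R (M * Ca) C2"
    if loc: "localization_functions \<Omega> \<kappa>0 \<kappa>1 \<kappa>2 \<kappa>bar \<eta>" and \<delta>: "0 < \<delta>" "\<delta> < delta0 \<kappa>1 \<kappa>bar" for \<eta> \<delta>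
  proof -
    let ?e = "\<eta> \<delta>" and ?\<psi> = "\<lambda>t. \<rho> (max 0 t)"
    have L: "localization \<Omega> ?e (gradient ?e) \<kappa>2"
      by (rule localization_of_functions[OF assms(1) loc assms(4,5,6) \<delta>])
    interpret localization \<Omega> ?e "gradient ?e" \<kappa>2 by (rule L)
    have im: "(indicator {..s} :: real \<Rightarrow> real) \<in> borel_measurable borel" for s :: real by simp
    have upper: "energy \<Omega> ?e ?\<psi> u \<le> ennreal (M * Ca) * energy \<Omega> ?e (indicator {..R}) u"
      if u: "u \<in> borel_measurable borel" for u
    proof -
      have "energy \<Omega> ?e ?\<psi> u \<le> ennreal M * energy \<Omega> ?e (indicator {..R0}) u"
        by (rule energy_mono[OF im u k(6,9)])
      also have "\<dots> \<le> ennreal M * (ennreal Ca * energy \<Omega> ?e (indicator {..R}) u)"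
        by (intro mult_left_mono Ca(2)[OF L u]) simp
      finally show ?thesis using k(6) Ca(1) by (simp add: ennreal_mult mult.assoc)
    qed
    have lower: "energy \<Omega> ?e (indicator {..R}) u \<le> ennreal (Cb * (1 / \<rho>0)) * energy \<Omega> ?e ?\<psi> u"
      if u: "u \<in> borel_measurable borel" for u
    proof -
      have "energy \<Omega> ?e (indicator {..r0}) u \<le> ennreal (1 / \<rho>0) * energy \<Omega> ?e ?\<psi> u"
        using k(1,10) by (intro energy_mono[OF k(7) u]) (auto simp: field_simps)
      then have "ennreal Cb * energy \<Omega> ?e (indicator {..r0}) u \<le> ennreal Cb * (ennreal (1 / \<rho>0) * energy \<Omega> ?e ?\<psi> u)"
        by (intro mult_left_mono) auto
      then have "energy \<Omega> ?e (indicator {..R}) u \<le> ennreal Cb * (ennreal (1 / \<rho>0) * energy \<Omega> ?e ?\<psi> u)"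
        by (rule order_trans[OF Cb(2)[OF L u]])
      then show ?thesis using k(1) Cb(1) by (simp only: ennreal_mult mult.assoc zero_le_divide_1_iff less_imp_le)
    qed
    have test: "ssq \<phi> \<le> ennreal (Cp * Cc) * energy \<Omega> ?e (indicator {..R}) \<phi>" if tf: "test_function \<Omega> \<phi>" for \<phi>
    proof -
      note \<phi> = rep_measurable[OF test_function_rep[OF tf]]
      obtain m U where "0 < m" "\<forall>x. \<phi> x \<noteq> 0 \<longrightarrow> x \<in> \<Omega> \<and> m \<le> ?e x" "\<forall>x. \<bar>\<phi> x\<bar> \<le> U"
        using test_function_support[OF tf] by blast
      then have "ssq \<phi> \<le> ennreal Cp * energy \<Omega> ?e hat \<phi>"
        unfolding ssq_def by (intro Cp(2)[OF L \<phi>]) auto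
      also have "energy \<Omega> ?e hat \<phi> \<le> ennreal 1 * energy \<Omega> ?e (indicator {..1/4}) \<phi>"
        by (rule energy_mono[OF im \<phi>]) (auto simp: indicator_def hat_def)
      also have "energy \<Omega> ?e (indicator {..1/4}) \<phi> \<le> ennreal Cc * energy \<Omega> ?e (indicator {..R}) \<phi>"
        by (rule Cc(2)[OF L \<phi>])
      finally have "ssq \<phi> \<le> ennreal Cp * (ennreal 1 * (ennreal Cc * energy \<Omega> ?e (indicator {..R}) \<phi>))"
        by (simp add: mult_left_mono)
      then show ?thesis using Cp(1) Cc(1) by (simp add: ennreal_mult mult.assoc)
    qed
    have coer: "W_norm2 \<Omega> R ?e u \<le> ennreal C2 * energy \<Omega> ?e ?\<psi> u'"
      if u: "u \<in> W0_space \<Omega> R ?e" and r: "rep \<Omega> u u'" for u u'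
    proof -
      have "ssq u' \<le> ennreal (4 * (Cp * Cc)) * energy \<Omega> ?e (indicator {..R}) u'"
        by (rule W0_poincare[OF _ test u r]) (use Cp(1) Cc(1) in simp)
      then have "W_norm2 \<Omega> R ?e u \<le> ennreal (4 * (Cp * Cc)) * energy \<Omega> ?e (indicator {..R}) u' + energy \<Omega> ?e (indicator {..R}) u'"
        unfolding W_norm2_rep[OF r] by (rule add_right_mono)
      also have "\<dots> = ennreal (4 * (Cp * Cc) + 1) * energy \<Omega> ?e (indicator {..R}) u'"
        using Cp(1) Cc(1) by (simp add: distrib_right)
      also have "\<dots> \<le> ennreal (4 * (Cp * Cc) + 1) * (ennreal (Cb * (1 / \<rho>0)) * energy \<Omega> ?e ?\<psi> u')"
        by (intro mult_left_mono lower rep_measurable[OF r]) simp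
      also have "\<dots> = ennreal ((4 * (Cp * Cc) + 1) * (Cb * (1 / \<rho>0))) * energy \<Omega> ?e ?\<psi> u'"
        using Cp(1) Cc(1) by (subst ennreal_mult') (auto simp: mult.assoc)
      also have "\<dots> \<le> ennreal C2 * energy \<Omega> ?e ?\<psi> u'"
        by (intro mult_right_mono ennreal_leI) (auto simp: C2_def)
      finally show ?thesis .
    qed
    show ?thesis
    proof unfold_locales
      show "0 \<le> M * Ca" using k(6) Ca(1) by simp
    qed (use k(7,8) C2 upper coer in auto)
  qed
  show ?thesis
  proof (intro exI[of _ C2] conjI allI impI ballI C2)
    fix \<eta> \<delta> assume h: "localization_functions \<Omega> \<kappa>0 \<kappa>1 \<kappa>2 \<kappa>bar \<eta>" "0 < \<delta> \<and> \<delta> < delta0 \<kappa>1 \<kappa>bar"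
    interpret nonlocal_form \<Omega> "\<eta> \<delta>" "gradient (\<eta> \<delta>)" \<kappa>2 \<rho> R "M * Ca" C2
      using main h by blast
    show "(W_norm \<Omega> R (\<eta> \<delta>) u)\<^sup>2 \<le> C2 * B_form \<Omega> \<rho> (\<eta> \<delta>) u u" if "u \<in> W0_space \<Omega> R (\<eta> \<delta>)" for u
      by (rule coercive(2)[OF that])
    show "\<exists>u. weak_solution \<Omega> R \<rho> (\<eta> \<delta>) f u \<and>
            (\<forall>w. weak_solution \<Omega> R \<rho> (\<eta> \<delta>) f w \<longrightarrow> (AE x in lebesgue_on \<Omega>. w x = u x)) \<and>
            W_norm \<Omega> R (\<eta> \<delta>) u \<le> C2 * W0_dual_norm \<Omega> R (\<eta> \<delta>) f" if "f \<in> W0_dual \<Omega> R (\<eta> \<delta>)" for f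
      by (rule well_posed[OF that])
  qed
qed

end
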